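(* Let $G$ be a polycyclic group with polycycle structure $((h_i)_i,(H_i)_i,(k_i)_i)$. Then there is an algorithm that, given an SFT $X$ on $G$ (by a finite set of forbidden patterns), safely computes a finite set of forbidden patterns that defines $X$ uniformly on all inductive intervals if $X$ is an II-avoshift; that is, whenever the algorithm gives an output, this output is a finite set $\mathcal P$ of patterns such that for every inductive interval $C$ the restriction $X|C$ is defined by $\mathcal P$, and the algorithm does give an output whenever $X$ is an II-avoshift. Furthermore, if $X$ is an II-avoshift, then for all $i$ the restriction $X|H_i$ is an II-avoshift on $H_i$ (with the inherited polycycle structure), and forbidden patterns for $X|H_i$ can be effectively computed.
   Context: Let $A$ be a finite alphabet; $G$ acts on $A^G$ by $(gx)_h=x_{g^{-1}h}$; a subshift is a closed $G$-invariant $X\subset A^G$. $X|C=\{x|C:x\in X\}$. A pattern is $P\in A^D$, $D\subset G$ finite; it occurs in $y\in A^S$ ($S\subset G$) if for some $g\in G$, $gD\subset S$ and $y_{gh}=P_h$ for $h\in D$. An SFT is the set of $x\in A^G$ in which no pattern from a given finite set occurs. A finite set $\mathcal P$ of patterns defines $X|C$ if for all $x\in A^C$: $x\in X|C$ iff no $P\in\mathcal P$ occurs in $x$. Avo: a subshift $X$ is avo for $C\subset G\setminus\{e\}$ if there is a finite $B\subset C$ such that for all $x\in X|C$ and $a\in A$: $(x|B)\sqcup a^e\in X|(B\cup\{e\})\iff x\sqcup a^e\in X|(C\cup\{e\})$, where $a^e$ is the pattern with domain $\{e\}$ and value $a$. An II-avoshift is a subshift that is avo for every inductive interval. Polycycle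 structure and inductive intervals: $1=H_0<H_1<\cdots<H_n=G$ are subgroups, each normal in the next, $H_i/H_{i-1}$ cyclic of order $k_i\le\infty$ generated by $h_iH_{i-1}$; $H_i$ inherits the structure given by $h_1,\dots,h_i$. An interval $I\subset\mathbb Z$ grazes $0$ if it has one of the forms $(-\infty,-1],[-m,-1],\emptyset,[1,m],[1,\infty)$. In $\mathbb Z_k$ ($k<\infty$) intervals are images of intervals of $\mathbb Z$, and such an interval grazes $0$ if it is empty, or contains $1$ or $-1$ but not $0$. An inductive interval (II) is a set $I\subset G$ determined by a tuple $(I_1,\dots,I_n)$, $I_i$ an interval grazing $0$ in $\mathbb Z_{k_i}$ (in $\mathbb Z$ if $k_i=\infty$): $e\notin I$, and for $g\neq e$, letting $i$ be least with $g\in H_i$ and $t$ the exponent with $g\in h_i^tH_{i-1}$, $g\in I$ iff $t\in I_i$. *)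

theory Defs
  imports "HOL-Analysis.Function_Topology" "HOL-Algebra.Generated_Groups"
    "HOL-Library.Nat_Bijection" "HOL-Library.Countable"
begin

section \<open>Configurations, patterns and subshifts\<close>

text \<open>
  Elements of $A^S$ are partial functions with domain exactly \<open>S\<close>; the alphabet $A$ is a finite
  type. Thus \<open>x |` C\<close> is the restriction of \<open>x\<close> to \<open>C\<close>, and \<open>x(e \<mapsto> a)\<close> is
  $x \sqcup a^e$ when \<open>e \<notin> dom x\<close>.
\<close>

type_synonym ('g, 'a) config = "'g \<Rightarrow> 'a option"

definition shift :: "('g, 'b) monoid_scheme \<Rightarrow> 'g \<Rightarrow> ('g, 'a) config \<Rightarrow> ('g, 'a) config" where
  "shift G g x = (\<lambda>h. if h \<in> carrier G then x (inv\<^bsub>G\<^esub> g \<otimes>\<^bsub>G\<^esub> h) else None)"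

definition restr :: "('g, 'a) config set \<Rightarrow> 'g set \<Rightarrow> ('g, 'a) config set" where
  "restr X C = (\<lambda>x. x |` C) ` X"

text \<open>
  The library's product topology lives on extensional total functions, so a set of
  configurations is transported along the obvious bijection.
\<close>

definition closed_configs :: "'g set \<Rightarrow> ('g, 'a) config set \<Rightarrow> bool" where
  "closed_configs S X \<longleftrightarrow>
     closedin (product_topology (\<lambda>_. discrete_topology UNIV) S) ((\<lambda>x. \<lambda>g\<in>S. the (x g)) ` X)"

definition subshift :: "('g, 'b) monoid_scheme \<Rightarrow> ('g, 'a::finite) config set \<Rightarrow> bool" where
  "subshift G X \<longleftrightarrow>
     (\<forall>x\<in>X. dom x = carrier G) \<and>
     closed_configs (carrier G) X \<and>
     (\<forall>g\<in>carrier G. \<forall>x\<in>X. shift G g x \<in> X)"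

definition pattern_set :: "('g, 'b) monoid_scheme \<Rightarrow> ('g, 'a::finite) config set \<Rightarrow> bool" where
  "pattern_set G F \<longleftrightarrow> finite F \<and> (\<forall>P\<in>F. finite (dom P) \<and> dom P \<subseteq> carrier G)"

definition occurs :: "('g, 'b) monoid_scheme \<Rightarrow> ('g, 'a) config \<Rightarrow> ('g, 'a) config \<Rightarrow> bool" where
  "occurs G P y \<longleftrightarrow>
     (\<exists>g\<in>carrier G. g <#\<^bsub>G\<^esub> dom P \<subseteq> dom y \<and> (\<forall>h\<in>dom P. y (g \<otimes>\<^bsub>G\<^esub> h) = P h))"

definition SFT :: "('g, 'b) monoid_scheme \<Rightarrow> ('g, 'a::finite) config set \<Rightarrow> ('g, 'a) config set" where
  "SFT G F = {x. dom x = carrier G \<and> \<not> (\<exists>P\<in>F. occurs G P x)}"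

definition defines_restr ::
    "('g, 'b) monoid_scheme \<Rightarrow> ('g, 'a::finite) config set \<Rightarrow> ('g, 'a) config set \<Rightarrow> 'g set \<Rightarrow> bool"
  where
  "defines_restr G Ps X C \<longleftrightarrow>
     (\<forall>x. dom x = C \<longrightarrow> (x \<in> restr X C \<longleftrightarrow> \<not> (\<exists>P\<in>Ps. occurs G P x)))"

definition avo :: "('g, 'b) monoid_scheme \<Rightarrow> ('g, 'a::finite) config set \<Rightarrow> 'g set \<Rightarrow> bool" where
  "avo G X C \<longleftrightarrow>
     (\<exists>B. finite B \<and> B \<subseteq> C \<and>
        (\<forall>x\<in>restr X C. \<forall>a.
           (x |` B)(\<one>\<^bsub>G\<^esub> \<mapsto> a) \<in> restr X (B \<union> {\<one>\<^bsub>G\<^esub>}) \<longleftrightarrow>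
           x(\<one>\<^bsub>G\<^esub> \<mapsto> a) \<in> restr X (C \<union> {\<one>\<^bsub>G\<^esub>})))"


section \<open>Polycycle structures and inductive intervals\<close>

text \<open>
  Here \<open>k i = 0\<close> stands for $k_i = \infty$; this is also the library's convention for
  \<open>order\<close>. The inclusions are not required to be proper (\<open>k i = 1\<close> is allowed). The structure
  inherited by \<open>H i\<close> is given by the same \<open>H\<close>, \<open>h\<close>, \<open>k\<close> with length \<open>i\<close>.
\<close>

definition polycycle_structure ::
    "('g, 'b) monoid_scheme \<Rightarrow> nat \<Rightarrow> (nat \<Rightarrow> 'g set) \<Rightarrow> (nat \<Rightarrow> 'g) \<Rightarrow> (nat \<Rightarrow> nat) \<Rightarrow> bool"
  where
  "polycycle_structure G n H h k \<longleftrightarrow>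
     group G \<and> H 0 = {\<one>\<^bsub>G\<^esub>} \<and> H n = carrier G \<and>
     (\<forall>i\<le>n. subgroup (H i) G) \<and>
     (\<forall>i\<in>{1..n}. H (i - 1) \<lhd> G\<lparr>carrier := H i\<rparr> \<and> h i \<in> H i \<and>
        (let Q = G\<lparr>carrier := H i\<rparr> Mod H (i - 1)
         in carrier Q = generate Q {h i <#\<^bsub>G\<^esub> H (i - 1)} \<and> order Q = k i))"

definition int_interval :: "int set \<Rightarrow> bool" where
  "int_interval I \<longleftrightarrow> (\<forall>a\<in>I. \<forall>b\<in>I. {a..b} \<subseteq> I)"

text \<open>Subsets of $\mathbb{Z}_k$, \<open>k\<close> finite, are represented by residues in \<open>{0..<k}\<close>.\<close>

definition grazing_interval :: "nat \<Rightarrow> int set \<Rightarrow> bool" where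
  "grazing_interval k J \<longleftrightarrow>
     (if k = 0 then
        J = {..-1} \<or> (\<exists>m\<ge>1. J = {-m..-1}) \<or> J = {} \<or> (\<exists>m\<ge>1. J = {1..m}) \<or> J = {1..}
      else
        (\<exists>I. int_interval I \<and> J = (\<lambda>t. t mod int k) ` I) \<and>
        (J = {} \<or> ((1 mod int k \<in> J \<or> (-1) mod int k \<in> J) \<and> 0 \<notin> J)))"

definition inductive_interval ::
    "('g, 'b) monoid_scheme \<Rightarrow> nat \<Rightarrow> (nat \<Rightarrow> 'g set) \<Rightarrow> (nat \<Rightarrow> 'g) \<Rightarrow> (nat \<Rightarrow> nat) \<Rightarrow> 'g set \<Rightarrow> bool"
  where
  "inductive_interval G n H h k C \<longleftrightarrow>
     (\<exists>J. (\<forall>i\<in>{1..n}. grazing_interval (k i) (J i)) \<and>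
        C = {g \<in> carrier G - {\<one>\<^bsub>G\<^esub>}.
               let i = (LEAST i. g \<in> H i)
               in \<exists>t\<in>J i. g \<in> (h i [^]\<^bsub>G\<^esub> t) <#\<^bsub>G\<^esub> H (i - 1)})"

definition II_avoshift ::
    "('g, 'b) monoid_scheme \<Rightarrow> nat \<Rightarrow> (nat \<Rightarrow> 'g set) \<Rightarrow> (nat \<Rightarrow> 'g) \<Rightarrow> (nat \<Rightarrow> nat) \<Rightarrow>
     ('g, 'a::finite) config set \<Rightarrow> bool"
  where
  "II_avoshift G n H h k X \<longleftrightarrow>
     subshift G X \<and> (\<forall>C. inductive_interval G n H h k C \<longrightarrow> avo G X C)"


section \<open>Algorithms: partial recursive functions\<close>

text \<open>
  An algorithm is a $\mu$-recursive program, with a big-step semantics. Programs carry no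
  arity; a program applied to too few arguments has no value.
\<close>

datatype recf = Zero | Succ | Proj nat | Comp recf "recf list" | PrimRec recf recf | Mu recf

inductive recf_eval :: "recf \<Rightarrow> nat list \<Rightarrow> nat \<Rightarrow> bool" where
  Zero: "recf_eval Zero xs 0"
| Succ: "recf_eval Succ (x # xs) (Suc x)"
| Proj: "i < length xs \<Longrightarrow> recf_eval (Proj i) xs (xs ! i)"
| Comp: "\<lbrakk>length ys = length gs; \<forall>i<length gs. recf_eval (gs ! i) xs (ys ! i); recf_eval f ys y\<rbrakk>
    \<Longrightarrow> recf_eval (Comp f gs) xs y"
| PrimRec_0: "recf_eval f xs y \<Longrightarrow> recf_eval (PrimRec f g) (0 # xs) y"
| PrimRec_Suc: "\<lbrakk>recf_eval (PrimRec f g) (m # xs) r; recf_eval g (m # r # xs) y\<rbrakk>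
    \<Longrightarrow> recf_eval (PrimRec f g) (Suc m # xs) y"
| Mu: "\<lbrakk>recf_eval f (m # xs) 0; \<forall>j<m. \<exists>z. recf_eval f (j # xs) (Suc z)\<rbrakk>
    \<Longrightarrow> recf_eval (Mu f) xs m"

inductive_cases recf_eval_ZeroE: "recf_eval Zero xs y"
inductive_cases recf_eval_SuccE: "recf_eval Succ xs y"
inductive_cases recf_eval_ProjE: "recf_eval (Proj i) xs y"
inductive_cases recf_eval_CompE: "recf_eval (Comp f gs) xs y"
inductive_cases recf_eval_PrimRec_0E: "recf_eval (PrimRec f g) (0 # xs) y"
inductive_cases recf_eval_PrimRec_SucE: "recf_eval (PrimRec f g) (Suc m # xs) y"
inductive_cases recf_eval_MuE: "recf_eval (Mu f) xs y"

lemma recf_eval_deterministic: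
  "recf_eval p xs y \<Longrightarrow> recf_eval p xs z \<Longrightarrow> y = z"
proof (induction p xs y arbitrary: z rule: recf_eval.induct)
  case (Zero xs)
  then show ?case by (rule recf_eval_ZeroE) simp
next
  case (Succ x xs)
  then show ?case by (rule recf_eval_SuccE) simp
next
  case (Proj i xs)
  from Proj.prems show ?case by (rule recf_eval_ProjE) simp
next
  case (Comp ys gs xs f y)
  from Comp.prems obtain zs where zs: "length zs = length gs"
      "\<forall>i<length gs. recf_eval (gs ! i) xs (zs ! i)" "recf_eval f zs z"
    by (rule recf_eval_CompE)
  have "ys = zs"
    using Comp.hyps(1) Comp.IH(1) zs by (intro nth_equalityI) auto
  then show ?case using Comp.IH zs(3) by blast
next
  case (PrimRec_0 f xs y g)
  from PrimRec_0.prems have "recf_eval f xs z" by (rule recf_eval_PrimRec_0E)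
  then show ?case by (rule PrimRec_0.IH)
next
  case (PrimRec_Suc f g m xs r y)
  from PrimRec_Suc.prems obtain s where
      "recf_eval (PrimRec f g) (m # xs) s" "recf_eval g (m # s # xs) z"
    by (rule recf_eval_PrimRec_SucE)
  then show ?case using PrimRec_Suc.IH by blast
next
  case (Mu f m xs)
  from Mu.prems have z: "recf_eval f (z # xs) 0" "\<forall>j<z. \<exists>w. recf_eval f (j # xs) (Suc w)"
    by (rule recf_eval_MuE, simp)+
  have "\<not> z < m" using Mu.IH(2) z(1) by (metis nat.distinct(1))
  moreover have "\<not> m < z" using Mu.IH(1) z(2) by (metis nat.distinct(1))
  ultimately show ?case by simp
qed


section \<open>Encoding group elements and patterns\<close>

text \<open>
  Every element is uniquely $h_n^{t_n} \cdots h_1^{t_1}$ with $t_i \in \mathbb{Z}$, and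
  $0 \le t_i < k_i$ when $k_i$ is finite. It is encoded by the list $(t_1, \dots, t_n)$.
\<close>

primrec polycyclic_prod ::
    "('g, 'b) monoid_scheme \<Rightarrow> (nat \<Rightarrow> 'g) \<Rightarrow> (nat \<Rightarrow> int) \<Rightarrow> nat \<Rightarrow> 'g" where
  "polycyclic_prod G h t 0 = \<one>\<^bsub>G\<^esub>"
| "polycyclic_prod G h t (Suc i) =
     (h (Suc i) [^]\<^bsub>G\<^esub> t (Suc i)) \<otimes>\<^bsub>G\<^esub> polycyclic_prod G h t i"

definition exponents_of ::
    "('g, 'b) monoid_scheme \<Rightarrow> nat \<Rightarrow> (nat \<Rightarrow> 'g) \<Rightarrow> (nat \<Rightarrow> nat) \<Rightarrow> 'g \<Rightarrow> int list \<Rightarrow> bool" where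
  "exponents_of G n h k g ts \<longleftrightarrow>
     (\<exists>t. (\<forall>i\<in>{1..n}. k i = 0 \<or> t i \<in> {0..<int (k i)}) \<and>
        ts = map t [1..<Suc n] \<and> g = polycyclic_prod G h t n)"

definition elem_code ::
    "('g, 'b) monoid_scheme \<Rightarrow> nat \<Rightarrow> (nat \<Rightarrow> 'g) \<Rightarrow> (nat \<Rightarrow> nat) \<Rightarrow> 'g \<Rightarrow> nat" where
  "elem_code G n h k g = list_encode (map int_encode (THE ts. exponents_of G n h k g ts))"

text \<open>
  A finite set is encoded by \<open>set_encode\<close>, a pattern as the finite set of its
  (position, letter) pairs. The numbering \<open>to_nat\<close> of the letters is an arbitrary injection;
  as the alphabet is finite, its choice does not affect computability.
\<close>

definition pattern_code ::
    "('g, 'b) monoid_scheme \<Rightarrow> nat \<Rightarrow> (nat \<Rightarrow> 'g) \<Rightarrow> (nat \<Rightarrow> nat) \<Rightarrow> ('g, 'a::finite) config \<Rightarrow> nat"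
  where
  "pattern_code G n h k P =
     set_encode {prod_encode (elem_code G n h k g, to_nat a) | g a. P g = Some a}"

definition patterns_code ::
    "('g, 'b) monoid_scheme \<Rightarrow> nat \<Rightarrow> (nat \<Rightarrow> 'g) \<Rightarrow> (nat \<Rightarrow> nat) \<Rightarrow> ('g, 'a::finite) config set \<Rightarrow> nat"
  where
  "patterns_code G n h k F = set_encode (pattern_code G n h k ` F)"

end

theory Submission
  imports Defs "HOL-Algebra.Multiplicative_Group"
begin

text \<open>
  The algorithm searches for a finite \<^emph>\<open>certificate\<close>, consisting of a candidate set \<open>Ps\<close> of patterns and a
  finite window \<open>B \<subseteq> G\<close>. A certificate can be checked by a finite computation, it guarantees that
  \<open>Ps\<close> defines \<open>X|C\<close> for every inductive interval \<open>C\<close>, and it exists if \<open>X\<close> is an II-avoshift.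
  The combinatorial core is a statement about the group alone.

  \<^bold>\<open>Building by one-point steps.\<close> An inductive interval is a union of layers; layer \<open>l\<close> consists of the
  cosets of \<open>H l\<close> by the powers of \<open>h (l + 1)\<close> whose exponents form an integer interval grazing 0.
  Suppose a further coset is to be filled, next to the cosets already present in layer \<open>l\<close>. After
  translation of this coset to \<open>H l\<close>, the exponents present in layer \<open>l\<close> graze 0, since the
  adjacent exponent has become 1 or -1, and the layers above are invariant under the translation.
  By induction on \<open>l\<close>, and by a union over countably many cosets, all the inclusions needed below are composed of
  translates of steps \<open>C \<subseteq> C \<union> {\<one>}\<close> with \<open>C\<close> an inductive interval. So a
  translation-invariant transitive relation that passes to increasing unions and holds for these steps
  holds between the empty set and an inductive interval (\<open>extend_empty\<close>), and from inductive
  intervals and from the subgroups \<open>H i\<close> to the whole group (\<open>extend_interval_to_carrier\<close>,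
  \<open>extend_H_to_carrier\<close>).

  \<^bold>\<open>Soundness\<close> (\<open>certificate_sound\<close>). A certificate shows that \<open>Ps\<close> and the given patterns exclude the
  same points of the full shift, and that a configuration on the part of an inductive interval
  \<open>C\<close> inside the window, free of \<open>Ps\<close> in the window, can be continued to \<open>\<one>\<close>. As the window contains
  everything that a pattern of \<open>Ps\<close> meeting \<open>\<one>\<close> can see, every configuration on all of \<open>C\<close> avoiding \<open>Ps\<close>
  can be continued to \<open>\<one>\<close>. Taking for the relation "every configuration on \<open>S\<close> avoiding \<open>Ps\<close> extends to one
  on \<open>S'\<close>", the building principle continues configurations on \<open>C\<close> to points of \<open>X\<close>.

  \<^bold>\<open>Completeness\<close> (\<open>certificate_complete\<close>). The tuples of grazing intervals form a compact space. If \<open>X\<close> is avo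
  for \<open>C\<close> through \<open>B\<close>, then every inductive interval close to \<open>C\<close> is a subset of \<open>C\<close> that contains \<open>B\<close>, and
  such a set is avo through the same \<open>B\<close>. By compactness one window works for all inductive
  intervals (\<open>uniformly_avo\<close>). Take as \<open>Ps\<close> all patterns on subsets of this window that are not
  patterns of \<open>X\<close> and whose domain is empty or contains \<open>\<one>\<close>. The building principle, now applied to the relation "a configuration on
  \<open>S'\<close> that avoids \<open>Ps\<close> and belongs to \<open>X\<close> on \<open>S\<close> belongs to \<open>X\<close> on \<open>S'\<close>" and started
  at the empty set, shows that avoiding \<open>Ps\<close> on \<open>C\<close> implies membership in \<open>X|C\<close>. Further compactness arguments provide
  a finite window on which all conditions on a certificate become visible.

  \<^bold>\<open>Computability\<close> (\<open>search_program\<close>). Multiplication is computable on exponent vectors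
  (\<open>multiplication_computable\<close>), and a finite window meets the inductive intervals in finitely many sets, which can be listed
  (\<open>all_one_step_extendable_iff\<close>). So certificates are decidable (\<open>certificate_code_iff\<close>), and an unbounded
  search over all pairs of a pattern set and a window is the desired algorithm.

  \<^bold>\<open>Restriction to\<close> \<open>H i\<close>. By soundness \<open>Ps\<close> also defines \<open>X|H i\<close>. Each nonempty pattern of \<open>Ps\<close> contains \<open>\<one>\<close>, so if it occurs
  in a configuration on \<open>H i\<close>, it is a pattern on \<open>H i\<close>; the patterns of \<open>Ps\<close> with domain inside \<open>H i\<close>
  therefore define \<open>X|H i\<close> as an SFT (\<open>restr_H_is_SFT\<close>). The inductive intervals of \<open>H i\<close> are those of \<open>G\<close> with
  empty upper layers, so the avo property is inherited (\<open>II_avoshift_H\<close>).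
\<close>

section \<open>Computable functions and decidable predicates\<close>

text \<open>
  Programs carry no arity, so the number of arguments for which a program has to give the value is fixed
  separately.
\<close>

definition rec_fun :: "nat \<Rightarrow> (nat list \<Rightarrow> nat) \<Rightarrow> bool" where
  "rec_fun m f \<longleftrightarrow> (\<exists>p. \<forall>xs. length xs = m \<longrightarrow> recf_eval p xs (f xs))"

lemma rec_fun_zero: "rec_fun m (\<lambda>xs. 0)"
  unfolding rec_fun_def by (blast intro: recf_eval.Zero)

lemma rec_fun_nth: "i < m \<Longrightarrow> rec_fun m (\<lambda>xs. xs ! i)"
  unfolding rec_fun_def by (metis recf_eval.Proj)

lemma rec_fun_compose:
  assumes "rec_fun (length fs) F" "\<forall>f\<in>set fs. rec_fun m f"
  shows "rec_fun m (\<lambda>xs. F (map (\<lambda>f. f xs) fs))"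
proof -
  obtain p where p: "\<And>ys. length ys = length fs \<Longrightarrow> recf_eval p ys (F ys)"
    using assms(1) unfolding rec_fun_def by blast
  obtain q where q: "\<And>f xs. f \<in> set fs \<Longrightarrow> length xs = m \<Longrightarrow> recf_eval (q f) xs (f xs)"
    using assms(2) unfolding rec_fun_def by metis
  show ?thesis
    unfolding rec_fun_def
    by (rule exI[of _ "Comp p (map q fs)"])
       (auto intro!: recf_eval.Comp[of "map (\<lambda>f. f xs) fs" for xs] p q)
qed

lemma rec_fun_compose1:
  assumes "rec_fun 1 (\<lambda>ys. F (ys ! 0))" "rec_fun m f"
  shows "rec_fun m (\<lambda>xs. F (f xs))"
  using rec_fun_compose[of "[f]" "\<lambda>ys. F (ys ! 0)" m] assms by simp

lemma rec_fun_compose2: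
  assumes "rec_fun 2 (\<lambda>ys. F (ys ! 0) (ys ! 1))" "rec_fun m f" "rec_fun m g"
  shows "rec_fun m (\<lambda>xs. F (f xs) (g xs))"
  using rec_fun_compose[of "[f, g]" "\<lambda>ys. F (ys ! 0) (ys ! 1)" m] assms by (simp add: numeral_2_eq_2)

lemma rec_fun_Suc: "rec_fun m f \<Longrightarrow> rec_fun m (\<lambda>xs. Suc (f xs))"
proof (rule rec_fun_compose1[of Suc])
  have "recf_eval Succ xs (Suc (xs ! 0))" if "length xs = 1" for xs
    using that recf_eval.Succ[of "xs ! 0" "[]"] by (cases xs) auto
  then show "rec_fun 1 (\<lambda>ys. Suc (ys ! 0))" unfolding rec_fun_def by blast
qed

lemma rec_fun_rec_nat:
  assumes "rec_fun 1 (\<lambda>ys. a (ys ! 0))" "rec_fun 3 (\<lambda>ys. s (ys ! 0) (ys ! 1) (ys ! 2))"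
  shows "rec_fun 2 (\<lambda>ys. rec_nat (a (ys ! 1)) (\<lambda>i r. s i r (ys ! 1)) (ys ! 0))"
proof -
  obtain p where p: "\<And>ys. length ys = 1 \<Longrightarrow> recf_eval p ys (a (ys ! 0))"
    using assms(1) unfolding rec_fun_def by blast
  obtain q where q: "\<And>ys. length ys = 3 \<Longrightarrow> recf_eval q ys (s (ys ! 0) (ys ! 1) (ys ! 2))"
    using assms(2) unfolding rec_fun_def by blast
  have "recf_eval (PrimRec p q) [m, x] (rec_nat (a x) (\<lambda>i r. s i r x) m)" for m x
  proof (induction m)
    case 0
    then show ?case using p[of "[x]"] by (auto intro: recf_eval.PrimRec_0)
  next
    case (Suc m)
    then show ?case using q[of "[m, rec_nat (a x) (\<lambda>i r. s i r x) m, x]"]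
      by (auto intro: recf_eval.PrimRec_Suc)
  qed
  moreover have "xs = [xs ! 0, xs ! 1]" if "length xs = 2" for xs :: "nat list"
    using that by (auto simp: numeral_2_eq_2 length_Suc_conv)
  ultimately have "recf_eval (PrimRec p q) xs (rec_nat (a (xs ! 1)) (\<lambda>i r. s i r (xs ! 1)) (xs ! 0))"
    if "length xs = 2" for xs
    using that by metis
  then show ?thesis unfolding rec_fun_def by blast
qed

lemma rec_fun_Least:
  assumes "rec_fun 2 (\<lambda>ys. F (ys ! 0) (ys ! 1))" "\<And>x. \<exists>i. F i x = 0"
  shows "rec_fun 1 (\<lambda>ys. LEAST i. F i (ys ! 0) = 0)"
proof -
  obtain p where p: "\<And>ys. length ys = 2 \<Longrightarrow> recf_eval p ys (F (ys ! 0) (ys ! 1))"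
    using assms(1) unfolding rec_fun_def by blast
  have p': "recf_eval p [i, x] (F i x)" for i x using p[of "[i, x]"] by simp
  have "recf_eval (Mu p) [x] (LEAST i. F i x = 0)" for x
  proof (rule recf_eval.Mu)
    show "recf_eval p [LEAST i. F i x = 0, x] 0"
      using p'[of "LEAST i. F i x = 0" x] LeastI_ex[OF assms(2)[of x]] by simp
    show "\<forall>j<LEAST i. F i x = 0. \<exists>z. recf_eval p [j, x] (Suc z)"
      using p' not_less_Least by (metis not0_implies_Suc)
  qed
  moreover have "xs = [xs ! 0]" if "length xs = 1" for xs :: "nat list"
    using that by (auto simp: length_Suc_conv)
  ultimately have "recf_eval (Mu p) xs (LEAST i. F i (xs ! 0) = 0)" if "length xs = 1" for xs
    using that by metis
  then show ?thesis unfolding rec_fun_def by blast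
qed

lemma rec_fun_add: "rec_fun 2 (\<lambda>ys. ys ! 0 + ys ! 1)"
proof -
  have "rec_fun 2 (\<lambda>ys. rec_nat (ys ! 1) (\<lambda>i r. Suc r) (ys ! 0))"
    by (rule rec_fun_rec_nat) (intro rec_fun_nth rec_fun_Suc; simp)+
  moreover have "rec_nat b (\<lambda>i r. Suc r) a = a + b" for a b :: nat by (induction a) auto
  ultimately show ?thesis by simp
qed

lemma rec_fun_diff: "rec_fun 2 (\<lambda>ys. ys ! 0 - ys ! 1)"
proof -
  have "rec_fun 2 (\<lambda>ys. rec_nat 0 (\<lambda>i r. i) (ys ! 0))"
    by (rule rec_fun_rec_nat) (intro rec_fun_nth rec_fun_zero; simp)+
  then have "rec_fun 1 (\<lambda>ys. rec_nat 0 (\<lambda>i r. i) (ys ! 0))"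
    using rec_fun_compose[of "[\<lambda>xs. xs ! 0, \<lambda>xs. xs ! 0]" "\<lambda>ys. rec_nat 0 (\<lambda>i r. i) (ys ! 0)" 1]
    by (simp add: rec_fun_nth numeral_2_eq_2)
  moreover have "rec_nat 0 (\<lambda>i r. i) a = a - 1" for a by (cases a) auto
  ultimately have pred: "rec_fun 1 (\<lambda>ys. ys ! 0 - 1)" by simp
  have "rec_fun 2 (\<lambda>ys. rec_nat (ys ! 1) (\<lambda>i r. r - 1) (ys ! 0))"
    by (rule rec_fun_rec_nat) (intro rec_fun_nth rec_fun_compose1[OF pred]; simp)+
  moreover have "rec_nat b (\<lambda>i r. r - 1) a = b - a" for a b :: nat by (induction a) auto
  ultimately have "rec_fun 2 (\<lambda>ys. ys ! 1 - ys ! 0)" by simp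
  from rec_fun_compose2[OF this, of 2 "\<lambda>ys. ys ! 1" "\<lambda>ys. ys ! 0"] show ?thesis
    by (simp add: rec_fun_nth)
qed

lemma rec_fun_triangle: "rec_fun 1 (\<lambda>ys. triangle (ys ! 0))"
proof -
  have "rec_fun 2 (\<lambda>ys. rec_nat 0 (\<lambda>i r. r + Suc i) (ys ! 0))"
    by (rule rec_fun_rec_nat)
       (intro rec_fun_nth rec_fun_zero rec_fun_Suc rec_fun_compose2[OF rec_fun_add]; simp)+
  then have "rec_fun 1 (\<lambda>ys. rec_nat 0 (\<lambda>i r. r + Suc i) (ys ! 0))"
    using rec_fun_compose[of "[\<lambda>xs. xs ! 0, \<lambda>xs. xs ! 0]" "\<lambda>ys. rec_nat 0 (\<lambda>i r. r + Suc i) (ys ! 0)" 1]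
    by (simp add: rec_fun_nth numeral_2_eq_2)
  moreover have "rec_nat 0 (\<lambda>i r. r + Suc i) a = triangle a" for a by (induction a) auto
  ultimately show ?thesis by simp
qed

lemma rec_fun_prod_encode: "rec_fun 2 (\<lambda>ys. prod_encode (ys ! 0, ys ! 1))"
  unfolding prod_encode_def
  by (simp, intro rec_fun_compose2[OF rec_fun_add] rec_fun_compose1[OF rec_fun_triangle] rec_fun_nth; simp)

abbreviation pfst :: "nat \<Rightarrow> nat" where "pfst z \<equiv> fst (prod_decode z)"
abbreviation psnd :: "nat \<Rightarrow> nat" where "psnd z \<equiv> snd (prod_decode z)"

lemma triangle_mono: "a \<le> b \<Longrightarrow> triangle a \<le> triangle b"
  by (induction b) (auto simp: le_Suc_eq)

text \<open>
  The pairing function enumerates the pairs along diagonals. The diagonal of \<open>z\<close> is found by an unbounded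
  search, and both components of \<open>z\<close> are obtained from it by subtraction.
\<close>

lemma Least_triangle: "(LEAST w. Suc z - triangle (Suc w) = 0) = pfst z + psnd z"
proof -
  let ?s = "pfst z + psnd z"
  have z: "z = triangle ?s + pfst z"
    using prod_decode_inverse[of z] unfolding prod_encode_def by (simp add: case_prod_beta)
  show ?thesis
  proof (rule Least_equality)
    show "Suc z - triangle (Suc ?s) = 0" using z by simp
    fix w assume w: "Suc z - triangle (Suc w) = 0"
    show "?s \<le> w"
    proof (rule ccontr)
      assume "\<not> ?s \<le> w"
      then have "triangle (Suc w) \<le> triangle ?s" by (intro triangle_mono) simp
      then show False using w z by simp
    qed
  qed
qed

lemma rec_fun_psum: "rec_fun 1 (\<lambda>ys. pfst (ys ! 0) + psnd (ys ! 0))"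
proof -
  have "rec_fun 1 (\<lambda>ys. LEAST w. Suc (ys ! 0) - triangle (Suc w) = 0)"
  proof (rule rec_fun_Least[of "\<lambda>w z. Suc z - triangle (Suc w)"])
    show "rec_fun 2 (\<lambda>ys. Suc (ys ! 1) - triangle (Suc (ys ! 0)))"
      by (intro rec_fun_compose2[OF rec_fun_diff] rec_fun_Suc rec_fun_compose1[OF rec_fun_triangle]
          rec_fun_nth; simp)
    fix x have "x \<le> triangle x" by (induction x) auto
    then show "\<exists>i. Suc x - triangle (Suc i) = 0" by (intro exI[of _ x]) simp
  qed
  then show ?thesis unfolding Least_triangle .
qed

lemma rec_fun_pfst: "rec_fun 1 (\<lambda>ys. pfst (ys ! 0))"
proof -
  have "rec_fun 1 (\<lambda>ys. ys ! 0 - triangle (pfst (ys ! 0) + psnd (ys ! 0)))"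
    by (intro rec_fun_compose2[OF rec_fun_diff] rec_fun_compose1[OF rec_fun_triangle] rec_fun_psum
        rec_fun_nth; simp)
  moreover have "z - triangle (pfst z + psnd z) = pfst z" for z
    using prod_decode_inverse[of z] unfolding prod_encode_def by (simp add: case_prod_beta)
  ultimately show ?thesis by simp
qed

lemma rec_fun_psnd: "rec_fun 1 (\<lambda>ys. psnd (ys ! 0))"
proof -
  have "rec_fun 1 (\<lambda>ys. (pfst (ys ! 0) + psnd (ys ! 0)) - pfst (ys ! 0))"
    by (intro rec_fun_compose2[OF rec_fun_diff] rec_fun_psum rec_fun_pfst)
  then show ?thesis by simp
qed

text \<open>
  From here on all functions are unary, and further arguments are packed into pairs: the closure rules below
  then have the form required for proving computability and decidability by \<open>intro\<close> along the structure of a term.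
\<close>

definition computable :: "(nat \<Rightarrow> nat) \<Rightarrow> bool" where
  "computable f \<longleftrightarrow> (\<exists>p. \<forall>x. recf_eval p [x] (f x))"

lemma comp_iff_rec_fun: "computable f \<longleftrightarrow> rec_fun 1 (\<lambda>xs. f (xs ! 0))"
proof -
  have "xs = [xs ! 0]" if "length xs = 1" for xs :: "nat list"
    using that by (auto simp: length_Suc_conv)
  then show ?thesis unfolding computable_def rec_fun_def
    by (metis length_Cons list.size(3) nth_Cons_0 One_nat_def)
qed

lemma comp_id: "computable (\<lambda>x. x)"
  unfolding comp_iff_rec_fun by (simp add: rec_fun_nth)

lemma comp_compose: "computable f \<Longrightarrow> computable g \<Longrightarrow> computable (\<lambda>x. f (g x))"
  unfolding comp_iff_rec_fun by (rule rec_fun_compose1)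

lemma comp_pair: "computable f \<Longrightarrow> computable g \<Longrightarrow> computable (\<lambda>x. prod_encode (f x, g x))"
  unfolding comp_iff_rec_fun by (rule rec_fun_compose2[OF rec_fun_prod_encode])

lemma comp_pfst: "computable f \<Longrightarrow> computable (\<lambda>x. pfst (f x))"
  unfolding comp_iff_rec_fun by (rule rec_fun_compose1[OF rec_fun_pfst])

lemma comp_psnd: "computable f \<Longrightarrow> computable (\<lambda>x. psnd (f x))"
  unfolding comp_iff_rec_fun by (rule rec_fun_compose1[OF rec_fun_psnd])

lemma comp_Suc: "computable f \<Longrightarrow> computable (\<lambda>x. Suc (f x))"
  unfolding comp_iff_rec_fun by (rule rec_fun_Suc)

lemma comp_const: "computable (\<lambda>x. c)"
  by (induction c) (simp_all add: comp_Suc, simp add: comp_iff_rec_fun rec_fun_zero)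

lemma comp_add: "computable f \<Longrightarrow> computable g \<Longrightarrow> computable (\<lambda>x. f x + g x)"
  unfolding comp_iff_rec_fun by (rule rec_fun_compose2[OF rec_fun_add])

lemma comp_diff: "computable f \<Longrightarrow> computable g \<Longrightarrow> computable (\<lambda>x. f x - g x)"
  unfolding comp_iff_rec_fun by (rule rec_fun_compose2[OF rec_fun_diff])

text \<open>
  Introduction rules can be applied under a bound variable once a function of two arguments is presented as a
  function of a pair. This form recurs in all rules for iteration and quantifiers.
\<close>

lemma comp_apply2:
  assumes "computable (\<lambda>z. F (pfst z) (psnd z))" "computable f" "computable g"
  shows "computable (\<lambda>x. F (f x) (g x))"
  using comp_compose[OF assms(1) comp_pair[OF assms(2,3)]] by simp

lemma comp_rec_nat:
  assumes "computable a" "computable (\<lambda>z. s (pfst z) (pfst (psnd z)) (psnd (psnd z)))" "computable b"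
  shows "computable (\<lambda>x. rec_nat (a x) (\<lambda>i r. s i r x) (b x))"
proof -
  have "rec_fun 3 (\<lambda>ys. s (ys ! 0) (ys ! 1) (ys ! 2))"
    using rec_fun_compose1[OF assms(2)[unfolded comp_iff_rec_fun],
        of 3 "\<lambda>ys. prod_encode (ys ! 0, prod_encode (ys ! 1, ys ! 2))"]
    by (simp add: rec_fun_compose2[OF rec_fun_prod_encode] rec_fun_nth)
  from rec_fun_compose2[OF rec_fun_rec_nat[OF assms(1)[unfolded comp_iff_rec_fun] this],
      of 1 "\<lambda>xs. b (xs ! 0)" "\<lambda>xs. xs ! 0"]
  show ?thesis using assms(3) by (simp add: comp_iff_rec_fun rec_fun_nth)
qed

lemma comp_funpow:
  assumes "computable (\<lambda>z. f (pfst z) (psnd z))" "computable b" "computable a"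
  shows "computable (\<lambda>x. ((\<lambda>y. f x y) ^^ b x) (a x))"
proof -
  have "computable (\<lambda>x. rec_nat (a x) (\<lambda>i r. f x r) (b x))"
    by (rule comp_rec_nat[OF assms(3) _ assms(2)])
       (intro comp_apply2[of f, OF assms(1)] comp_pfst comp_psnd comp_id)
  moreover have "rec_nat y (\<lambda>i r. g r) m = (g ^^ m) y" for g :: "nat \<Rightarrow> nat" and m y
    by (induction m) auto
  ultimately show ?thesis by simp
qed

lemma comp_power2: "computable f \<Longrightarrow> computable (\<lambda>x. 2 ^ f x)"
proof -
  assume f: "computable f"
  have "computable (\<lambda>x. ((\<lambda>y. y + y) ^^ f x) 1)"
    by (rule comp_funpow) (intro comp_add comp_psnd comp_id comp_const f)+
  moreover have "((\<lambda>y. y + y) ^^ m) 1 = (2 :: nat) ^ m" for m by (induction m) auto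
  ultimately show ?thesis by simp
qed

definition decidable :: "(nat \<Rightarrow> bool) \<Rightarrow> bool" where
  "decidable P \<longleftrightarrow> computable (\<lambda>x. if P x then 1 else 0)"

lemma comp_if: 
  assumes "decidable P" "computable f" "computable g"
  shows "computable (\<lambda>x. if P x then f x else g x)"
proof -
  have "computable (\<lambda>x. rec_nat (g x) (\<lambda>i r. f x) (if P x then 1 else 0))"
    by (rule comp_rec_nat[OF assms(3)])
       (use assms in \<open>simp_all add: decidable_def comp_compose[of f] comp_psnd comp_id\<close>)
  moreover have "rec_nat (g x) (\<lambda>i r. f x) (if P x then 1 else 0) = (if P x then f x else g x)" for x
    by simp
  ultimately show ?thesis by simp
qed

lemma dec_not: "decidable P \<Longrightarrow> decidable (\<lambda>x. \<not> P x)"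
proof -
  assume "decidable P"
  then have "computable (\<lambda>x. if P x then 0 else 1)" by (intro comp_if comp_const)
  moreover have "(\<lambda>x. if P x then 0 else 1) = (\<lambda>x. if \<not> P x then 1 else (0::nat))" by auto
  ultimately show ?thesis unfolding decidable_def by simp
qed

lemma dec_conj: "decidable P \<Longrightarrow> decidable Q \<Longrightarrow> decidable (\<lambda>x. P x \<and> Q x)"
proof -
  assume a: "decidable P" "decidable Q"
  have "computable (\<lambda>x. if P x then if Q x then 1 else 0 else 0)"
    by (intro comp_if[OF a(1)] comp_if[OF a(2)] comp_const)
  moreover have "(\<lambda>x. if P x then if Q x then 1 else 0 else 0) = (\<lambda>x. if P x \<and> Q x then 1 else (0::nat))"
    by auto
  ultimately show ?thesis unfolding decidable_def by simp
qed

lemma dec_const: "decidable (\<lambda>x. b)"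
  unfolding decidable_def by (rule comp_const)

lemma dec_disj: "decidable P \<Longrightarrow> decidable Q \<Longrightarrow> decidable (\<lambda>x. P x \<or> Q x)"
  using dec_not[OF dec_conj[OF dec_not dec_not], of P Q] by simp

lemma dec_imp: "decidable P \<Longrightarrow> decidable Q \<Longrightarrow> decidable (\<lambda>x. P x \<longrightarrow> Q x)"
  unfolding imp_conv_disj by (intro dec_disj dec_not)

lemma dec_iff: "decidable P \<Longrightarrow> decidable Q \<Longrightarrow> decidable (\<lambda>x. P x \<longleftrightarrow> Q x)"
  unfolding iff_conv_conj_imp by (intro dec_conj dec_imp)

lemma dec_eq_0: "computable f \<Longrightarrow> decidable (\<lambda>x. f x = 0)"
proof -
  assume "computable f"
  then have "computable (\<lambda>x. 1 - f x)" by (intro comp_diff comp_const)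
  moreover have "(\<lambda>x. 1 - f x) = (\<lambda>x. if f x = 0 then 1 else 0)" by (auto simp: not_gr_zero)
  ultimately show ?thesis unfolding decidable_def by simp
qed

lemma dec_le: "computable f \<Longrightarrow> computable g \<Longrightarrow> decidable (\<lambda>x. f x \<le> g x)"
  using dec_eq_0[OF comp_diff, of f g] by (simp only: diff_is_0_eq)

lemma dec_less: "computable f \<Longrightarrow> computable g \<Longrightarrow> decidable (\<lambda>x. f x < g x)"
  using dec_not[OF dec_le, of g f] by (simp only: not_le)

lemma dec_eq: "computable f \<Longrightarrow> computable g \<Longrightarrow> decidable (\<lambda>x. f x = g x)"
  unfolding order.eq_iff by (intro dec_conj dec_le)

lemma dec_compose: "decidable P \<Longrightarrow> computable f \<Longrightarrow> decidable (\<lambda>x. P (f x))"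
  unfolding decidable_def by (rule comp_compose)

lemma dec_apply2:
  assumes "decidable (\<lambda>z. F (pfst z) (psnd z))" "computable f" "computable g"
  shows "decidable (\<lambda>x. F (f x) (g x))"
  using dec_compose[OF assms(1) comp_pair[OF assms(2,3)]] by simp

lemma dec_all_less:
  assumes "computable b" "decidable (\<lambda>z. Q (pfst z) (psnd z))"
  shows "decidable (\<lambda>x. \<forall>i<b x. Q i x)"
proof -
  have "computable (\<lambda>x. rec_nat 1 (\<lambda>i r. if Q i x then r else 0) (b x))"
    by (rule comp_rec_nat[OF _ _ assms(1)])
       (intro comp_if dec_apply2[of Q, OF assms(2)] comp_pfst comp_psnd comp_id comp_const)+
  moreover have "rec_nat 1 (\<lambda>i r. if Q i x then r else 0) m = (if \<forall>i<m. Q i x then 1 else (0::nat))" for m x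
    by (induction m) (auto simp: less_Suc_eq)
  ultimately show ?thesis unfolding decidable_def by simp
qed

lemma dec_ex_less:
  assumes "computable b" "decidable (\<lambda>z. Q (pfst z) (psnd z))"
  shows "decidable (\<lambda>x. \<exists>i<b x. Q i x)"
  using dec_not[OF dec_all_less[OF assms(1), of "\<lambda>i x. \<not> Q i x"]] dec_not[OF assms(2)] by simp

lemma comp_div2: "computable f \<Longrightarrow> computable (\<lambda>x. f x div 2)"
proof -
  assume f: "computable f"
  \<comment> \<open>Iterating \<open>(a, b) \<mapsto> (b + 1, a)\<close> keeps the halves of the step number, rounded up and down.\<close>
  have "computable (\<lambda>x. psnd (((\<lambda>y. prod_encode (Suc (psnd y), pfst y)) ^^ x) (prod_encode (0, 0))))"
    by (rule comp_psnd, rule comp_funpow) (intro comp_pair comp_Suc comp_pfst comp_psnd comp_id comp_const)+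
  moreover have "((\<lambda>y. prod_encode (Suc (psnd y), pfst y)) ^^ m) (prod_encode (0, 0))
      = prod_encode (Suc m div 2, m div 2)" for m
    by (induction m) auto
  ultimately have "computable (\<lambda>x. x div 2)" by simp
  from comp_compose[OF this f] show ?thesis .
qed

lemma dec_even: "computable f \<Longrightarrow> decidable (\<lambda>x. even (f x))"
proof -
  assume "computable f"
  then have "decidable (\<lambda>x. f x = f x div 2 + f x div 2)" by (intro dec_eq comp_add comp_div2)
  moreover have "(m = m div 2 + m div 2) = even m" for m :: nat by presburger
  ultimately show ?thesis by simp
qed

lemma dec_mem: 
  assumes "computable f" "computable g" shows "decidable (\<lambda>x. f x \<in> set_decode (g x))"
proof -
  have "decidable (\<lambda>x. odd (((\<lambda>y. y div 2) ^^ f x) (g x)))"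
    by (intro dec_not dec_even comp_funpow comp_div2 comp_psnd comp_id assms)
  moreover have "((\<lambda>y. y div 2) ^^ m) b = b div 2 ^ m" for m b :: nat
    by (induction m) (auto simp: div_mult2_eq[symmetric] mult.commute)
  ultimately show ?thesis unfolding set_decode_def by simp
qed

text \<open>
  Elements of a coded finite set are smaller than its code, so quantifiers over coded sets are bounded quantifiers.
\<close>

lemma set_decode_less: "q \<in> set_decode c \<Longrightarrow> q < c"
proof -
  assume "q \<in> set_decode c"
  then have "odd (c div 2 ^ q)" by (simp add: set_decode_def)
  then have "c div 2 ^ q \<noteq> 0" by (metis even_zero)
  then have "2 ^ q \<le> c" by (metis div_less not_le)
  then show "q < c" using less_exp[of q] by linarith
qed

lemma dec_ball:
  assumes "computable b" "decidable (\<lambda>z. Q (pfst z) (psnd z))"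
  shows "decidable (\<lambda>x. \<forall>i\<in>set_decode (b x). Q i x)"
proof -
  have "decidable (\<lambda>x. \<forall>i<b x. i \<in> set_decode (b x) \<longrightarrow> Q i x)"
    by (intro dec_all_less dec_imp dec_mem assms comp_pfst comp_id comp_compose[OF assms(1)] comp_psnd)
  moreover have "(\<forall>i<b x. i \<in> set_decode (b x) \<longrightarrow> Q i x) \<longleftrightarrow> (\<forall>i\<in>set_decode (b x). Q i x)" for x
    using set_decode_less by blast
  ultimately show ?thesis by simp
qed

lemma dec_bex:
  assumes "computable b" "decidable (\<lambda>z. Q (pfst z) (psnd z))"
  shows "decidable (\<lambda>x. \<exists>i\<in>set_decode (b x). Q i x)"
  using dec_not[OF dec_ball[OF assms(1), of "\<lambda>i x. \<not> Q i x"]] dec_not[OF assms(2)] by simp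

lemma dec_finite: "finite A \<Longrightarrow> computable f \<Longrightarrow> decidable (\<lambda>x. f x \<in> A)"
  using dec_mem[OF _ comp_const[of "set_encode A"], of f] by simp

lemma comp_filter:
  assumes "computable b" "decidable Q"
  shows "computable (\<lambda>x. set_encode {i \<in> set_decode (b x). Q i})"
proof -
  let ?s = "\<lambda>x m. {i \<in> set_decode x. Q i \<and> i < m}"
  have "computable (\<lambda>x. rec_nat 0 (\<lambda>i r. if i \<in> set_decode (b x) \<and> Q i then 2 ^ i + r else r) (b x))"
    by (rule comp_rec_nat[OF _ _ assms(1)])
       (intro comp_if dec_conj dec_mem comp_add comp_power2 comp_pfst comp_psnd comp_id comp_const
         dec_compose[OF assms(2)] comp_compose[OF assms(1)])+
  moreover have "rec_nat 0 (\<lambda>i r. if i \<in> set_decode x \<and> Q i then 2 ^ i + r else r) m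
      = set_encode (?s x m)" for m x
  proof (induction m)
    case (Suc m)
    have "?s x (Suc m) = (if m \<in> set_decode x \<and> Q m then insert m (?s x m) else ?s x m)"
      by (auto simp: less_Suc_eq)
    then show ?case using Suc by simp
  qed simp
  moreover have "?s x x = {i \<in> set_decode x. Q i}" for x
    using set_decode_less by blast
  ultimately show ?thesis by simp
qed

text \<open>
  A "safe" semi-algorithm: every output comes from a witness \<open>i\<close> that has been checked, and there is an output as
  soon as there is a witness.
\<close>

lemma recf_search:
  assumes "decidable (\<lambda>z. Q (pfst z) (psnd z))" "computable f"
  shows "\<exists>p. \<forall>x. (\<forall>y. recf_eval p [x] y \<longrightarrow> (\<exists>i. Q i x \<and> y = f i)) \<and>
                 ((\<exists>i. Q i x) \<longrightarrow> (\<exists>y. recf_eval p [x] y))"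
proof -
  have "computable (\<lambda>z. if Q (pfst z) (psnd z) then 0 else 1)"
    by (intro comp_if assms(1) comp_const)
  then have "rec_fun 2 (\<lambda>ys. if Q (ys ! 0) (ys ! 1) then 0 else 1)"
    using rec_fun_compose1[of "\<lambda>z. if Q (pfst z) (psnd z) then 0 else 1" 2 "\<lambda>ys. prod_encode (ys ! 0, ys ! 1)"]
    using rec_fun_prod_encode by (simp add: comp_iff_rec_fun)
  then obtain c where "\<And>ys. length ys = 2 \<Longrightarrow> recf_eval c ys (if Q (ys ! 0) (ys ! 1) then 0 else 1)"
    unfolding rec_fun_def by blast
  from this[of "[i, x]" for i x] have c: "recf_eval c [i, x] (if Q i x then 0 else 1)" for i x by simp
  obtain r where r: "\<And>x. recf_eval r [x] (f x)" using assms(2) unfolding computable_def by blast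
  have 1: "\<exists>i. Q i x \<and> y = f i" if "recf_eval (Comp r [Mu c]) [x] y" for x y
  proof -
    from that obtain ys where ys: "length ys = 1" "recf_eval (Mu c) [x] (ys ! 0)" "recf_eval r ys y"
      by (rule recf_eval_CompE) auto
    from ys(2) have "recf_eval c [ys ! 0, x] 0" by (rule recf_eval_MuE)
    then have "Q (ys ! 0) x" using recf_eval_deterministic[OF c, of "ys ! 0" x 0] by (auto split: if_splits)
    moreover have "ys = [ys ! 0]" using ys(1) by (auto simp: length_Suc_conv)
    then have "recf_eval r [ys ! 0] y" using ys(3) by simp
    then have "y = f (ys ! 0)" using recf_eval_deterministic r by blast
    ultimately show ?thesis by blast
  qed
  have 2: "\<exists>y. recf_eval (Comp r [Mu c]) [x] y" if "Q i x" for i x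
  proof -
    define m where "m = (LEAST i. Q i x)"
    have "Q m x" unfolding m_def using that by (rule LeastI)
    then have found: "recf_eval c [m, x] 0" using c[of m x] by simp
    have "recf_eval c [j, x] (Suc 0)" if "j < m" for j
    proof -
      have "\<not> Q j x" using that not_less_Least unfolding m_def by blast
      then show ?thesis using c[of j x] by simp
    qed
    then have "recf_eval (Mu c) [x] m"
      using found by (intro recf_eval.Mu) blast+
    then have "recf_eval (Comp r [Mu c]) [x] (f m)"
      by (intro recf_eval.Comp[of "[m]"]) (auto simp: r)
    then show ?thesis by blast
  qed
  show ?thesis using 1 2 by (intro exI[of _ "Comp r [Mu c]"]) blast
qed

section \<open>Polycyclic groups and inductive intervals as unions of layers\<close>

text \<open>
  Integer representatives of grazing intervals, treating finite and infinite order uniformly: \<open>k = 0\<close> stands for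
  infinite order, and then the condition on divisibility says \<open>0 \<notin> T\<close>.
\<close>

definition grazes :: "nat \<Rightarrow> int set \<Rightarrow> bool" where
  "grazes k T \<longleftrightarrow> int_interval T \<and> (\<forall>t\<in>T. \<not> int k dvd t) \<and> (T = {} \<or> 1 \<in> T \<or> -1 \<in> T)"

lemma int_intervalD: "int_interval T \<Longrightarrow> a \<in> T \<Longrightarrow> b \<in> T \<Longrightarrow> a \<le> x \<Longrightarrow> x \<le> b \<Longrightarrow> x \<in> T"
  unfolding int_interval_def by (meson atLeastAtMost_iff subsetD)

lemma int_intervalI: "(\<And>a b x. a \<in> T \<Longrightarrow> b \<in> T \<Longrightarrow> a \<le> x \<Longrightarrow> x \<le> b \<Longrightarrow> x \<in> T) \<Longrightarrow> int_interval T"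
  unfolding int_interval_def by (meson atLeastAtMost_iff subsetI)

lemma int_interval_cases:
  assumes "int_interval T" "1 \<in> T" "0 \<notin> T"
  shows "T = {1..} \<or> (\<exists>m\<ge>1. T = {1..m})"
proof -
  have pos: "t \<ge> 1" if "t \<in> T" for t
  proof (rule ccontr)
    assume "\<not> t \<ge> 1"
    then have "0 \<in> T" using int_intervalD[OF assms(1) that assms(2), of 0] by simp
    then show False using assms(3) by simp
  qed
  show ?thesis
  proof (cases "\<exists>b. \<forall>t\<in>T. t \<le> b")
    case True
    then obtain b where b: "\<And>t. t \<in> T \<Longrightarrow> t \<le> b" by blast
    have "T \<subseteq> {1..b}" using pos b by auto
    then have fin: "finite T" by (rule finite_subset) simp
    have max: "Max T \<in> T" using fin assms(2) by (intro Max_in) auto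
    have "T = {1..Max T}"
    proof
      show "T \<subseteq> {1..Max T}" using pos fin by auto
      show "{1..Max T} \<subseteq> T" using int_intervalD[OF assms(1,2) max] by auto
    qed
    moreover have "Max T \<ge> 1" using pos max by simp
    ultimately show ?thesis by blast
  next
    case False
    have "t \<in> T" if "t \<ge> 1" for t
    proof -
      obtain s where s: "s \<in> T" "s > t" using False by (meson not_le)
      then show ?thesis using int_intervalD[OF assms(1,2) s(1) that] by simp
    qed
    then have "T = {1..}" using pos by auto
    then show ?thesis by blast
  qed
qed

lemma int_interval_uminus: "int_interval T \<Longrightarrow> int_interval (uminus ` T)"
proof (rule int_intervalI)
  fix a b x assume a: "int_interval T" "a \<in> uminus ` T" "b \<in> uminus ` T" "a \<le> x" "x \<le> b"
  then obtain a' b' where ab: "a = - a'" "b = - b'" "a' \<in> T" "b' \<in> T" by blast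
  then have "- x \<in> T" using int_intervalD[OF a(1) ab(4,3), of "- x"] a by simp
  then show "x \<in> uminus ` T" by (rule rev_image_eqI) simp
qed

lemma int_interval_shift: "int_interval T \<Longrightarrow> int_interval ((\<lambda>t. t + c) ` T)"
proof (rule int_intervalI)
  fix a b x
  assume a: "int_interval T" "a \<in> (\<lambda>t. t + c) ` T" "b \<in> (\<lambda>t. t + c) ` T" "a \<le> x" "x \<le> b"
  then obtain a' b' where ab: "a = a' + c" "b = b' + c" "a' \<in> T" "b' \<in> T" by blast
  then have "x - c \<in> T" using int_intervalD[OF a(1) ab(3,4), of "x - c"] a by simp
  then show "x \<in> (\<lambda>t. t + c) ` T" by (rule rev_image_eqI) simp
qed

text \<open>
  For finite \<open>k\<close> a lift of an interval of residues need not contain 1 or -1 itself, but only an integer congruent to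
  one of them; translating the lift by a multiple of \<open>k\<close> repairs this.
\<close>

lemma grazing_interval_iff: "grazing_interval k J \<longleftrightarrow> (\<exists>T. grazes k T \<and> J = (\<lambda>t. t mod int k) ` T)"
proof (cases "k = 0")
  case True
  have neg: "T = {..-1} \<or> (\<exists>m\<ge>1. T = {-m..-1})" if "int_interval T" "-1 \<in> T" "0 \<notin> T" for T
  proof -
    have "1 \<in> uminus ` T" using that(2) by (metis image_eqI minus_minus)
    then have "uminus ` T = {1..} \<or> (\<exists>m\<ge>1. uminus ` T = {1..m})"
      using that by (intro int_interval_cases int_interval_uminus) auto
    moreover have "T = uminus ` uminus ` T" by (simp add: image_image)
    moreover have "uminus ` {1..m} = {-m..-1}" for m :: int by simp
    moreover have "uminus ` {1::int..} = {..-1}"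
      by (auto intro: image_eqI[where x = "- x" for x])
    ultimately show ?thesis by metis
  qed
  have "grazes 0 T \<longleftrightarrow> T = {..-1} \<or> (\<exists>m\<ge>1. T = {-m..-1}) \<or> T = {} \<or> (\<exists>m\<ge>1. T = {1..m}) \<or> T = {1..}" for T
  proof
    assume "grazes 0 T"
    then have "int_interval T" "0 \<notin> T" "T = {} \<or> 1 \<in> T \<or> -1 \<in> T" unfolding grazes_def by auto
    then show "T = {..-1} \<or> (\<exists>m\<ge>1. T = {-m..-1}) \<or> T = {} \<or> (\<exists>m\<ge>1. T = {1..m}) \<or> T = {1..}"
      using neg[of T] int_interval_cases[of T] by blast
  qed (auto simp: grazes_def int_interval_def)
  then show ?thesis using True unfolding grazing_interval_def by simp
next
  case False
  then have k: "int k > 0" by simp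
  have dvd: "int k dvd t \<longleftrightarrow> t mod int k = 0" for t by (rule dvd_eq_mod_eq_0)
  show ?thesis
  proof
    assume "grazing_interval k J"
    then obtain I where I: "int_interval I" "J = (\<lambda>t. t mod int k) ` I"
      and J: "J = {} \<or> ((1 mod int k \<in> J \<or> (-1) mod int k \<in> J) \<and> 0 \<notin> J)"
      using False unfolding grazing_interval_def by auto
    show "\<exists>T. grazes k T \<and> J = (\<lambda>t. t mod int k) ` T"
    proof (cases "J = {}")
      case True
      then show ?thesis by (intro exI[of _ "{}"]) (simp add: grazes_def int_interval_def)
    next
      case nonempty: False
      then obtain e where e: "e = 1 \<or> e = -1" "e mod int k \<in> J" and "0 \<notin> J" using J by blast
      then obtain i where i: "i \<in> I" "e mod int k = i mod int k" using I(2) by auto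
      let ?T = "(\<lambda>t. t + (e - i)) ` I"
      have mod: "(t + (e - i)) mod int k = t mod int k" for t
        using i(2) by (metis add.right_neutral cancel_comm_monoid_add_class.diff_cancel mod_add_right_eq mod_diff_cong mod_0)
      have JT: "J = (\<lambda>t. t mod int k) ` ?T" using I(2) by (simp add: image_image mod)
      have "e \<in> ?T" using i(1) by (auto intro: image_eqI[of _ _ i])
      moreover have "\<forall>t\<in>?T. \<not> int k dvd t" using \<open>0 \<notin> J\<close> JT unfolding dvd by force
      ultimately have "grazes k ?T"
        using e(1) int_interval_shift[OF I(1)] unfolding grazes_def by auto
      then show ?thesis using JT by blast
    qed
  next
    assume "\<exists>T. grazes k T \<and> J = (\<lambda>t. t mod int k) ` T"
    then obtain T where T: "grazes k T" "J = (\<lambda>t. t mod int k) ` T" by blast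
    have "t mod int k \<noteq> 0" if "t \<in> T" for t using T(1) that dvd[of t] unfolding grazes_def by blast
    then have "0 \<notin> J" unfolding T(2) by (auto dest: sym)
    moreover have "J = {} \<or> 1 mod int k \<in> J \<or> (-1) mod int k \<in> J" using T unfolding grazes_def by auto
    ultimately show "grazing_interval k J"
      using False T unfolding grazing_interval_def grazes_def by (simp only: if_False) blast
  qed
qed

text \<open>
  The elementwise content of a polycycle structure: quotient groups are replaced by coset decompositions and by
  divisibility of exponents, and the indices are shifted so that step \<open>i < n\<close> leads from \<open>H i\<close> to \<open>H (Suc i)\<close>.
\<close>

locale polycyclic = group G for G (structure) +
  fixes n :: nat and H :: "nat \<Rightarrow> 'a set" and h :: "nat \<Rightarrow> 'a" and k :: "nat \<Rightarrow> nat"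
  assumes H_0: "H 0 = {\<one>}"
    and H_n: "H n = carrier G"
    and H_subgroup: "i \<le> n \<Longrightarrow> subgroup (H i) G"
    and H_mono_Suc: "i < n \<Longrightarrow> H i \<subseteq> H (Suc i)"
    and H_conj: "i < n \<Longrightarrow> x \<in> H (Suc i) \<Longrightarrow> u \<in> H i \<Longrightarrow> x \<otimes> u \<otimes> inv x \<in> H i"
    and h_in: "i < n \<Longrightarrow> h (Suc i) \<in> H (Suc i)"
    and h_generates: "i < n \<Longrightarrow> g \<in> H (Suc i) \<Longrightarrow> \<exists>t::int. \<exists>u\<in>H i. g = h (Suc i) [^] t \<otimes> u"
    and h_pow_iff: "i < n \<Longrightarrow> h (Suc i) [^] (t::int) \<in> H i \<longleftrightarrow> int (k (Suc i)) dvd t"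

lemma polycyclic_if_structure:
  fixes G (structure)
  assumes "polycycle_structure G n H h k"
  shows "polycyclic G n H h k"
proof -
  note d = assms[unfolded polycycle_structure_def]
  note grp = conjunct1[OF d]
  note H_0 = conjunct1[OF conjunct2[OF d]]
  note H_n = conjunct1[OF conjunct2[OF conjunct2[OF d]]]
  note all_sub = conjunct1[OF conjunct2[OF conjunct2[OF conjunct2[OF d]]]]
  note all_step = conjunct2[OF conjunct2[OF conjunct2[OF conjunct2[OF d]]]]
  interpret group G by (rule grp)
  have norm: "H i \<lhd> G\<lparr>carrier := H (Suc i)\<rparr>" and hH: "h (Suc i) \<in> H (Suc i)"
    and gen: "carrier (G\<lparr>carrier := H (Suc i)\<rparr> Mod H i)
        = generate (G\<lparr>carrier := H (Suc i)\<rparr> Mod H i) {h (Suc i) <# H i}"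
    and ord: "order (G\<lparr>carrier := H (Suc i)\<rparr> Mod H i) = k (Suc i)"
    if "i < n" for i
  proof -
    have "Suc i \<in> {1..n}" using that by simp
    from bspec[OF all_step this] have "H (Suc i - 1) \<lhd> G\<lparr>carrier := H (Suc i)\<rparr> \<and> h (Suc i) \<in> H (Suc i) \<and>
        (let Q = G\<lparr>carrier := H (Suc i)\<rparr> Mod H (Suc i - 1)
         in carrier Q = generate Q {h (Suc i) <# H (Suc i - 1)} \<and> order Q = k (Suc i))" .
    note this[unfolded Let_def diff_Suc_1]
    then show "H i \<lhd> G\<lparr>carrier := H (Suc i)\<rparr>" "h (Suc i) \<in> H (Suc i)"
      "carrier (G\<lparr>carrier := H (Suc i)\<rparr> Mod H i)
        = generate (G\<lparr>carrier := H (Suc i)\<rparr> Mod H i) {h (Suc i) <# H i}"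
      "order (G\<lparr>carrier := H (Suc i)\<rparr> Mod H i) = k (Suc i)"
      by - (elim conjE, assumption)+
  qed
  have sub: "subgroup (H i) G" if "i \<le> n" for i using all_sub that by simp
  have step: "x \<otimes> u \<otimes> inv x \<in> H i \<and> H i \<subseteq> H (Suc i)"
    if "i < n" "x \<in> H (Suc i)" "u \<in> H i" for i x u
  proof -
    interpret N: normal "H i" "G\<lparr>carrier := H (Suc i)\<rparr>" by (rule norm[OF that(1)])
    have "subgroup (H (Suc i)) G" using sub that by simp
    then show ?thesis using N.inv_op_closed2[of x u] that N.subset by auto
  qed
  have cyc: "(\<exists>t::int. \<exists>u\<in>H i. g = h (Suc i) [^] t \<otimes> u)"
    "h (Suc i) [^] (s::int) \<in> H i \<longleftrightarrow> int (k (Suc i)) dvd s"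
    if i: "i < n" and g: "g \<in> H (Suc i)" for i g s
  proof -
    let ?K = "G\<lparr>carrier := H (Suc i)\<rparr>"
    let ?Q = "?K Mod H i"
    have sK: "subgroup (H (Suc i)) G" using sub i by simp
    interpret N: normal "H i" ?K by (rule norm[OF i])
    interpret Q: group ?Q by (rule N.factorgroup_is_group)
    have hK: "h (Suc i) \<in> carrier ?K" using hH[OF i] by simp
    have lK: "x <#\<^bsub>?K\<^esub> H i = x <# H i" for x by (simp add: l_coset_def)
    have coset_eq: "x <# H i = H i #>\<^bsub>?K\<^esub> x" if "x \<in> carrier ?K" for x
      using N.coset_eq that unfolding lK[symmetric] by simp
    have coset: "h (Suc i) <# H i = H i #>\<^bsub>?K\<^esub> h (Suc i)"
      by (rule coset_eq[OF hK])
    have q: "h (Suc i) <# H i \<in> carrier ?Q"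
      unfolding coset using N.rcosetsI[OF N.subset hK] by (simp add: FactGroup_def)
    have pow: "(h (Suc i) <# H i) [^]\<^bsub>?Q\<^esub> t = (h (Suc i) [^] t) <# H i" for t :: int
    proof -
      have "(h (Suc i) <# H i) [^]\<^bsub>?Q\<^esub> t = H i #>\<^bsub>?K\<^esub> (h (Suc i) [^]\<^bsub>?K\<^esub> t)"
        unfolding coset by (rule N.FactGroup_int_pow[OF hK])
      also have "\<dots> = (h (Suc i) [^]\<^bsub>?K\<^esub> t) <# H i"
        by (rule coset_eq[symmetric, OF N.int_pow_closed[OF hK]])
      also have "\<dots> = (h (Suc i) [^] t) <# H i"
        unfolding int_pow_consistent[OF sK hH[OF i], symmetric] ..
      finally show ?thesis .
    qed
    have powH: "h (Suc i) [^] t \<in> carrier G" for t :: int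
      using subgroup.mem_carrier[OF sK hH[OF i]] by (rule int_pow_closed)
    have HG: "H i \<subseteq> carrier G" "\<one> \<in> H i"
      using subgroup.subset[OF sub[of i]] subgroup.one_closed[OF sub[of i]] i by auto
    have "g <# H i \<in> carrier ?Q"
      using N.rcosetsI[OF N.subset, of g] coset_eq[of g] g by (simp add: FactGroup_def)
    then obtain t :: int where "g <# H i = (h (Suc i) <# H i) [^]\<^bsub>?Q\<^esub> t"
      unfolding gen[OF i] Q.generate_pow[OF q] by blast
    then have "g <# H i = (h (Suc i) [^] t) <# H i" unfolding pow .
    moreover have self: "x \<in> x <# H i" if "x \<in> carrier G" for x
      using HG(2) r_one[OF that] unfolding l_coset_def by (metis UN_I singletonI)
    ultimately have "g \<in> (h (Suc i) [^] t) <# H i"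
      using subgroup.mem_carrier[OF sK g] by blast
    then show "\<exists>t::int. \<exists>u\<in>H i. g = h (Suc i) [^] t \<otimes> u"
      unfolding l_coset_def by blast
    have one: "\<one>\<^bsub>?Q\<^esub> = H i" by (simp add: FactGroup_def)
    have "int (Q.ord (h (Suc i) <# H i)) = int (k (Suc i))"
      using Q.generate_pow_card[OF q] gen[OF i] ord[OF i] by (simp add: order_def)
    then have "int (k (Suc i)) dvd s \<longleftrightarrow> (h (Suc i) [^] s) <# H i = H i"
      using Q.int_pow_eq_id[OF q, of s] unfolding pow one by simp
    also have "\<dots> \<longleftrightarrow> h (Suc i) [^] s \<in> H i"
    proof
      assume "(h (Suc i) [^] s) <# H i = H i"
      moreover have "h (Suc i) [^] s \<in> (h (Suc i) [^] s) <# H i"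
        using powH by (rule self)
      ultimately show "h (Suc i) [^] s \<in> H i" by simp
    next
      assume "h (Suc i) [^] s \<in> H i"
      then show "(h (Suc i) [^] s) <# H i = H i"
        using coset_join3[OF powH sub] i by simp
    qed
    finally show "h (Suc i) [^] s \<in> H i \<longleftrightarrow> int (k (Suc i)) dvd s" by simp
  qed
  show ?thesis
  proof (intro polycyclic.intro polycyclic_axioms.intro is_group)
    fix i assume i: "i < n"
    show "H i \<subseteq> H (Suc i)"
      using step[OF i hH[OF i], of \<one>] sub[of i] i by (simp add: subgroup.one_closed)
    show "h (Suc i) \<in> H (Suc i)" using hH[OF i] .
    show "x \<otimes> u \<otimes> inv x \<in> H i" if "x \<in> H (Suc i)" "u \<in> H i" for x u
      using step[OF i that] by simp
    show "\<exists>t::int. \<exists>u\<in>H i. g = h (Suc i) [^] t \<otimes> u" if "g \<in> H (Suc i)" for g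
      using cyc(1)[OF i that] .
    show "h (Suc i) [^] (t::int) \<in> H i \<longleftrightarrow> int (k (Suc i)) dvd t" for t
      using cyc(2)[OF i hH[OF i]] .
  qed (use H_0 H_n sub in auto)
qed

context polycyclic
begin

lemma H_mono: "i \<le> j \<Longrightarrow> j \<le> n \<Longrightarrow> H i \<subseteq> H j"
  by (induction rule: dec_induct) (use H_mono_Suc in \<open>auto simp: Suc_le_eq\<close>)

lemma H_carrier: "i \<le> n \<Longrightarrow> u \<in> H i \<Longrightarrow> u \<in> carrier G"
  using H_mono[of i n] H_n by auto

lemma h_carrier [simp]: "i < n \<Longrightarrow> h (Suc i) \<in> carrier G"
  using H_carrier[of "Suc i"] h_in by simp

lemma H_one: "i \<le> n \<Longrightarrow> \<one> \<in> H i"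
  using subgroup.one_closed[OF H_subgroup] .

lemma H_mult: "i \<le> n \<Longrightarrow> u \<in> H i \<Longrightarrow> v \<in> H i \<Longrightarrow> u \<otimes> v \<in> H i"
  using subgroup.m_closed[OF H_subgroup] .

lemma H_inv: "i \<le> n \<Longrightarrow> u \<in> H i \<Longrightarrow> inv u \<in> H i"
  using subgroup.m_inv_closed[OF H_subgroup] .

lemma h_pow_in: "i < n \<Longrightarrow> h (Suc i) [^] (t::int) \<in> H (Suc i)"
  using subgroup_int_pow_closed[OF H_subgroup h_in] by simp

lemma H_conj': "i < n \<Longrightarrow> x \<in> H (Suc i) \<Longrightarrow> u \<in> H i \<Longrightarrow> inv x \<otimes> u \<otimes> x \<in> H i"
  using H_conj[of i "inv x" u] H_inv[of "Suc i" x] H_carrier[of "Suc i" x] by simp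

text \<open>
  The index \<open>i\<close> of a layer is that of the subgroup whose cosets it consists of; the layer lies in \<open>H (Suc i)\<close>.
\<close>

definition layer :: "nat \<Rightarrow> int set \<Rightarrow> 'a set" where
  "layer i T = {h (Suc i) [^] t \<otimes> u | t u. t \<in> T \<and> u \<in> H i}"

definition layers :: "nat \<Rightarrow> (nat \<Rightarrow> int set) \<Rightarrow> 'a set" where
  "layers i T = (\<Union>l\<in>{i..<n}. layer l (T l))"

lemma layer_empty [simp]: "layer i {} = {}"
  by (simp add: layer_def)

lemma layer_Un: "layer i (S \<union> T) = layer i S \<union> layer i T"
  by (auto simp: layer_def)

lemma layer_UN: "layer i (\<Union>j\<in>I. T j) = (\<Union>j\<in>I. layer i (T j))"
  by (auto simp: layer_def)

lemma layer_subset: "i < n \<Longrightarrow> layer i T \<subseteq> H (Suc i)"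
  using h_pow_in H_mono_Suc by (auto simp: layer_def intro!: H_mult)

lemma layer_carrier: "i < n \<Longrightarrow> layer i T \<subseteq> carrier G"
  using layer_subset H_carrier[of "Suc i"] by force

lemma layer_UNIV: "i < n \<Longrightarrow> layer i UNIV = H (Suc i)"
proof
  assume i: "i < n"
  show "layer i UNIV \<subseteq> H (Suc i)" using layer_subset[OF i] .
  show "H (Suc i) \<subseteq> layer i UNIV" using h_generates[OF i] by (force simp: layer_def)
qed

lemma layer_zero: "i < n \<Longrightarrow> layer i {0} = H i"
  using H_carrier[of i] by (force simp: layer_def)

lemma h_pow_mult_eqD:
  assumes "i < n" "u \<in> H i" "v \<in> H i" "h (Suc i) [^] (s::int) \<otimes> u = h (Suc i) [^] t \<otimes> v"
  shows "int (k (Suc i)) dvd s - t"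
proof -
  have uv: "u \<in> carrier G" "v \<in> carrier G" using assms H_carrier[of i] by auto
  have "h (Suc i) [^] (s - t) = h (Suc i) [^] (- t) \<otimes> (h (Suc i) [^] s \<otimes> u) \<otimes> inv u"
    using assms(1) uv by (simp add: m_assoc int_pow_mult[symmetric])
  also have "\<dots> = h (Suc i) [^] (- t) \<otimes> (h (Suc i) [^] t \<otimes> v) \<otimes> inv u" using assms(4) by simp
  also have "\<dots> = v \<otimes> inv u"
    using assms(1) uv by (simp add: m_assoc[symmetric] int_pow_mult[symmetric])
  finally have "h (Suc i) [^] (s - t) = v \<otimes> inv u" .
  moreover have "v \<otimes> inv u \<in> H i" using assms H_mult[of i v "inv u"] H_inv[of i u] by simp
  ultimately show ?thesis using assms(1) h_pow_iff[of i "s - t"] by simp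
qed

lemma h_pow_layer_iff:
  assumes "i < n" "u \<in> H i"
  shows "h (Suc i) [^] t \<otimes> u \<in> layer i T \<longleftrightarrow> (\<exists>s\<in>T. int (k (Suc i)) dvd t - s)"
proof
  assume "h (Suc i) [^] t \<otimes> u \<in> layer i T"
  then show "\<exists>s\<in>T. int (k (Suc i)) dvd t - s"
    using h_pow_mult_eqD[OF assms] unfolding layer_def by blast
next
  assume "\<exists>s\<in>T. int (k (Suc i)) dvd t - s"
  then obtain s where s: "s \<in> T" "int (k (Suc i)) dvd t - s" by blast
  have u: "u \<in> carrier G" using assms H_carrier[of i] by simp
  have "h (Suc i) [^] (t - s) \<in> H i" using h_pow_iff assms s by simp
  then have "h (Suc i) [^] (t - s) \<otimes> u \<in> H i" using assms by (intro H_mult) auto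
  moreover have "h (Suc i) [^] t \<otimes> u = h (Suc i) [^] s \<otimes> (h (Suc i) [^] (t - s) \<otimes> u)"
    using assms(1) u by (simp add: m_assoc[symmetric] int_pow_mult[symmetric])
  ultimately show "h (Suc i) [^] t \<otimes> u \<in> layer i T" unfolding layer_def using s by blast
qed

lemma layer_disjoint: "i < n \<Longrightarrow> \<forall>t\<in>T. \<not> int (k (Suc i)) dvd t \<Longrightarrow> layer i T \<inter> H i = {}"
proof -
  assume i: "i < n" "\<forall>t\<in>T. \<not> int (k (Suc i)) dvd t"
  have "h (Suc i) [^] t \<otimes> u \<notin> H i" if "t \<in> T" "u \<in> H i" for t u
  proof
    assume "h (Suc i) [^] t \<otimes> u \<in> H i"
    then have "h (Suc i) [^] (0::int) \<otimes> (h (Suc i) [^] t \<otimes> u) \<in> layer i T"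
      using that i H_carrier[of i u] by (force simp: layer_def)
    with h_pow_layer_iff[OF i(1) \<open>h (Suc i) [^] t \<otimes> u \<in> H i\<close>, of 0 T] i(2) show False by auto
  qed
  then show ?thesis by (auto simp: layer_def)
qed

lemma layers_Suc: "i < n \<Longrightarrow> layers i T = layer i (T i) \<union> layers (Suc i) T"
proof -
  assume "i < n"
  then have "{i..<n} = insert i {Suc i..<n}" by auto
  then show ?thesis by (simp add: layers_def)
qed

lemma layers_n [simp]: "layers n T = {}" by (simp add: layers_def)

lemma layers_cong: "(\<And>l. i \<le> l \<Longrightarrow> l < n \<Longrightarrow> T l = T' l) \<Longrightarrow> layers i T = layers i T'"
  by (simp add: layers_def)

lemma layers_carrier: "layers i T \<subseteq> carrier G"
  using layer_carrier by (fastforce simp: layers_def)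

text \<open>
  An element of a grazing layer \<open>l\<close> lies in \<open>H (Suc l)\<close> but not in \<open>H l\<close>, so \<open>Suc l\<close> is the least index of a subgroup
  containing it. Hence the least index in the definition of an inductive interval selects the layer.
\<close>

lemma inductive_interval_iff:
  "inductive_interval G n H h k C \<longleftrightarrow> (\<exists>T. (\<forall>l<n. grazes (k (Suc l)) (T l)) \<and> C = layers 0 T)"
proof -
  have key: "{g \<in> carrier G - {\<one>}. let i = (LEAST i. g \<in> H i)
      in \<exists>t\<in>J i. g \<in> (h i [^] t) <# H (i - 1)} = layers 0 T"
    if T: "\<And>l. l < n \<Longrightarrow> grazes (k (Suc l)) (T l)"
      and J: "\<And>l. l < n \<Longrightarrow> J (Suc l) = (\<lambda>t. t mod int (k (Suc l))) ` T l" for J T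
  proof -
    have mem: "(let i = (LEAST i. g \<in> H i) in \<exists>t\<in>J i. g \<in> (h i [^] t) <# H (i - 1)) \<longleftrightarrow> g \<in> layers 0 T"
      if "g \<in> carrier G - {\<one>}" for g
    proof -
      define i where "i = (LEAST i. g \<in> H i)"
      have gi: "g \<in> H i" unfolding i_def by (rule LeastI[of _ n]) (use that H_n in auto)
      have "i \<noteq> 0"
      proof
        assume "i = 0"
        then have "g = \<one>" using gi unfolding \<open>i = 0\<close> H_0 by (rule_tac singletonD)
        then show False using that by blast
      qed
      then obtain j where j: "i = Suc j" by (cases i) auto
      have "i \<le> n" unfolding i_def by (rule Least_le) (use that H_n in auto)
      then have jn: "j < n" using j by simp
      have gj: "g \<notin> H j" using not_less_Least[of j "\<lambda>i. g \<in> H i"] j i_def by auto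
      obtain t :: int and u where tu: "u \<in> H j" "g = h (Suc j) [^] t \<otimes> u"
        using h_generates[OF jn, of g] gi unfolding j by blast
      have "(\<exists>s\<in>J i. g \<in> (h i [^] s) <# H (i - 1)) \<longleftrightarrow> g \<in> layer j (J (Suc j))"
        unfolding j by (auto simp: layer_def l_coset_def)
      also have "\<dots> \<longleftrightarrow> (\<exists>s\<in>T j. int (k (Suc j)) dvd t - s mod int (k (Suc j)))"
        unfolding J[OF jn] tu(2) h_pow_layer_iff[OF jn tu(1)] by auto
      also have "\<dots> \<longleftrightarrow> (\<exists>s\<in>T j. int (k (Suc j)) dvd t - s)"
        by (simp add: mod_eq_dvd_iff[symmetric])
      also have "\<dots> \<longleftrightarrow> g \<in> layer j (T j)"
        unfolding tu(2) h_pow_layer_iff[OF jn tu(1)] ..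
      also have "\<dots> \<longleftrightarrow> g \<in> layers 0 T"
      proof
        assume "g \<in> layers 0 T"
        then obtain l where l: "l < n" "g \<in> layer l (T l)" by (auto simp: layers_def)
        have "g \<in> H (Suc l)" using l layer_subset by auto
        then have "Suc j \<le> Suc l" unfolding j[symmetric] i_def by (rule Least_le)
        moreover have "g \<notin> H l"
          using layer_disjoint[OF l(1)] T[OF l(1)] l(2) by (auto simp: grazes_def)
        then have "\<not> j < l" using H_mono[of "Suc j" l] l(1) gi j by (auto simp: Suc_le_eq)
        ultimately have "l = j" by simp
        then show "g \<in> layer j (T j)" using l by simp
      qed (use jn in \<open>auto simp: layers_def\<close>)
      finally show ?thesis unfolding Let_def i_def .
    qed
    have "layers 0 T \<subseteq> carrier G - {\<one>}"
    proof
      fix g assume "g \<in> layers 0 T"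
      then obtain l where l: "l < n" "g \<in> layer l (T l)" by (auto simp: layers_def)
      then have "g \<notin> H l" using layer_disjoint[OF l(1)] T[OF l(1)] by (auto simp: grazes_def)
      then show "g \<in> carrier G - {\<one>}" using l layer_carrier H_one[of l] by auto
    qed
    then show ?thesis using mem by blast
  qed
  show ?thesis
  proof
    assume "inductive_interval G n H h k C"
    then obtain J where J: "\<forall>i\<in>{1..n}. grazing_interval (k i) (J i)"
      and C: "C = {g \<in> carrier G - {\<one>}. let i = (LEAST i. g \<in> H i)
      in \<exists>t\<in>J i. g \<in> (h i [^] t) <# H (i - 1)}"
      unfolding inductive_interval_def by blast
    have "\<forall>l. \<exists>T. l < n \<longrightarrow> grazes (k (Suc l)) T \<and> J (Suc l) = (\<lambda>t. t mod int (k (Suc l))) ` T"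
      using J by (auto simp: grazing_interval_iff)
    then obtain T where "\<And>l. l < n \<Longrightarrow> grazes (k (Suc l)) (T l) \<and> J (Suc l) = (\<lambda>t. t mod int (k (Suc l))) ` T l"
      by metis
    then show "\<exists>T. (\<forall>l<n. grazes (k (Suc l)) (T l)) \<and> C = layers 0 T"
      using key[of T J] C by auto
  next
    assume "\<exists>T. (\<forall>l<n. grazes (k (Suc l)) (T l)) \<and> C = layers 0 T"
    then obtain T where T: "\<And>l. l < n \<Longrightarrow> grazes (k (Suc l)) (T l)" "C = layers 0 T" by blast
    let ?J = "\<lambda>i. (\<lambda>t. t mod int (k i)) ` T (i - 1)"
    have "grazing_interval (k i) (?J i)" if "i \<in> {1..n}" for i
    proof -
      define j where "j = i - 1"
      have "i = Suc j" "j < n" using that unfolding j_def by auto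
      then show ?thesis using T(1)[of j] unfolding grazing_interval_iff by auto
    qed
    then show "inductive_interval G n H h k C"
      unfolding inductive_interval_def using key[of T ?J] T by (intro exI[of _ ?J]) auto
  qed
qed

lemma H_translate_layer:
  assumes "i < n" "x \<in> H i"
  shows "x <# layer i T \<subseteq> layer i T"
proof
  fix g assume "g \<in> x <# layer i T"
  then obtain t u where tu: "t \<in> T" "u \<in> H i" "g = x \<otimes> (h (Suc i) [^] t \<otimes> u)"
    by (auto simp: layer_def l_coset_def)
  let ?c = "h (Suc i) [^] t"
  have c: "x \<in> carrier G" "u \<in> carrier G" "?c \<in> carrier G" using tu assms H_carrier[of i] by auto
  have "g = ?c \<otimes> ((inv ?c \<otimes> x \<otimes> ?c) \<otimes> u)"
    using c tu(3) by (simp add: m_assoc[symmetric])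
  moreover have "(inv ?c \<otimes> x \<otimes> ?c) \<otimes> u \<in> H i"
    using assms tu by (intro H_mult H_conj' h_pow_in) auto
  ultimately show "g \<in> layer i T" unfolding layer_def using tu(1) by blast
qed

lemma translate_inverse: "x \<in> carrier G \<Longrightarrow> S \<subseteq> carrier G \<Longrightarrow> x <# (inv x <# S) = S"
  by (simp add: lcos_m_assoc lcos_mult_one)

lemma translate_invariant:
  assumes "x \<in> carrier G" "S \<subseteq> carrier G" "x <# S \<subseteq> S" "inv x <# S \<subseteq> S"
  shows "x <# S = S"
proof
  have "x <# (inv x <# S) \<subseteq> x <# S" using assms(4) by (auto simp: l_coset_def)
  then show "S \<subseteq> x <# S" using translate_inverse assms by simp
qed (rule assms(3))

text \<open>
  A coset of \<open>H l\<close> in \<open>H (Suc l)\<close> is invariant under left translation by \<open>H l\<close>, because \<open>H l\<close> is normal in \<open>H (Suc l)\<close>. So translations in \<open>H i\<close> preserve all layers from \<open>i\<close> upwards.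
\<close>

lemma translate_layers:
  assumes "i \<le> n" "x \<in> H i"
  shows "x <# layers i T = layers i T"
proof -
  have sub: "y <# layers i T \<subseteq> layers i T" if "y \<in> H i" for y
  proof -
    have "y <# layer l (T l) \<subseteq> layer l (T l)" if "l \<in> {i..<n}" for l
      using H_translate_layer[of l y] H_mono[of i l] \<open>y \<in> H i\<close> that by auto
    then show ?thesis unfolding layers_def by (fastforce simp: l_coset_def)
  qed
  show ?thesis
    using sub[of x] sub[of "inv x"] assms H_inv H_carrier[of i] layers_carrier
    by (intro translate_invariant) auto
qed

lemma translate_layer:
  assumes "i < n"
  shows "(h (Suc i) [^] (s::int)) <# layer i T = layer i ((\<lambda>t. t + s) ` T)"
proof -
  have "h (Suc i) [^] s \<otimes> (h (Suc i) [^] t \<otimes> u) = h (Suc i) [^] (t + s) \<otimes> u" if "u \<in> H i" for t u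
    using that assms H_carrier[of i u] by (simp add: m_assoc[symmetric] int_pow_mult[symmetric] add.commute)
  note eq = this
  show ?thesis
  proof
    show "(h (Suc i) [^] s) <# layer i T \<subseteq> layer i ((\<lambda>t. t + s) ` T)"
      using eq unfolding layer_def l_coset_def by blast
    show "layer i ((\<lambda>t. t + s) ` T) \<subseteq> (h (Suc i) [^] s) <# layer i T"
    proof
      fix g assume "g \<in> layer i ((\<lambda>t. t + s) ` T)"
      then obtain t u where tu: "t \<in> T" "u \<in> H i" "g = h (Suc i) [^] (t + s) \<otimes> u"
        by (auto simp: layer_def)
      then have "g = h (Suc i) [^] s \<otimes> (h (Suc i) [^] t \<otimes> u)" using eq by simp
      then show "g \<in> (h (Suc i) [^] s) <# layer i T"
        using tu unfolding layer_def l_coset_def by blast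
    qed
  qed
qed

lemma translate_Un: "x <# (S \<union> S') = (x <# S) \<union> (x <# S')"
  by (auto simp: l_coset_def)

end

section \<open>Building sets from one-point steps\<close>

text \<open>
  If \<open>t\<close> is a new exponent next to an interval \<open>K\<close>, then \<open>K\<close> as seen from \<open>t\<close> grazes 0: its nearest element has
  become 1 or -1.
\<close>

lemma grazes_shifted:
  assumes "int_interval K" "\<not> (\<exists>s\<in>K. int k dvd t - s)" "K = {} \<or> t - 1 \<in> K \<or> t + 1 \<in> K"
  shows "grazes k ((\<lambda>s. s + - t) ` K)"
proof -
  have "\<not> int k dvd s + - t" if "s \<in> K" for s
    using assms(2) that by (metis dvd_minus_iff minus_diff_eq uminus_add_conv_diff add.commute)
  moreover have "1 \<in> (\<lambda>s. s + - t) ` K" if "t + 1 \<in> K"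
    using that by (rule rev_image_eqI) simp
  moreover have "-1 \<in> (\<lambda>s. s + - t) ` K" if "t - 1 \<in> K"
    using that by (rule rev_image_eqI) simp
  ultimately show ?thesis
    using assms int_interval_shift unfolding grazes_def by blast
qed

lemma int_interval_Int: "int_interval S \<Longrightarrow> int_interval T \<Longrightarrow> int_interval (S \<inter> T)"
  by (rule int_intervalI) (blast intro: int_intervalD)

lemma int_interval_ivl [simp]: "int_interval {a..b}" "int_interval {a..}" "int_interval {..a}" "int_interval UNIV" "int_interval {}" "int_interval {a}"
  by (auto intro!: int_intervalI)

lemma int_interval_Un:
  assumes "int_interval S" "int_interval T" "c \<in> S" "c \<in> T"
  shows "int_interval (S \<union> T)"
proof (rule int_intervalI)
  fix a b x assume a: "a \<in> S \<union> T" and b: "b \<in> S \<union> T" and x: "a \<le> x" "x \<le> b"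
  show "x \<in> S \<union> T"
  proof (cases "x \<le> c")
    case True
    from a show ?thesis
    proof
      assume "a \<in> S"
      then show ?thesis using int_intervalD[OF assms(1) _ assms(3) x(1) True] by simp
    next
      assume "a \<in> T"
      then show ?thesis using int_intervalD[OF assms(2) _ assms(4) x(1) True] by simp
    qed
  next
    case False
    then have c: "c \<le> x" by simp
    from b show ?thesis
    proof
      assume "b \<in> S"
      then show ?thesis using int_intervalD[OF assms(1,3) _ c x(2)] by simp
    next
      assume "b \<in> T"
      then show ?thesis using int_intervalD[OF assms(2,4) _ c x(2)] by simp
    qed
  qed
qed

lemma int_interval_insert_0:
  assumes "grazes k T"
  shows "int_interval (insert 0 T)"
proof -
  have T: "int_interval T" and "T = {} \<or> 1 \<in> T \<or> -1 \<in> T" using assms by (auto simp: grazes_def)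
  then consider "T = {}" | "1 \<in> T" | "-1 \<in> T" by blast
  then show ?thesis
  proof cases
    case 2
    then have "insert 0 T = {0..1} \<union> T" using atLeastAtMost_iff[of _ 0 "1::int"] by (auto simp: le_less)
    then show ?thesis using int_interval_Un[OF _ T, of "{0..1}" 1] 2 by simp
  next
    case 3
    then have "insert 0 T = {-1..0} \<union> T" by (auto simp: le_less)
    then show ?thesis using int_interval_Un[OF _ T, of "{-1..0}" "-1"] 3 by simp
  qed simp
qed

context polycyclic
begin

text \<open>
  The relations \<open>R S S'\<close> to which the building principle applies. They express that a configuration on \<open>S\<close> controls
  what happens on the larger set \<open>S'\<close>.
\<close>

definition extension_relation :: "('a set \<Rightarrow> 'a set \<Rightarrow> bool) \<Rightarrow> bool" where
  "extension_relation R \<longleftrightarrow>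
     (\<forall>S\<subseteq>carrier G. R S S) \<and>
     (\<forall>S S' S''. S \<subseteq> S' \<longrightarrow> S' \<subseteq> S'' \<longrightarrow> S'' \<subseteq> carrier G \<longrightarrow> R S S' \<longrightarrow> R S' S'' \<longrightarrow> R S S'') \<and>
     (\<forall>g\<in>carrier G. \<forall>S S'. S \<subseteq> S' \<longrightarrow> S' \<subseteq> carrier G \<longrightarrow> R S S' \<longrightarrow> R (g <# S) (g <# S')) \<and>
     (\<forall>S :: nat \<Rightarrow> 'a set. (\<forall>j. S j \<subseteq> S (Suc j) \<and> S j \<subseteq> carrier G \<and> R (S j) (S (Suc j))) \<longrightarrow> R (S 0) (\<Union>j. S j))"

lemma extension_relationD:
  assumes "extension_relation R"
  shows "S \<subseteq> carrier G \<Longrightarrow> R S S"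
    and "R S S' \<Longrightarrow> R S' S'' \<Longrightarrow> S \<subseteq> S' \<Longrightarrow> S' \<subseteq> S'' \<Longrightarrow> S'' \<subseteq> carrier G \<Longrightarrow> R S S''"
    and "g \<in> carrier G \<Longrightarrow> S \<subseteq> S' \<Longrightarrow> S' \<subseteq> carrier G \<Longrightarrow> R S S' \<Longrightarrow> R (g <# S) (g <# S')"
    and "(\<And>j::nat. F j \<subseteq> F (Suc j)) \<Longrightarrow> (\<And>j. F j \<subseteq> carrier G) \<Longrightarrow> (\<And>j. R (F j) (F (Suc j))) \<Longrightarrow> R (F 0) (\<Union>j. F j)"
proof -
  note R = assms[unfolded extension_relation_def]
  show "S \<subseteq> carrier G \<Longrightarrow> R S S" using conjunct1[OF R] by blast
  show "R S S' \<Longrightarrow> R S' S'' \<Longrightarrow> S \<subseteq> S' \<Longrightarrow> S' \<subseteq> S'' \<Longrightarrow> S'' \<subseteq> carrier G \<Longrightarrow> R S S''"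
    using conjunct1[OF conjunct2[OF R]] by simp
  show "g \<in> carrier G \<Longrightarrow> S \<subseteq> S' \<Longrightarrow> S' \<subseteq> carrier G \<Longrightarrow> R S S' \<Longrightarrow> R (g <# S) (g <# S')"
    using conjunct1[OF conjunct2[OF conjunct2[OF R]]] by simp
  show "(\<And>j::nat. F j \<subseteq> F (Suc j)) \<Longrightarrow> (\<And>j. F j \<subseteq> carrier G) \<Longrightarrow> (\<And>j. R (F j) (F (Suc j))) \<Longrightarrow> R (F 0) (\<Union>j. F j)"
    using spec[OF conjunct2[OF conjunct2[OF conjunct2[OF R]]], of F] by simp
qed

definition grazing_tuple :: "(nat \<Rightarrow> int set) \<Rightarrow> bool" where
  "grazing_tuple T \<longleftrightarrow> (\<forall>l<n. grazes (k (Suc l)) (T l))"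

text \<open>
  One further coset is added to layer \<open>i\<close>. If its exponent is new modulo \<open>k\<close>, translate this coset to \<open>H i\<close>; the
  present set then consists of layers \<open>i\<close> and above with grazing exponents, and the induction hypothesis adds \<open>H i\<close>.
  If the exponent is old, nothing changes.
\<close>

lemma grow_coset:
  assumes R: "extension_relation R" and i: "i < n"
    and IH: "\<And>T. grazing_tuple T \<Longrightarrow> R (layers i T) (layers i T \<union> H i)"
    and T: "grazing_tuple T" and K: "int_interval K" "K = {} \<or> t - 1 \<in> K \<or> t + 1 \<in> K"
  shows "R (layer i K \<union> layers (Suc i) T) (layer i (insert t K) \<union> layers (Suc i) T)"
proof (cases "\<exists>s\<in>K. int (k (Suc i)) dvd t - s")
  case True
  have "layer i (insert t K) = layer i K"
  proof -
    have "layer i {t} \<subseteq> layer i K"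
    proof
      fix g assume "g \<in> layer i {t}"
      then obtain u where "u \<in> H i" "g = h (Suc i) [^] t \<otimes> u" by (auto simp: layer_def)
      then show "g \<in> layer i K" using h_pow_layer_iff[OF i, of u t K] True by simp
    qed
    then show ?thesis using layer_Un[of i "{t}" K] by auto
  qed
  then show ?thesis
    using extension_relationD(1)[OF R] layer_carrier[OF i] layers_carrier by simp
next
  case False
  let ?g = "h (Suc i) [^] t" and ?K = "(\<lambda>s. s + - t) ` K"
  let ?T = "T(i := ?K)"
  have "grazes (k (Suc i)) ?K" by (rule grazes_shifted[OF K(1) False K(2)])
  then have "grazing_tuple ?T" using T unfolding grazing_tuple_def by simp
  from IH[OF this] have "R (layers i ?T) (layers i ?T \<union> H i)" .
  moreover have "layers i ?T = layer i ?K \<union> layers (Suc i) T"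
    unfolding layers_Suc[OF i] using layers_cong[of "Suc i" ?T T] by simp
  ultimately have "R (layer i ?K \<union> layers (Suc i) T) (layer i ?K \<union> layers (Suc i) T \<union> H i)" by simp
  moreover have "H i \<subseteq> carrier G" using H_carrier[of i] i by auto
  ultimately have "R (?g <# (layer i ?K \<union> layers (Suc i) T)) (?g <# (layer i ?K \<union> layers (Suc i) T \<union> H i))"
    using layer_carrier[OF i] layers_carrier i by (intro extension_relationD(3)[OF R]) auto
  moreover have "?g <# layers (Suc i) T = layers (Suc i) T"
    using i h_pow_in by (intro translate_layers) auto
  moreover have "?g <# layer i ?K = layer i K"
    unfolding translate_layer[OF i] by (simp add: image_image)
  moreover have "?g <# H i = layer i {t}"
    using translate_layer[OF i, of t "{0}"] layer_zero[OF i] by simp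
  moreover have "layer i K \<union> layers (Suc i) T \<union> layer i {t} = layer i (insert t K) \<union> layers (Suc i) T"
    using layer_Un[of i "{t}" K] by auto
  ultimately show ?thesis unfolding translate_Un by simp
qed

text \<open>
  Starting from any \<open>c \<in> K\<close>, the interval is extended to the right end of \<open>K'\<close> and then to the left end, one integer
  at a time. Either end may be infinite, which is where the closure under increasing unions is used.
\<close>

lemma grow_interval:
  assumes R: "extension_relation R" and i: "i < n"
    and IH: "\<And>T. grazing_tuple T \<Longrightarrow> R (layers i T) (layers i T \<union> H i)"
    and T: "grazing_tuple T" and K: "int_interval K" "int_interval K'" "K \<subseteq> K'"
  shows "R (layer i K \<union> layers (Suc i) T) (layer i K' \<union> layers (Suc i) T)"
proof -
  let ?L = "\<lambda>K. layer i K \<union> layers (Suc i) T"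
  have carr: "?L K \<subseteq> carrier G" for K using layer_carrier[OF i] layers_carrier by auto
  have mono: "?L S \<subseteq> ?L S'" if "S \<subseteq> S'" for S S' using that by (auto simp: layer_def)
  have step: "R (?L S) (?L (insert t S))"
    if "int_interval S" "S = {} \<or> t - 1 \<in> S \<or> t + 1 \<in> S" for S t
    by (rule grow_coset[OF R i IH T that])
  note trans = extension_relationD(2)[OF R]
  have nonempty: "R (?L S) (?L K')" if S: "int_interval S" "S \<subseteq> K'" "c \<in> S" for S c
  proof -
    let ?S' = "S \<union> (K' \<inter> {c..})"
    define U where "U N = S \<union> (K' \<inter> {c..c + int N})" for N
    define V where "V N = ?S' \<union> (K' \<inter> {c - int N..c})" for N
    have c: "c \<in> K'" using S by blast
    \<comment> \<open>\<open>U\<close> grows to the right of \<open>c\<close> inside \<open>K'\<close>; \<open>V\<close> starts from the union of \<open>U\<close> and grows to the left.\<close>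
    have Uiv: "int_interval (U N)" for N unfolding U_def using c S K
      by (intro int_interval_Un[of _ _ c] int_interval_Int int_interval_ivl) auto
    have S'iv: "int_interval ?S'" using c S K by (intro int_interval_Un[of _ _ c] int_interval_Int int_interval_ivl) auto
    have Viv: "int_interval (V N)" for N unfolding V_def using c S K S'iv
      by (intro int_interval_Un[of _ _ c] int_interval_Int int_interval_ivl) auto
    have Ustep: "R (?L (U N)) (?L (U (Suc N)))" for N
    proof (cases "c + int (Suc N) \<in> K'")
      case True
      have "c + int N \<in> K'" using int_intervalD[OF K(2) c True] by simp
      then have "c + int (Suc N) - 1 \<in> U N" unfolding U_def by simp
      moreover have "U (Suc N) = insert (c + int (Suc N)) (U N)"
        using True unfolding U_def by auto
      ultimately show ?thesis using step[OF Uiv[of N], of "c + int (Suc N)"] by simp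
    next
      case False
      have "K' \<inter> {c..c + int (Suc N)} = K' \<inter> {c..c + int N}"
      proof -
        have "x \<noteq> c + int (Suc N)" if "x \<in> K'" for x using False that by blast
        then show ?thesis by force
      qed
      then have "U (Suc N) = U N" unfolding U_def by simp
      then show ?thesis using extension_relationD(1)[OF R carr] by simp
    qed
    have Vstep: "R (?L (V N)) (?L (V (Suc N)))" for N
    proof (cases "c - int (Suc N) \<in> K'")
      case True
      have "c - int N \<in> K'" using int_intervalD[OF K(2) True c] by simp
      then have "c - int (Suc N) + 1 \<in> V N" unfolding V_def by simp
      moreover have "V (Suc N) = insert (c - int (Suc N)) (V N)"
        using True unfolding V_def by auto
      ultimately show ?thesis using step[OF Viv[of N], of "c - int (Suc N)"] by simp
    next
      case False
      have "K' \<inter> {c - int (Suc N)..c} = K' \<inter> {c - int N..c}"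
      proof -
        have "x \<noteq> c - int (Suc N)" if "x \<in> K'" for x using False that by blast
        then show ?thesis by force
      qed
      then have "V (Suc N) = V N" unfolding V_def by simp
      then show ?thesis using extension_relationD(1)[OF R carr] by simp
    qed
    have Umono: "U N \<subseteq> U (Suc N)" and Vmono: "V N \<subseteq> V (Suc N)" for N
      unfolding U_def V_def by auto
    have "R (?L (U 0)) (\<Union>N. ?L (U N))"
      by (rule extension_relationD(4)[OF R]) (rule mono[OF Umono] carr Ustep)+
    moreover have "U 0 = S" using S(3) unfolding U_def by auto
    moreover have "(\<Union>N. U N) = ?S'"
    proof -
      have "x \<in> {c..c + int (nat (x - c))}" if "x \<ge> c" for x using that by simp
      then show ?thesis unfolding U_def by fastforce
    qed
    then have "(\<Union>N. ?L (U N)) = ?L ?S'" using layer_UN[of i U UNIV] by auto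
    ultimately have 1: "R (?L S) (?L ?S')" by simp
    have "R (?L (V 0)) (\<Union>N. ?L (V N))"
      by (rule extension_relationD(4)[OF R]) (rule mono[OF Vmono] carr Vstep)+
    moreover have "V 0 = ?S'" using S(3) unfolding V_def by auto
    moreover have "(\<Union>N. V N) = K'"
    proof -
      have "x \<in> {c..} \<or> x \<in> {c - int (nat (c - x))..c}" for x by auto
      then show ?thesis unfolding V_def using S(2) by fastforce
    qed
    then have "(\<Union>N. ?L (V N)) = ?L K'" using layer_UN[of i V UNIV] by auto
    ultimately have 2: "R (?L ?S') (?L K')" by simp
    show ?thesis by (rule trans[OF 1 2 mono mono carr]) (use S(2) in auto)
  qed
  show ?thesis
  proof (cases "K = {}")
    case False
    then obtain c where "c \<in> K" by blast
    then show ?thesis by (rule nonempty[OF K(1,3)])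
  next
    case Kempty: True
    show ?thesis
    proof (cases "K' = {}")
      case True
      show ?thesis unfolding Kempty True by (rule extension_relationD(1)[OF R carr])
    next
      case False
      then obtain c where c: "c \<in> K'" by blast
      have 1: "R (?L {}) (?L {c})" using step[of "{}" c] by simp
      have 2: "R (?L {c}) (?L K')" using nonempty[of "{c}" c] c by simp
      show ?thesis unfolding Kempty
        by (rule trans[OF 1 2 mono mono carr]) (use c in auto)
    qed
  qed
qed

context
  fixes R
  assumes R: "extension_relation R"
    and base: "\<And>T. grazing_tuple T \<Longrightarrow> R (layers 0 T) (layers 0 T \<union> {\<one>})"
begin

text \<open>
  A coset of \<open>H i\<close> in \<open>H (Suc i)\<close> can be filled by the induction hypothesis, and \<open>H (Suc i)\<close> is filled coset by coset.
\<close>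

lemma extend_by_H: "i \<le> n \<Longrightarrow> grazing_tuple T \<Longrightarrow> R (layers i T) (layers i T \<union> H i)"
proof (induction i arbitrary: T)
  case 0
  then show ?case using base H_0 by simp
next
  case (Suc i)
  then have i: "i < n" by simp
  have "R (layer i {} \<union> layers (Suc i) T) (layer i UNIV \<union> layers (Suc i) T)"
    using i by (intro grow_interval[OF R i Suc.IH Suc.prems(2)]) auto
  then show ?case using layer_UNIV[OF i] by (simp add: Un_commute)
qed

text \<open>
  The layers of an inductive interval are filled from the top layer downwards.
\<close>

lemma extend_empty: "i \<le> n \<Longrightarrow> grazing_tuple T \<Longrightarrow> R {} (layers i T)"
proof (induction i rule: inc_induct)
  case base
  then show ?case using extension_relationD(1)[OF R] by simp
next
  case (step i)
  then have i: "i < n" by simp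
  have "R (layer i {} \<union> layers (Suc i) T) (layer i (T i) \<union> layers (Suc i) T)"
    using step.prems i by (intro grow_interval[OF R i extend_by_H]) (auto simp: grazing_tuple_def grazes_def)
  then have "R (layers (Suc i) T) (layers i T)" using layers_Suc[OF i] by simp
  from extension_relationD(2)[OF R step.IH[OF step.prems] this] show ?case
    using layers_Suc[OF i] layers_carrier layer_carrier[OF i] by simp
qed

text \<open>
  Together with \<open>H i\<close>, the exponents in layer \<open>i\<close> form the interval \<open>insert 0 (T i)\<close>, which grows to all of \<open>\<int>\<close>. This
  turns \<open>H i\<close> into \<open>H (Suc i)\<close>.
\<close>

lemma extend_to_carrier: "i \<le> n \<Longrightarrow> grazing_tuple T \<Longrightarrow> R (layers i T \<union> H i) (carrier G)"
proof (induction i rule: inc_induct)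
  case base
  then show ?case using extension_relationD(1)[OF R] H_n by simp
next
  case (step i)
  then have i: "i < n" by simp
  have "int_interval (insert 0 (T i))"
    using step.prems i unfolding grazing_tuple_def by (blast intro: int_interval_insert_0)
  then have "R (layer i (insert 0 (T i)) \<union> layers (Suc i) T) (layer i UNIV \<union> layers (Suc i) T)"
    using step.prems i by (intro grow_interval[OF R i extend_by_H]) auto
  moreover have "layer i (insert 0 (T i)) \<union> layers (Suc i) T = layers i T \<union> H i"
    using layers_Suc[OF i] layer_zero[OF i] layer_Un[of i "{0}" "T i"] by auto
  moreover have "layer i UNIV \<union> layers (Suc i) T = layers (Suc i) T \<union> H (Suc i)"
    using layer_UNIV[OF i] by auto
  ultimately have 1: "R (layers i T \<union> H i) (layers (Suc i) T \<union> H (Suc i))" by simp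
  have "layers i T \<subseteq> layers (Suc i) T \<union> H (Suc i)"
    using layers_Suc[OF i] layer_subset[OF i] by auto
  moreover have "layers (Suc i) T \<union> H (Suc i) \<subseteq> carrier G"
    using layers_carrier H_mono[of "Suc i" n] H_n i by simp
  ultimately show ?case
    using H_mono_Suc[OF i] extension_relationD(2)[OF R 1 step.IH[OF step.prems]] by auto
qed

lemma extend_interval_to_carrier:
  assumes T: "grazing_tuple T"
  shows "R (layers 0 T) (carrier G)"
proof -
  have "layers 0 T \<union> H 0 \<subseteq> carrier G" using layers_carrier H_mono[of 0 n] H_n by auto
  then show ?thesis
    using extension_relationD(2)[OF R extend_by_H[OF le0 T] extend_to_carrier[OF le0 T]] by auto
qed

lemma extend_H_to_carrier: "i \<le> n \<Longrightarrow> R (H i) (carrier G)"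
proof -
  assume i: "i \<le> n"
  have "grazing_tuple (\<lambda>_. {})" by (simp add: grazing_tuple_def grazes_def)
  moreover have "layers i (\<lambda>_. {}) = {}" by (simp add: layers_def)
  ultimately show ?thesis using extend_to_carrier[OF i, of "\<lambda>_. {}"] by simp
qed

end

end

section \<open>Compactness, occurrences and shifts\<close>

text \<open>
  All compactness arguments below, about configurations as well as about tuples of intervals, are instances of this one: if for each finite
  set \<open>D\<close> of coordinates there is an \<open>x\<close> satisfying a condition that weakens when \<open>D\<close> shrinks, then such \<open>x\<close> accumulate at some
  \<open>f\<close>. The closed sets with the finite intersection property are the sets of those \<open>f\<close> that agree on \<open>D\<close> with an
  admissible \<open>x\<close>; each is a finite union of cylinders.
\<close>

lemma compact_finite_valued:
  fixes \<Phi> :: "'i set \<Rightarrow> ('i \<Rightarrow> 'v::finite) \<Rightarrow> bool"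
  assumes ex: "\<And>D. finite D \<Longrightarrow> \<exists>x. \<Phi> D x"
    and anti: "\<And>D D' x. \<Phi> D' x \<Longrightarrow> D \<subseteq> D' \<Longrightarrow> finite D' \<Longrightarrow> \<Phi> D x"
  shows "\<exists>f. \<forall>D. finite D \<longrightarrow> (\<exists>x. \<Phi> D x \<and> (\<forall>i\<in>D. x i = f i))"
proof -
  let ?T = "product_topology (\<lambda>_. discrete_topology (UNIV :: 'v set)) (UNIV :: 'i set)"
  define S where "S D = {f. \<exists>x. \<Phi> D x \<and> (\<forall>i\<in>D. x i = f i)}" for D
  have compact: "compact_space ?T"
    by (simp add: compact_space_product_topology compact_space_discrete_topology)
  have closed: "closedin ?T (S D)" if D: "finite D" for D
  proof -
    let ?cyl = "\<lambda>x. Pi\<^sub>E UNIV (\<lambda>i. if i \<in> D then {x i} else UNIV)"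
    have S_D: "S D = (\<Union>v \<in> (\<lambda>x. restrict x D) ` {x. \<Phi> D x}. ?cyl v)"
    proof -
      have cyl: "f \<in> ?cyl (restrict x D) \<longleftrightarrow> (\<forall>i\<in>D. x i = f i)" for f x
        by (auto simp: PiE_iff split: if_splits)
      show ?thesis
      proof (rule Set.set_eqI)
        fix f
        have "f \<in> S D \<longleftrightarrow> (\<exists>x. \<Phi> D x \<and> f \<in> ?cyl (restrict x D))"
          unfolding S_def mem_Collect_eq cyl ..
        also have "\<dots> \<longleftrightarrow> f \<in> (\<Union>v \<in> (\<lambda>x. restrict x D) ` {x. \<Phi> D x}. ?cyl v)"
          unfolding UN_iff bex_simps mem_Collect_eq by simp
        finally show "f \<in> S D \<longleftrightarrow> f \<in> (\<Union>v \<in> (\<lambda>x. restrict x D) ` {x. \<Phi> D x}. ?cyl v)" .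
      qed
    qed
    have "(\<lambda>x. restrict x D) ` {x. \<Phi> D x} \<subseteq> Pi\<^sub>E D (\<lambda>_. UNIV)" by auto
    then have fin: "finite ((\<lambda>x. restrict x D) ` {x. \<Phi> D x})"
      by (rule finite_subset) (simp add: D finite_PiE)
    have "closedin ?T (?cyl v)" for v by (simp add: closedin_product_topology)
    then show ?thesis unfolding S_D by (intro closedin_Union finite_imageI fin) blast
  qed
  have "\<Inter> (S ` {D. finite D}) \<noteq> {}"
  proof -
    have "\<forall>\<U>. (\<forall>C\<in>\<U>. closedin ?T C) \<and> (\<forall>\<F>. finite \<F> \<and> \<F> \<subseteq> \<U> \<longrightarrow> \<Inter>\<F> \<noteq> {}) \<longrightarrow> \<Inter>\<U> \<noteq> {}"
      using compact unfolding compact_space_fip .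
    moreover have "\<Inter>\<F> \<noteq> {}" if F: "finite \<F>" "\<F> \<subseteq> S ` {D. finite D}" for \<F>
    proof -
      obtain \<D> where D: "finite \<D>" "\<D> \<subseteq> {D. finite D}" "\<F> = S ` \<D>"
        using finite_subset_image[OF F] by blast
      then have fin: "finite (\<Union>\<D>)" by auto
      obtain x where x: "\<Phi> (\<Union>\<D>) x" using ex[OF fin] by blast
      then have "x \<in> S D" if "D \<in> \<D>" for D
        using anti[OF x _ fin, of D] that unfolding S_def by blast
      then show ?thesis using D(3) by blast
    qed
    ultimately show ?thesis using closed by (simp add: image_iff)
  qed
  then obtain f where "\<And>D. finite D \<Longrightarrow> f \<in> S D" by auto
  then show ?thesis unfolding S_def by blast
qed

context group
begin

definition occ_at :: "'a \<Rightarrow> ('a, 'c) config \<Rightarrow> ('a, 'c) config \<Rightarrow> bool" where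
  "occ_at g P x \<longleftrightarrow> (\<forall>d\<in>dom P. x (g \<otimes> d) = P d)"

definition avoids :: "('a, 'c) config set \<Rightarrow> ('a, 'c) config \<Rightarrow> bool" where
  "avoids Ps x \<longleftrightarrow> (\<forall>P\<in>Ps. \<forall>g\<in>carrier G. \<not> occ_at g P x)"

text \<open>
  The values of \<open>P\<close> on its domain are not \<open>None\<close>, so the translate of this domain lies in the domain of \<open>x\<close>.
\<close>

lemma occurs_iff: "occurs G P x \<longleftrightarrow> (\<exists>g\<in>carrier G. occ_at g P x)"
proof -
  have "g <# dom P \<subseteq> dom x" if "occ_at g P x" for g
    using that unfolding occ_at_def l_coset_def by (auto simp: domIff)
  then show ?thesis unfolding occurs_def occ_at_def by blast
qed

lemma not_occurs_iff: "\<not> (\<exists>P\<in>Ps. occurs G P x) \<longleftrightarrow> avoids Ps x"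
  unfolding occurs_iff avoids_def by blast

lemma SFT_iff: "x \<in> SFT G F \<longleftrightarrow> dom x = carrier G \<and> avoids F x"
  unfolding SFT_def not_occurs_iff by simp

lemma defines_restr_iff:
  "defines_restr G Ps X C \<longleftrightarrow> (\<forall>x. dom x = C \<longrightarrow> (x \<in> restr X C \<longleftrightarrow> avoids Ps x))"
  unfolding defines_restr_def not_occurs_iff ..

lemma occ_at_le: "occ_at g P x \<Longrightarrow> x \<subseteq>\<^sub>m y \<Longrightarrow> occ_at g P y"
  unfolding occ_at_def map_le_def by (metis domIff)

lemma occ_at_cong: "occ_at g P x \<Longrightarrow> (\<And>d. d \<in> dom P \<Longrightarrow> x (g \<otimes> d) = y (g \<otimes> d)) \<Longrightarrow> occ_at g P y"
  unfolding occ_at_def by metis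

lemma avoids_le: "avoids Ps y \<Longrightarrow> x \<subseteq>\<^sub>m y \<Longrightarrow> avoids Ps x"
  unfolding avoids_def using occ_at_le by blast

lemma map_le_restrict [simp]: "x |` S \<subseteq>\<^sub>m x"
  unfolding map_le_def by (auto simp: restrict_map_def split: if_splits)

lemma avoids_restrict: "avoids Ps y \<Longrightarrow> avoids Ps (y |` S)"
  using avoids_le map_le_restrict by blast

lemma pattern_setD: "pattern_set G Ps \<Longrightarrow> P \<in> Ps \<Longrightarrow> d \<in> dom P \<Longrightarrow> d \<in> carrier G"
  "pattern_set G Ps \<Longrightarrow> P \<in> Ps \<Longrightarrow> finite (dom P)" "pattern_set G Ps \<Longrightarrow> finite Ps"
  unfolding pattern_set_def by blast+

lemma avoids_local:
  assumes Ps: "pattern_set G Ps"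
    and loc: "\<And>D. finite D \<Longrightarrow> \<exists>x. avoids Ps x \<and> (\<forall>g\<in>D. x g = f g)"
  shows "avoids Ps f"
  unfolding avoids_def
proof (intro ballI notI)
  fix P g assume P: "P \<in> Ps" "g \<in> carrier G" "occ_at g P f"
  have "finite ((\<lambda>d. g \<otimes> d) ` dom P)" using pattern_setD(2)[OF Ps P(1)] by simp
  from loc[OF this] obtain x where x: "avoids Ps x" "\<forall>i\<in>(\<lambda>d. g \<otimes> d) ` dom P. x i = f i" by blast
  have "occ_at g P x" using P(3) by (rule occ_at_cong) (use x(2) in simp)
  then show False using x(1) P unfolding avoids_def by blast
qed

lemma shift_dom:
  assumes "g \<in> carrier G" "dom x \<subseteq> carrier G"
  shows "dom (shift G g x) = g <# dom x"
proof
  show "dom (shift G g x) \<subseteq> g <# dom x"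
  proof
    fix a assume "a \<in> dom (shift G g x)"
    then have a: "a \<in> carrier G" "inv g \<otimes> a \<in> dom x"
      by (auto simp: shift_def domIff split: if_splits)
    then have "a = g \<otimes> (inv g \<otimes> a)" using assms by (simp add: m_assoc[symmetric])
    then show "a \<in> g <# dom x" using a(2) unfolding l_coset_def by blast
  qed
  show "g <# dom x \<subseteq> dom (shift G g x)"
  proof
    fix a assume "a \<in> g <# dom x"
    then obtain b where b: "b \<in> dom x" "a = g \<otimes> b" unfolding l_coset_def by blast
    then have "b \<in> carrier G" using assms by blast
    then show "a \<in> dom (shift G g x)" using b assms by (auto simp: shift_def m_assoc[symmetric] domIff)
  qed
qed

lemma shift_apply: "g \<in> carrier G \<Longrightarrow> a \<in> carrier G \<Longrightarrow> shift G g x (g \<otimes> a) = x a"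
  by (simp add: shift_def m_assoc[symmetric])

lemma shift_occ_at:
  assumes "g \<in> carrier G" "a \<in> carrier G" "dom P \<subseteq> carrier G"
  shows "occ_at (g \<otimes> a) P (shift G g x) \<longleftrightarrow> occ_at a P x"
proof -
  have "shift G g x (g \<otimes> a \<otimes> d) = x (a \<otimes> d)" if "d \<in> dom P" for d
  proof -
    have "d \<in> carrier G" using that assms by blast
    then show ?thesis using shift_apply[of g "a \<otimes> d" x] assms by (simp add: m_assoc)
  qed
  then show ?thesis unfolding occ_at_def by simp
qed

lemma shift_avoids:
  assumes g: "g \<in> carrier G" and Ps: "pattern_set G Ps" and x: "avoids Ps x"
  shows "avoids Ps (shift G g x)"
  unfolding avoids_def
proof (intro ballI notI)
  fix P a assume P: "P \<in> Ps" "a \<in> carrier G" "occ_at a P (shift G g x)"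
  then have "occ_at (g \<otimes> (inv g \<otimes> a)) P (shift G g x)" using g by (simp add: m_assoc[symmetric])
  then have "occ_at (inv g \<otimes> a) P x"
    using shift_occ_at[of g "inv g \<otimes> a" P x] g P pattern_setD(1)[OF Ps P(1)] by auto
  then show False using x P g unfolding avoids_def by blast
qed

lemma shift_inv:
  assumes "g \<in> carrier G" "dom x \<subseteq> carrier G"
  shows "shift G g (shift G (inv g) x) = x"
proof
  fix a
  have "x a = None" if "a \<notin> carrier G" using assms(2) that by blast
  then show "shift G g (shift G (inv g) x) a = x a"
    using assms(1) by (cases "a \<in> carrier G") (simp_all add: shift_def m_assoc[symmetric])
qed

lemma shift_restrict:
  assumes "g \<in> carrier G" "S \<subseteq> carrier G"
  shows "shift G g (x |` S) = shift G g x |` (g <# S)"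
proof
  fix a
  show "shift G g (x |` S) a = (shift G g x |` (g <# S)) a"
  proof (cases "a \<in> carrier G")
    case True
    then have a: "a = g \<otimes> (inv g \<otimes> a)" using assms by (simp add: m_assoc[symmetric])
    have "a \<in> g <# S \<longleftrightarrow> inv g \<otimes> a \<in> S"
    proof
      assume "a \<in> g <# S"
      then obtain b where "b \<in> S" "a = g \<otimes> b" unfolding l_coset_def by blast
      then show "inv g \<otimes> a \<in> S" using assms by (auto simp: m_assoc[symmetric] subset_iff)
    next
      assume "inv g \<otimes> a \<in> S"
      then show "a \<in> g <# S" using a unfolding l_coset_def by blast
    qed
    then show ?thesis by (simp add: shift_def restrict_map_def)
  qed (simp add: shift_def restrict_map_def)
qed

lemma shift_SFT:
  assumes "g \<in> carrier G" "pattern_set G F" "x \<in> SFT G F"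
  shows "shift G g x \<in> SFT G F"
proof -
  have "g <# carrier G = carrier G"
  proof
    show "carrier G \<subseteq> g <# carrier G"
    proof
      fix a assume "a \<in> carrier G"
      then have "a = g \<otimes> (inv g \<otimes> a)" "inv g \<otimes> a \<in> carrier G"
        using assms(1) by (simp_all add: m_assoc[symmetric])
      then show "a \<in> g <# carrier G" unfolding l_coset_def by blast
    qed
  qed (use assms(1) in \<open>auto simp: l_coset_def\<close>)
  then show ?thesis
    using assms shift_dom[of g x] shift_avoids unfolding SFT_iff by auto
qed

end

section \<open>Certificates and their soundness\<close>

context group
begin

lemma restrict_restrict_subset: "D \<subseteq> C \<Longrightarrow> (x |` C) |` D = x |` D"
  by (simp add: Int_absorb1)

lemma restr_iff: "x \<in> restr X C \<longleftrightarrow> (\<exists>y\<in>X. x = y |` C)"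
  unfolding restr_def by blast

lemma restr_restrict: "x \<in> restr X C \<Longrightarrow> D \<subseteq> C \<Longrightarrow> x |` D \<in> restr X D"
proof -
  assume "x \<in> restr X C" and D: "D \<subseteq> C"
  then obtain y where y: "y \<in> X" "x = y |` C" unfolding restr_iff by blast
  have "x |` D = y |` D" unfolding y(2) by (rule restrict_restrict_subset[OF D])
  then show ?thesis unfolding restr_iff using y(1) by blast
qed

text \<open>
  Membership in \<open>X|C\<close> is decided on the finite subsets of \<open>C\<close>, as \<open>X\<close> is compact.
\<close>

lemma SFT_restr_compact:
  fixes F :: "('a, 'c::finite) config set"
  assumes F: "pattern_set G F" and x: "dom x = C" "C \<subseteq> carrier G"
    and loc: "\<And>D. finite D \<Longrightarrow> D \<subseteq> C \<Longrightarrow> x |` D \<in> restr (SFT G F) D"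
  shows "x \<in> restr (SFT G F) C"
proof -
  have "\<exists>f. \<forall>D. finite D \<longrightarrow> (\<exists>z. (z \<in> SFT G F \<and> z |` (D \<inter> C) = x |` (D \<inter> C)) \<and> (\<forall>i\<in>D. z i = f i))"
  proof (rule compact_finite_valued)
    fix D :: "'a set" assume "finite D"
    then have "x |` (D \<inter> C) \<in> restr (SFT G F) (D \<inter> C)" by (intro loc) auto
    then show "\<exists>z. z \<in> SFT G F \<and> z |` (D \<inter> C) = x |` (D \<inter> C)" unfolding restr_iff by metis
  next
    fix D D' :: "'a set" and z
    assume z: "z \<in> SFT G F \<and> z |` (D' \<inter> C) = x |` (D' \<inter> C)" and D: "D \<subseteq> D'"
    have sub: "D \<inter> C \<subseteq> D' \<inter> C" using D by blast
    have "z |` (D \<inter> C) = (z |` (D' \<inter> C)) |` (D \<inter> C)" by (rule restrict_restrict_subset[OF sub, symmetric])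
    also have "\<dots> = (x |` (D' \<inter> C)) |` (D \<inter> C)" using z by (simp only:)
    also have "\<dots> = x |` (D \<inter> C)" by (rule restrict_restrict_subset[OF sub])
    finally show "z \<in> SFT G F \<and> z |` (D \<inter> C) = x |` (D \<inter> C)" using z by simp
  qed
  then obtain f where "\<forall>D. finite D \<longrightarrow>
      (\<exists>z. (z \<in> SFT G F \<and> z |` (D \<inter> C) = x |` (D \<inter> C)) \<and> (\<forall>i\<in>D. z i = f i))" ..
  then have f: "\<exists>z. z \<in> SFT G F \<and> z |` (D \<inter> C) = x |` (D \<inter> C) \<and> (\<forall>i\<in>D. z i = f i)"
    if "finite D" for D using that by (simp only: conj_assoc)
  have "avoids F f"
  proof (rule avoids_local[OF F])
    fix D :: "'a set" assume "finite D"
    then show "\<exists>z. avoids F z \<and> (\<forall>i\<in>D. z i = f i)" using f SFT_iff by blast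
  qed
  moreover have "dom f = carrier G"
  proof -
    have "f g \<noteq> None \<longleftrightarrow> g \<in> carrier G" for g
    proof -
      obtain z where z: "z \<in> SFT G F" "z g = f g" using f[of "{g}"] by auto
      have "z g \<noteq> None \<longleftrightarrow> g \<in> carrier G" using z(1) SFT_iff[of z F] by (simp add: domIff set_eq_iff)
      then show ?thesis using z(2) by simp
    qed
    then show ?thesis by auto
  qed
  moreover have "x = f |` C"
  proof
    fix g
    obtain z where z: "z |` ({g} \<inter> C) = x |` ({g} \<inter> C)" "z g = f g" using f[of "{g}"] by auto
    show "x g = (f |` C) g"
    proof (cases "g \<in> C")
      case True
      then show ?thesis using fun_cong[OF z(1), of g] z(2) by (simp add: restrict_map_def)
    next
      case False
      then show ?thesis using x(1) by (auto simp: restrict_map_def)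
    qed
  qed
  ultimately show ?thesis unfolding restr_iff by (intro bexI[of _ f]) (simp_all add: SFT_iff)
qed

text \<open>
  Only the base point \<open>g\<close> of the occurrence is confined to the window \<open>B\<close>. For finite \<open>B\<close> this is a finite test.
\<close>

definition occurs_within :: "'a set \<Rightarrow> ('a, 'c) config set \<Rightarrow> ('a, 'c) config \<Rightarrow> bool" where
  "occurs_within B Ps x \<longleftrightarrow> (\<exists>P\<in>Ps. \<exists>g\<in>B. occ_at g P x)"

text \<open>
  A finite proof that \<open>P\<close> occurs in no point of the SFT defined by \<open>F\<close>: every way of filling the window around \<open>P\<close>
  produces a forbidden pattern.
\<close>

definition refutes :: "'a set \<Rightarrow> ('a, 'c) config set \<Rightarrow> ('a, 'c) config \<Rightarrow> bool" where
  "refutes B F P \<longleftrightarrow> dom P \<subseteq> B \<and> (\<forall>x. dom x = B \<longrightarrow> P \<subseteq>\<^sub>m x \<longrightarrow> occurs_within B F x)"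

definition one_step_extendable :: "'a set \<Rightarrow> ('a, 'c) config set \<Rightarrow> 'a set \<Rightarrow> bool" where
  "one_step_extendable B Ps C \<longleftrightarrow>
     (\<forall>x. dom x = C \<inter> B \<longrightarrow> \<not> occurs_within B Ps x \<longrightarrow> (\<exists>a. \<not> occurs_within B Ps (x(\<one> \<mapsto> a))))"

text \<open>
  Nonempty patterns contain \<open>\<one>\<close>, so a pattern occurring in a configuration has its base point in the domain of
  that configuration. This confines occurrences in configurations on a subgroup to the subgroup.
\<close>

definition based :: "('a, 'c) config set \<Rightarrow> bool" where
  "based Ps \<longleftrightarrow> (\<forall>P\<in>Ps. dom P = {} \<or> \<one> \<in> dom P)"

text \<open>
  The translates of \<open>P\<close> that cover \<open>\<one>\<close> are those by \<open>inv d\<close> with \<open>d \<in> dom P\<close>. Both their base points and their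
  domains have to lie in the window, so that the window sees every occurrence created by a new value at \<open>\<one>\<close>.
\<close>

definition fits :: "'a set \<Rightarrow> ('a, 'c) config set \<Rightarrow> bool" where
  "fits B Ps \<longleftrightarrow> (\<forall>P\<in>Ps. \<forall>d\<in>dom P. inv d \<in> B \<and> (\<forall>d'\<in>dom P. inv d \<otimes> d' \<in> B))"

lemma refutes_avoid:
  assumes F: "pattern_set G F" and B: "B \<subseteq> carrier G" and ref: "refutes B F P" and y: "y \<in> SFT G F"
    and g: "g \<in> carrier G"
  shows "\<not> occ_at g P y"
proof
  assume occ: "occ_at g P y"
  have PB: "dom P \<subseteq> B" using ref unfolding refutes_def by blast
  then have P: "dom P \<subseteq> carrier G" using B by blast
  let ?y = "shift G (inv g) y"
  have y': "?y \<in> SFT G F" using shift_SFT[OF _ F y] g by simp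
  then have dom: "dom ?y = carrier G" "avoids F ?y" using SFT_iff by blast+
  have "occ_at (inv g \<otimes> g) P ?y" using occ shift_occ_at[of "inv g" g P y] g P by simp
  then have "occ_at \<one> P ?y" using g by simp
  note occ_one = this
  have "P \<subseteq>\<^sub>m ?y |` B"
    unfolding map_le_def
  proof (rule ballI)
    fix d assume d: "d \<in> dom P"
    then have "d \<in> carrier G" "d \<in> B" using P PB by blast+
    moreover have "?y (\<one> \<otimes> d) = P d" using occ_one d unfolding occ_at_def by blast
    ultimately show "P d = (?y |` B) d" by (simp add: restrict_map_def)
  qed
  moreover have "dom (?y |` B) = B" using dom(1) B by auto
  ultimately have "occurs_within B F (?y |` B)" using ref unfolding refutes_def by blast
  then show False
    using avoids_restrict[OF dom(2), of B] B unfolding occurs_within_def avoids_def by blast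
qed

lemma refutes_all_avoid:
  assumes "pattern_set G F" "B \<subseteq> carrier G" "\<forall>P\<in>Ps. refutes B F P"
  shows "SFT G F \<subseteq> SFT G Ps"
proof
  fix y assume y: "y \<in> SFT G F"
  then have "dom y = carrier G" unfolding SFT_iff by blast
  moreover have "avoids Ps y" unfolding avoids_def
    using refutes_avoid[OF assms(1,2) _ y] assms(3) by blast
  ultimately show "y \<in> SFT G Ps" unfolding SFT_iff by blast
qed

text \<open>
  A letter at \<open>\<one>\<close> chosen by looking at \<open>C \<inter> B\<close> is correct for all of \<open>C\<close>: a new occurrence covers \<open>\<one>\<close>, so
  by \<open>fits\<close> it is visible in the window.
\<close>

lemma extend_if_one_step_extendable:
  assumes Ps: "pattern_set G Ps" and fit: "fits B Ps" and B: "B \<subseteq> carrier G" "\<one> \<in> B"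
    and C: "\<one> \<notin> C" and ext: "one_step_extendable B Ps C"
    and x: "dom x = C" "avoids Ps x"
  shows "\<exists>a. avoids Ps (x(\<one> \<mapsto> a))"
proof -
  have "dom (x |` B) = C \<inter> B" using x by auto
  moreover have "\<not> occurs_within B Ps (x |` B)"
    using avoids_restrict[OF x(2), of B] B unfolding occurs_within_def avoids_def by blast
  ultimately obtain a where a: "\<not> occurs_within B Ps ((x |` B)(\<one> \<mapsto> a))"
    using ext unfolding one_step_extendable_def by blast
  have "avoids Ps (x(\<one> \<mapsto> a))"
    unfolding avoids_def
  proof (intro ballI notI)
    fix P g assume P: "P \<in> Ps" "g \<in> carrier G" "occ_at g P (x(\<one> \<mapsto> a))"
    show False
    proof (cases "\<exists>d\<in>dom P. g \<otimes> d = \<one>")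
      case True
      then obtain d where d: "d \<in> dom P" "g \<otimes> d = \<one>" by blast
      have "d \<in> carrier G" using pattern_setD(1)[OF Ps P(1) d(1)] .
      then have g: "g = inv d" using d P inv_equality[of g d] by simp
      have near: "g \<otimes> d' \<in> B" if "d' \<in> dom P" for d'
        using fit P(1) d(1) that unfolding fits_def g by blast
      have "occ_at g P ((x |` B)(\<one> \<mapsto> a))"
        using P(3) by (rule occ_at_cong) (use near in auto)
      moreover have "g \<in> B" using fit P(1) d(1) unfolding fits_def g by blast
      ultimately show False using a P unfolding occurs_within_def by blast
    next
      case False
      then have "occ_at g P x" using P(3) by (intro occ_at_cong[OF P(3)]) auto
      then show False using x(2) P unfolding avoids_def by blast
    qed
  qed
  then show ?thesis by blast
qed

end

context polycyclic
begin

definition avoiding_extension :: "('a, 'c) config set \<Rightarrow> 'a set \<Rightarrow> 'a set \<Rightarrow> bool" where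
  "avoiding_extension Ps S S' \<longleftrightarrow>
     (\<forall>x. dom x = S \<longrightarrow> avoids Ps x \<longrightarrow> (\<exists>y. dom y = S' \<and> avoids Ps y \<and> y |` S = x))"

lemma restrict_dom_self: "dom x = S \<Longrightarrow> x |` S = x"
  by (auto simp: restrict_map_def fun_eq_iff)

text \<open>
  For increasing unions, extensions are chosen successively and glued; the result avoids \<open>Ps\<close> because an occurrence
  of a finite pattern takes place in one of the sets of the chain.
\<close>

lemma extension_relation_avoiding_extension:
  assumes Ps: "pattern_set G Ps"
  shows "extension_relation (avoiding_extension Ps)"
  unfolding extension_relation_def
proof (intro conjI allI ballI impI)
  fix S assume "S \<subseteq> carrier G"
  show "avoiding_extension Ps S S" unfolding avoiding_extension_def using restrict_dom_self by blast
next
  fix S S' S'' assume S: "S \<subseteq> S'" "avoiding_extension Ps S S'" "avoiding_extension Ps S' S''"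
  show "avoiding_extension Ps S S''" unfolding avoiding_extension_def
  proof (intro allI impI)
    fix x assume "dom x = S" "avoids Ps x"
    then obtain y where y: "dom y = S'" "avoids Ps y" "y |` S = x"
      using S(2) unfolding avoiding_extension_def by blast
    then obtain z where z: "dom z = S''" "avoids Ps z" "z |` S' = y"
      using S(3) unfolding avoiding_extension_def by blast
    have "z |` S = x" using restrict_restrict_subset[OF S(1), of z] y(3) z(3) by simp
    then show "\<exists>y. dom y = S'' \<and> avoids Ps y \<and> y |` S = x" using z by blast
  qed
next
  fix g S S' assume g: "g \<in> carrier G" and S: "S \<subseteq> S'" "S' \<subseteq> carrier G" "avoiding_extension Ps S S'"
  show "avoiding_extension Ps (g <# S) (g <# S')" unfolding avoiding_extension_def
  proof (intro allI impI)
    fix x assume x: "dom x = g <# S" "avoids Ps x"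
    have gS: "g <# S \<subseteq> carrier G" using g S by (auto simp: l_coset_def)
    have "dom (shift G (inv g) x) = S"
      using shift_dom[of "inv g" x] g x(1) gS S translate_inverse[of "inv g" S] by simp
    moreover have "avoids Ps (shift G (inv g) x)" using shift_avoids[OF _ Ps x(2)] g by simp
    ultimately obtain y where y: "dom y = S'" "avoids Ps y" "y |` S = shift G (inv g) x"
      using S(3) unfolding avoiding_extension_def by blast
    have "dom (shift G g y) = g <# S'" using shift_dom[OF g, of y] y(1) S(2) by simp
    moreover have "avoids Ps (shift G g y)" using shift_avoids[OF g Ps y(2)] .
    moreover have "shift G g y |` (g <# S) = x"
      using shift_restrict[OF g, of S y] y(3) shift_inv[OF g, of x] x(1) gS S by simp
    ultimately show "\<exists>y. dom y = g <# S' \<and> avoids Ps y \<and> y |` (g <# S) = x" by blast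
  qed
next
  fix S :: "nat \<Rightarrow> 'a set"
  assume S: "\<forall>j. S j \<subseteq> S (Suc j) \<and> S j \<subseteq> carrier G \<and> avoiding_extension Ps (S j) (S (Suc j))"
  show "avoiding_extension Ps (S 0) (\<Union>j. S j)" unfolding avoiding_extension_def
  proof (intro allI impI)
    fix x assume x: "dom x = S 0" "avoids Ps x"
    have "\<exists>f. \<forall>j. (dom (f j) = S j \<and> avoids Ps (f j) \<and> (j = 0 \<longrightarrow> f j = x)) \<and> f (Suc j) |` S j = f j"
    proof (rule dependent_nat_choice)
      show "\<exists>y. dom y = S 0 \<and> avoids Ps y \<and> (0 = (0::nat) \<longrightarrow> y = x)" using x by blast
      fix y and j :: nat assume y: "dom y = S j \<and> avoids Ps y \<and> (j = 0 \<longrightarrow> y = x)"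
      have "avoiding_extension Ps (S j) (S (Suc j))" using S by blast
      then obtain z where "dom z = S (Suc j)" "avoids Ps z" "z |` S j = y"
        using y unfolding avoiding_extension_def by blast
      then show "\<exists>z. (dom z = S (Suc j) \<and> avoids Ps z \<and> (Suc j = 0 \<longrightarrow> z = x)) \<and> z |` S j = y"
        by blast
    qed
    then obtain f where f': "\<forall>j. (dom (f j) = S j \<and> avoids Ps (f j) \<and> (j = 0 \<longrightarrow> f j = x)) \<and> f (Suc j) |` S j = f j" ..
    have f: "f 0 = x" "\<And>j. dom (f j) = S j" "\<And>j. avoids Ps (f j)" "\<And>j. f (Suc j) |` S j = f j"
      using f' by simp_all
    have mono: "S i \<subseteq> S j" if "i \<le> j" for i j by (rule lift_Suc_mono_le[of S, OF _ that]) (use S in blast)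
    have coh: "f j |` S i = f i" if "i \<le> j" for i j
      using that
    proof (induction rule: dec_induct)
      case base
      then show ?case by (rule restrict_dom_self[OF f(2)])
    next
      case (step j)
      have "f (Suc j) |` S i = (f (Suc j) |` S j) |` S i"
        by (rule restrict_restrict_subset[OF mono[OF step.hyps(1)], symmetric])
      then show ?case unfolding f(4) step.IH .
    qed
    define y where "y g = (if \<exists>j. g \<in> S j then f (LEAST j. g \<in> S j) g else None)" for g
    have y_eq: "y g = f j g" if "g \<in> S j" for g j
    proof -
      let ?i = "LEAST j. g \<in> S j"
      have i: "g \<in> S ?i" "?i \<le> j" using LeastI[of "\<lambda>j. g \<in> S j", OF that] Least_le[of "\<lambda>j. g \<in> S j", OF that] .
      have "f j g = (f j |` S ?i) g" using i(1) by (simp add: restrict_map_def)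
      then show ?thesis using coh[OF i(2)] that unfolding y_def by auto
    qed
    have "dom y = (\<Union>j. S j)"
    proof -
      have "y g \<noteq> None \<longleftrightarrow> (\<exists>j. g \<in> S j)" for g
      proof
        assume "\<exists>j. g \<in> S j"
        then obtain j where "g \<in> S j" by blast
        then show "y g \<noteq> None" using y_eq[of g j] f(2)[of j] by auto
      qed (auto simp: y_def split: if_splits)
      then show ?thesis by auto
    qed
    moreover have "avoids Ps y"
    proof (rule avoids_local[OF Ps])
      fix D :: "'a set" assume D: "finite D"
      have "\<exists>j. D \<inter> (\<Union>j. S j) \<subseteq> S j"
        using D
      proof (induction rule: finite_induct)
        case (insert d D)
        then obtain j where j: "D \<inter> (\<Union>j. S j) \<subseteq> S j" by blast
        show ?case
        proof (cases "\<exists>i. d \<in> S i")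
          case True
          then obtain i where i: "d \<in> S i" by blast
          have "S i \<subseteq> S (max i j)" "S j \<subseteq> S (max i j)" by (rule mono, simp)+
          then have "insert d D \<inter> (\<Union>j. S j) \<subseteq> S (max i j)" using i j by blast
          then show ?thesis by blast
        next
          case False
          then have "insert d D \<inter> (\<Union>j. S j) \<subseteq> S j" using j by blast
          then show ?thesis by blast
        qed
      qed simp
      then obtain j where j: "D \<inter> (\<Union>j. S j) \<subseteq> S j" by blast
      have "f j g = y g" if "g \<in> D" for g
      proof (cases "g \<in> S j")
        case False
        then have "\<not> (\<exists>j. g \<in> S j)" using j that by blast
        then show ?thesis using False f(2)[of j] unfolding y_def by auto
      qed (use y_eq in simp)
      then show "\<exists>x. avoids Ps x \<and> (\<forall>g\<in>D. x g = y g)" using f(3) by blast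
    qed
    moreover have "y |` S 0 = x"
    proof
      fix g show "(y |` S 0) g = x g"
        using y_eq[of g 0] f(1) x(1)
        by (cases "g \<in> S 0") (auto simp: restrict_map_def domIff set_eq_iff)
    qed
    ultimately show "\<exists>y. dom y = (\<Union>j. S j) \<and> avoids Ps y \<and> y |` S 0 = x"
      by (intro exI[of _ y] conjI)
  qed
qed

text \<open>
  The two conditions on \<open>refutes\<close> say that \<open>F\<close> and \<open>Ps\<close> define the same SFT. The last condition quantifies over infinitely many
  inductive intervals, but it depends only on their intersections with \<open>B\<close>.
\<close>

definition certificate :: "('a, 'c) config set \<Rightarrow> ('a, 'c) config set \<Rightarrow> 'a set \<Rightarrow> bool" where
  "certificate F Ps B \<longleftrightarrow> \<one> \<in> B \<and> based Ps \<and> fits B Ps \<and>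
     (\<forall>P\<in>Ps. refutes B F P) \<and> (\<forall>Q\<in>F. refutes B Ps Q) \<and>
     (\<forall>T. grazing_tuple T \<longrightarrow> one_step_extendable B Ps (layers 0 T))"

lemma one_notin_layers:
  assumes "grazing_tuple T"
  shows "\<one> \<notin> layers 0 T"
proof
  assume "\<one> \<in> layers 0 T"
  then obtain l where l: "l < n" "\<one> \<in> layer l (T l)" by (auto simp: layers_def)
  have "layer l (T l) \<inter> H l = {}"
    using assms l(1) unfolding grazing_tuple_def grazes_def by (intro layer_disjoint) auto
  then show False using l H_one[of l] by auto
qed

text \<open>
  The last condition on a certificate provides the one-point steps for the relation \<open>avoiding_extension\<close>. A configuration that
  extends to one on \<open>carrier G\<close> avoiding \<open>Ps\<close> is a restriction of a point of the SFT.
\<close>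

theorem certificate_sound:
  fixes F :: "('a, 'c::finite) config set"
  assumes F: "pattern_set G F" and Ps: "pattern_set G Ps" and B: "B \<subseteq> carrier G"
    and cert: "certificate F Ps B"
  shows "SFT G F = SFT G Ps"
    and "grazing_tuple T \<Longrightarrow> defines_restr G Ps (SFT G F) (layers 0 T)"
    and "i \<le> n \<Longrightarrow> defines_restr G Ps (SFT G F) (H i)"
proof -
  have c: "\<one> \<in> B" "fits B Ps" "\<forall>P\<in>Ps. refutes B F P" "\<forall>Q\<in>F. refutes B Ps Q"
    "\<And>T. grazing_tuple T \<Longrightarrow> one_step_extendable B Ps (layers 0 T)"
    using cert unfolding certificate_def by blast+
  show eq: "SFT G F = SFT G Ps"
    using refutes_all_avoid[OF F B c(3)] refutes_all_avoid[OF Ps B c(4)] by blast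
  have R: "extension_relation (avoiding_extension Ps)"
    by (rule extension_relation_avoiding_extension[OF Ps])
  have base: "avoiding_extension Ps (layers 0 T) (layers 0 T \<union> {\<one>})" if T: "grazing_tuple T" for T
    unfolding avoiding_extension_def
  proof (intro allI impI)
    fix x :: "('a, 'c) config" assume x: "dom x = layers 0 T" "avoids Ps x"
    obtain a where a: "avoids Ps (x(\<one> \<mapsto> a))"
      using extend_if_one_step_extendable[OF Ps c(2) B c(1) one_notin_layers[OF T] c(5)[OF T] x] by blast
    have "x(\<one> \<mapsto> a) |` layers 0 T = x"
    proof
      fix g show "(x(\<one> \<mapsto> a) |` layers 0 T) g = x g"
        using x(1) one_notin_layers[OF T]
        by (cases "g \<in> layers 0 T") (auto simp: restrict_map_def domIff set_eq_iff)
    qed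
    then show "\<exists>y. dom y = layers 0 T \<union> {\<one>} \<and> avoids Ps y \<and> y |` layers 0 T = x"
      using a x(1) by (intro exI[of _ "x(\<one> \<mapsto> a)"]) auto
  qed
  have defined: "defines_restr G Ps (SFT G F) C" if C: "avoiding_extension Ps C (carrier G)" for C
    unfolding defines_restr_iff
  proof (intro allI impI iffI)
    fix x assume "x \<in> restr (SFT G F) C"
    then obtain y where "y \<in> SFT G Ps" "x = y |` C" unfolding eq restr_iff by blast
    then show "avoids Ps x" unfolding SFT_iff by (simp add: avoids_restrict)
  next
    fix x assume "dom x = C" "avoids Ps x"
    then obtain y where "dom y = carrier G" "avoids Ps y" "y |` C = x"
      using C unfolding avoiding_extension_def by blast
    then have "y \<in> SFT G Ps" "x = y |` C" unfolding SFT_iff by simp_all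
    then show "x \<in> restr (SFT G F) C" unfolding eq restr_iff by blast
  qed
  show "defines_restr G Ps (SFT G F) (layers 0 T)" if "grazing_tuple T"
    by (rule defined[OF extend_interval_to_carrier[OF R base that]])
  show "defines_restr G Ps (SFT G F) (H i)" if "i \<le> n"
    by (rule defined[OF extend_H_to_carrier[OF R base that]])
qed

end

section \<open>Compactness of the family of inductive intervals\<close>

lemma grazes_0: "grazes k T \<Longrightarrow> 0 \<notin> T"
  unfolding grazes_def by (metis dvd_0_right)

lemma grazes_interval: "grazes k T \<Longrightarrow> int_interval T"
  unfolding grazes_def by blast

lemma grazes_pos:
  assumes T: "grazes k T" and x: "x \<in> T" "0 < x"
  shows "1 \<in> T"
proof (rule ccontr)
  assume "1 \<notin> T"
  then have "-1 \<in> T" using T x(1) unfolding grazes_def by blast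
  then have "0 \<in> T" using int_intervalD[OF grazes_interval[OF T] _ x(1), of "-1" 0] x(2) by simp
  then show False using grazes_0[OF T] by simp
qed

lemma grazes_uminus: "grazes k T \<Longrightarrow> grazes k (uminus ` T)"
  using int_interval_uminus[of T] unfolding grazes_def by (auto simp: image_iff intro: bexI[of _ "-1"])

lemma grazes_bounded:
  assumes T: "grazes k T" and k: "k > 0" and x: "x \<in> T"
  shows "\<bar>x\<bar> < int k"
proof -
  have pos: "y < int k" if T: "grazes k T" and y0: "y \<in> T" for y T
  proof (rule ccontr)
    assume big: "\<not> y < int k"
    then have y: "y \<in> T" "0 < y" using y0 k by auto
    have "1 \<in> T" "1 \<le> int k" "int k \<le> y" using grazes_pos[OF T y] k big by auto
    then have "int k \<in> T" using int_intervalD[OF grazes_interval[OF T] _ y(1), of 1 "int k"] by simp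
    then have "\<not> int k dvd int k" using T unfolding grazes_def by (rule_tac bspec) auto
    then show False by simp
  qed
  have "- x \<in> uminus ` T" using x by blast
  then have "- x < int k" using pos[OF grazes_uminus[OF T]] by blast
  then show ?thesis using pos[OF T x] by simp
qed

text \<open>
  If some \<open>b > 0\<close> is missing from \<open>T\<close>, it suffices to test \<open>1, \<dots>, b\<close>: an interval \<open>T'\<close> that passes the test does not contain
  \<open>b\<close> and so cannot continue past \<open>b\<close>. Otherwise \<open>T\<close> contains all positive integers.
\<close>

lemma grazes_controlled_pos:
  assumes "grazes k T"
  shows "\<exists>M. finite M \<and> (\<forall>T'. grazes k T' \<longrightarrow> (\<forall>t\<in>M. t \<in> T' \<longrightarrow> t \<in> T) \<longrightarrow> T' \<inter> {0<..} \<subseteq> T)"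
proof (cases "{0<..} \<subseteq> T")
  case True
  then show ?thesis by (intro exI[of _ "{}"]) auto
next
  case False
  then obtain b where b: "b > 0" "b \<notin> T" by auto
  have "T' \<inter> {0<..} \<subseteq> T" if T': "grazes k T'" and M: "\<forall>t\<in>{1..b}. t \<in> T' \<longrightarrow> t \<in> T" for T'
  proof
    fix x assume "x \<in> T' \<inter> {0<..}"
    then have x: "x \<in> T'" "x > 0" by auto
    show "x \<in> T"
    proof (cases "x \<le> b")
      case True
      then show ?thesis using M x by auto
    next
      case False
      then have "b \<in> T'"
        using int_intervalD[OF grazes_interval[OF T'] grazes_pos[OF T' x] x(1), of b] b by simp
      then show ?thesis using M b by auto
    qed
  qed
  then show ?thesis by (intro exI[of _ "{1..b}"]) blast
qed

text \<open>
  Grazing intervals close to \<open>T\<close> are subsets of \<open>T\<close>. This one-sidedness makes the avo property stable: it is inherited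
  by smaller sets.
\<close>

lemma grazes_controlled:
  assumes T: "grazes k T"
  shows "\<exists>M. finite M \<and> (\<forall>T'. grazes k T' \<longrightarrow> (\<forall>t\<in>M. t \<in> T' \<longrightarrow> t \<in> T) \<longrightarrow> T' \<subseteq> T)"
proof -
  obtain M where M: "finite M"
    "\<And>T'. grazes k T' \<Longrightarrow> \<forall>t\<in>M. t \<in> T' \<longrightarrow> t \<in> T \<Longrightarrow> T' \<inter> {0<..} \<subseteq> T"
    using grazes_controlled_pos[OF T] by blast
  obtain N where N: "finite N"
    "\<And>T'. grazes k T' \<Longrightarrow> \<forall>t\<in>N. t \<in> T' \<longrightarrow> t \<in> uminus ` T \<Longrightarrow> T' \<inter> {0<..} \<subseteq> uminus ` T"
    using grazes_controlled_pos[OF grazes_uminus[OF T]] by blast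
  have "T' \<subseteq> T" if T': "grazes k T'" and a: "\<forall>t\<in>M \<union> uminus ` N. t \<in> T' \<longrightarrow> t \<in> T" for T'
  proof
    fix x assume x: "x \<in> T'"
    consider "x > 0" | "x < 0" | "x = 0" by linarith
    then show "x \<in> T"
    proof cases
      case 1
      then show ?thesis using M(2)[OF T'] a x by auto
    next
      case 2
      have "t \<in> uminus ` T" if "t \<in> N" "t \<in> uminus ` T'" for t
      proof -
        have "- t \<in> T'" "- t \<in> uminus ` N" using that by auto
        then have "- t \<in> T" using a by blast
        then show ?thesis by (rule rev_image_eqI) simp
      qed
      moreover have "- x \<in> uminus ` T' \<inter> {0<..}" using x 2 by auto
      ultimately have "- x \<in> uminus ` T" using N(2)[OF grazes_uminus[OF T']] by blast
      then show ?thesis by auto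
    next
      case 3
      then show ?thesis using x grazes_0[OF T'] by simp
    qed
  qed
  then show ?thesis using M(1) N(1) by (intro exI[of _ "M \<union> uminus ` N"]) blast
qed

context polycyclic
begin

lemma layer_local:
  assumes l: "l < n"
  shows "\<exists>M. finite M \<and> (\<forall>T T'. grazes (k (Suc l)) T \<longrightarrow> grazes (k (Suc l)) T' \<longrightarrow>
      (\<forall>t\<in>M. t \<in> T \<longleftrightarrow> t \<in> T') \<longrightarrow> b \<in> layer l T \<longrightarrow> b \<in> layer l T')"
proof (cases "b \<in> H (Suc l)")
  case False
  then show ?thesis using layer_subset[OF l] by (intro exI[of _ "{}"]) auto
next
  case True
  then obtain t u where tu: "u \<in> H l" "b = h (Suc l) [^] (t::int) \<otimes> u"
    using h_generates[OF l] by blast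
  note mem = h_pow_layer_iff[OF l tu(1), of t, folded tu(2)]
  show ?thesis
  proof (cases "k (Suc l) = 0")
    case True
    then show ?thesis unfolding mem by (intro exI[of _ "{t}"]) auto
  next
    case False
    let ?M = "{- int (k (Suc l))..int (k (Suc l))}"
    have "b \<in> layer l T'" if T: "grazes (k (Suc l)) T" and a: "\<forall>t\<in>?M. t \<in> T \<longleftrightarrow> t \<in> T'" and b: "b \<in> layer l T" for T T'
    proof -
      obtain s where s: "s \<in> T" "int (k (Suc l)) dvd t - s" using b unfolding mem by blast
      have "s \<in> ?M" using grazes_bounded[OF T _ s(1)] False by auto
      then show ?thesis using s a unfolding mem by blast
    qed
    then show ?thesis by (intro exI[of _ ?M]) blast
  qed
qed

text \<open>
  The basic neighbourhoods in the product topology on tuples of subsets of \<open>\<int>\<close>.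
\<close>

definition agree :: "(nat \<times> int) set \<Rightarrow> (nat \<Rightarrow> int set) \<Rightarrow> (nat \<Rightarrow> int set) \<Rightarrow> bool" where
  "agree D T T' \<longleftrightarrow> (\<forall>(l, t)\<in>D. t \<in> T l \<longleftrightarrow> t \<in> T' l)"

lemma agreeD: "agree D T T' \<Longrightarrow> (l, t) \<in> D \<Longrightarrow> t \<in> T l \<longleftrightarrow> t \<in> T' l"
  unfolding agree_def by blast

lemma agree_sym: "agree D T T' \<Longrightarrow> agree D T' T"
  unfolding agree_def by blast

lemma agree_mono: "agree D' T T' \<Longrightarrow> D \<subseteq> D' \<Longrightarrow> agree D T T'"
  unfolding agree_def by blast

lemma layers_local:
  shows "\<exists>D. finite D \<and> (\<forall>T T'. grazing_tuple T \<longrightarrow> grazing_tuple T' \<longrightarrow> agree D T T' \<longrightarrow>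
      (b \<in> layers 0 T \<longleftrightarrow> b \<in> layers 0 T'))"
proof -
  let ?P = "\<lambda>l M. finite M \<and> (\<forall>T T'. grazes (k (Suc l)) T \<longrightarrow> grazes (k (Suc l)) T' \<longrightarrow>
      (\<forall>t\<in>M. t \<in> T \<longleftrightarrow> t \<in> T') \<longrightarrow> b \<in> layer l T \<longrightarrow> b \<in> layer l T')"
  have "\<exists>M. l < n \<longrightarrow> ?P l M" for l
  proof (cases "l < n")
    case True
    from layer_local[OF this, of b] show ?thesis by (simp only: True simp_thms)
  qed simp
  then have "\<forall>l. \<exists>M. l < n \<longrightarrow> ?P l M" by (rule allI)
  from choice[OF this] obtain M where M': "\<forall>l. l < n \<longrightarrow> ?P l (M l)" ..
  have M: "?P l (M l)" if "l < n" for l by (rule mp[OF spec[OF M'] that])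
  let ?D = "SIGMA l:{..<n}. M l"
  have imp: "b \<in> layers 0 T'"
    if T: "grazing_tuple T" "grazing_tuple T'" "agree ?D T T'" "b \<in> layers 0 T" for T T'
  proof -
    obtain l where l: "l < n" "b \<in> layer l (T l)" using T(4) by (auto simp: layers_def)
    have "\<forall>t\<in>M l. t \<in> T l \<longleftrightarrow> t \<in> T' l" using agreeD[OF T(3)] l(1) by blast
    moreover have "grazes (k (Suc l)) (T l)" "grazes (k (Suc l)) (T' l)"
      using T(1,2) l(1) unfolding grazing_tuple_def by simp_all
    ultimately have "b \<in> layer l (T' l)"
      using M[OF l(1)] l(2) by (simp only: simp_thms)
    then show ?thesis using l(1) by (auto simp: layers_def)
  qed
  have fin: "finite ?D" using M[THEN conjunct1] by (intro finite_SigmaI) simp_all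
  have "b \<in> layers 0 T \<longleftrightarrow> b \<in> layers 0 T'"
    if "grazing_tuple T" "grazing_tuple T'" "agree ?D T T'" for T T'
    using imp[OF that] imp[OF that(2,1) agree_sym[OF that(3)]] by blast
  then show ?thesis using fin by blast
qed

lemma layers_local_finite:
  assumes "finite B"
  shows "\<exists>D. finite D \<and> (\<forall>T T'. grazing_tuple T \<longrightarrow> grazing_tuple T' \<longrightarrow> agree D T T' \<longrightarrow>
      layers 0 T \<inter> B = layers 0 T' \<inter> B)"
proof -
  let ?P = "\<lambda>b D. finite D \<and> (\<forall>T T'. grazing_tuple T \<longrightarrow> grazing_tuple T' \<longrightarrow> agree D T T' \<longrightarrow>
      (b \<in> layers 0 T \<longleftrightarrow> b \<in> layers 0 T'))"
  have "\<forall>b. \<exists>D. ?P b D" by (rule allI, rule layers_local)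
  from choice[OF this] obtain D where "\<forall>b. ?P b (D b)" ..
  then have D1: "\<And>b. finite (D b)" and D2: "\<And>b T T'. grazing_tuple T \<Longrightarrow> grazing_tuple T' \<Longrightarrow>
      agree (D b) T T' \<Longrightarrow> b \<in> layers 0 T \<longleftrightarrow> b \<in> layers 0 T'"
    by simp_all
  have "layers 0 T \<inter> B = layers 0 T' \<inter> B"
    if "grazing_tuple T" "grazing_tuple T'" "agree (\<Union>b\<in>B. D b) T T'" for T T'
  proof -
    have "b \<in> layers 0 T \<longleftrightarrow> b \<in> layers 0 T'" if "b \<in> B" for b
      by (rule D2[OF \<open>grazing_tuple T\<close> \<open>grazing_tuple T'\<close> agree_mono[OF \<open>agree (\<Union>b\<in>B. D b) T T'\<close>]]) (use that in blast)
    then show ?thesis by blast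
  qed
  moreover have "finite (\<Union>b\<in>B. D b)" using assms D1 by simp
  ultimately show ?thesis by blast
qed

lemma layers_controlled:
  assumes T: "grazing_tuple T"
  shows "\<exists>D. finite D \<and> (\<forall>T'. grazing_tuple T' \<longrightarrow> agree D T T' \<longrightarrow> layers 0 T' \<subseteq> layers 0 T)"
proof -
  let ?P = "\<lambda>l M. finite M \<and>
      (\<forall>T'. grazes (k (Suc l)) T' \<longrightarrow> (\<forall>t\<in>M. t \<in> T' \<longrightarrow> t \<in> T l) \<longrightarrow> T' \<subseteq> T l)"
  have "\<exists>M. l < n \<longrightarrow> ?P l M" for l
  proof (cases "l < n")
    case True
    then have "grazes (k (Suc l)) (T l)" using T unfolding grazing_tuple_def by simp
    from grazes_controlled[OF this] show ?thesis by (simp only: True simp_thms)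
  qed simp
  then have "\<forall>l. \<exists>M. l < n \<longrightarrow> ?P l M" by (rule allI)
  from choice[OF this] obtain M where M': "\<forall>l. l < n \<longrightarrow> ?P l (M l)" ..
  have M: "?P l (M l)" if "l < n" for l by (rule mp[OF spec[OF M'] that])
  let ?D = "SIGMA l:{..<n}. M l"
  have "layers 0 T' \<subseteq> layers 0 T" if T': "grazing_tuple T'" "agree ?D T T'" for T'
  proof
    fix b assume "b \<in> layers 0 T'"
    then obtain l where l: "l < n" "b \<in> layer l (T' l)" by (auto simp: layers_def)
    have "\<forall>t\<in>M l. t \<in> T' l \<longrightarrow> t \<in> T l" using agreeD[OF T'(2)] l(1) by blast
    moreover have "grazes (k (Suc l)) (T' l)" using T'(1) l(1) unfolding grazing_tuple_def by simp
    ultimately have "T' l \<subseteq> T l" using M[OF l(1)] by (simp only: simp_thms)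
    then have "b \<in> layer l (T l)" using l(2) layer_Un[of l "T' l" "T l"] by (auto simp: Un_absorb1)
    then show "b \<in> layers 0 T" using l(1) by (auto simp: layers_def)
  qed
  moreover have "finite ?D" using M[THEN conjunct1] by (intro finite_SigmaI) simp_all
  ultimately show ?thesis by blast
qed

text \<open>
  Grazing is a condition on finitely many integers at a time, hence closed.
\<close>

lemma grazing_tuple_closed:
  assumes near: "\<And>D. finite D \<Longrightarrow> \<exists>T'. grazing_tuple T' \<and> agree D T T'"
  shows "grazing_tuple T"
  unfolding grazing_tuple_def
proof (intro allI impI)
  fix l assume l: "l < n"
  have near': "\<exists>T'. grazes (k (Suc l)) T' \<and> (\<forall>t\<in>M. t \<in> T l \<longleftrightarrow> t \<in> T')" if "finite M" for M
  proof -
    obtain T' where T': "grazing_tuple T'" "agree ({l} \<times> M) T T'" using near[of "{l} \<times> M"] \<open>finite M\<close> by auto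
    have "\<forall>t\<in>M. t \<in> T l \<longleftrightarrow> t \<in> T' l" using agreeD[OF T'(2)] by blast
    then show ?thesis using T'(1) l unfolding grazing_tuple_def by blast
  qed
  have 1: "int_interval (T l)"
  proof (rule int_intervalI)
    fix a b x assume ab: "a \<in> T l" "b \<in> T l" "a \<le> x" "x \<le> b"
    obtain T' where T': "grazes (k (Suc l)) T'" "\<forall>t\<in>{a, b, x}. t \<in> T l \<longleftrightarrow> t \<in> T'"
      using near'[of "{a, b, x}"] by auto
    then show "x \<in> T l" using int_intervalD[OF grazes_interval[OF T'(1)], of a b x] ab by simp
  qed
  have 2: "\<not> int (k (Suc l)) dvd t" if t: "t \<in> T l" for t
  proof -
    obtain T' where T': "grazes (k (Suc l)) T'" "\<forall>s\<in>{t}. s \<in> T l \<longleftrightarrow> s \<in> T'"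
      using near'[of "{t}"] by auto
    then show ?thesis using t unfolding grazes_def by simp
  qed
  have 3: "1 \<in> T l \<or> -1 \<in> T l" if t: "t \<in> T l" for t
  proof -
    obtain T' where T': "grazes (k (Suc l)) T'" "\<forall>s\<in>{t, 1, -1}. s \<in> T l \<longleftrightarrow> s \<in> T'"
      using near'[of "{t, 1, -1}"] by auto
    then show ?thesis using t unfolding grazes_def by auto
  qed
  show "grazes (k (Suc l)) (T l)" unfolding grazes_def using 1 2 3 by blast
qed

text \<open>
  Compactness of the space of grazing tuples: a property that holds near each tuple with some finite \<open>B\<close>, and is preserved
  when \<open>B\<close> grows, holds for all tuples with a common \<open>B\<close>. Otherwise choose a bad tuple for each finite set; the bad
  tuples accumulate at a grazing tuple.
\<close>

lemma tuple_cover: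
  fixes \<Phi> :: "'a set \<Rightarrow> (nat \<Rightarrow> int set) \<Rightarrow> bool"
  assumes loc: "\<And>T. grazing_tuple T \<Longrightarrow> \<exists>D B. finite D \<and> finite B \<and> B \<subseteq> carrier G \<and>
      (\<forall>T'. grazing_tuple T' \<longrightarrow> agree D T T' \<longrightarrow> \<Phi> B T')"
    and mono: "\<And>B B' T. \<Phi> B T \<Longrightarrow> B \<subseteq> B' \<Longrightarrow> finite B' \<Longrightarrow> B' \<subseteq> carrier G \<Longrightarrow> \<Phi> B' T"
  shows "\<exists>B. finite B \<and> B \<subseteq> carrier G \<and> (\<forall>T. grazing_tuple T \<longrightarrow> \<Phi> B T)"
proof (rule ccontr)
  assume no: "\<not> ?thesis"
  \<comment> \<open>The coordinates \<open>Inl (l, t)\<close> hold the characteristic functions of the intervals; the finite sets of coordinates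
    \<open>Inr g\<close> serve to index the finite sets \<open>B\<close>.\<close>
  let ?tup = "\<lambda>x :: (nat \<times> int) + 'a \<Rightarrow> bool. \<lambda>l. {t. x (Inl (l, t))}"
  let ?B = "\<lambda>E :: ((nat \<times> int) + 'a) set. Inr -` E \<inter> carrier G"
  have fin: "finite (?B E)" if "finite E" for E
    using that by (intro finite_Int disjI1 finite_vimageI) auto
  have "\<exists>f. \<forall>E. finite E \<longrightarrow> (\<exists>x. (grazing_tuple (?tup x) \<and> \<not> \<Phi> (?B E) (?tup x)) \<and> (\<forall>i\<in>E. x i = f i))"
  proof (rule compact_finite_valued)
    fix E :: "((nat \<times> int) + 'a) set" assume "finite E"
    then obtain T where T: "grazing_tuple T" "\<not> \<Phi> (?B E) T" using no fin by blast
    have "?tup (\<lambda>i. case i of Inl (l, t) \<Rightarrow> t \<in> T l | Inr _ \<Rightarrow> False) = T" by auto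
    then show "\<exists>x. grazing_tuple (?tup x) \<and> \<not> \<Phi> (?B E) (?tup x)" using T by metis
  next
    fix E E' :: "((nat \<times> int) + 'a) set" and x
    assume "grazing_tuple (?tup x) \<and> \<not> \<Phi> (?B E') (?tup x)" "E \<subseteq> E'" "finite E'"
    moreover have "?B E \<subseteq> ?B E'" using \<open>E \<subseteq> E'\<close> by blast
    ultimately show "grazing_tuple (?tup x) \<and> \<not> \<Phi> (?B E) (?tup x)"
      using mono[of "?B E" "?tup x" "?B E'"] fin[of E'] by blast
  qed
  then obtain f where f: "\<And>E. finite E \<Longrightarrow> \<exists>x. grazing_tuple (?tup x) \<and> \<not> \<Phi> (?B E) (?tup x) \<and> (\<forall>i\<in>E. x i = f i)"
    by (auto simp only: conj_assoc)
  have near: "\<exists>x. grazing_tuple (?tup x) \<and> \<not> \<Phi> B (?tup x) \<and> agree D (?tup f) (?tup x)"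
    if DB: "finite D" "finite B" "B \<subseteq> carrier G" for D B
  proof -
    have "finite (Inl ` D \<union> Inr ` B)" using DB by simp
    from f[OF this] obtain x where x: "grazing_tuple (?tup x)" "\<not> \<Phi> (?B (Inl ` D \<union> Inr ` B)) (?tup x)"
      "\<forall>i\<in>Inl ` D \<union> Inr ` B. x i = f i" by blast
    moreover have "?B (Inl ` D \<union> Inr ` B) = B" using DB(3) by auto
    moreover have "agree D (?tup f) (?tup x)" unfolding agree_def using x(3) by auto
    ultimately show ?thesis by auto
  qed
  have "grazing_tuple (?tup f)"
  proof (rule grazing_tuple_closed)
    fix D :: "(nat \<times> int) set" assume "finite D"
    then show "\<exists>T'. grazing_tuple T' \<and> agree D (?tup f) T'" using near[of D "{}"] by auto
  qed
  from loc[OF this] obtain D B where DB: "finite D" "finite B" "B \<subseteq> carrier G"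
    "\<And>T'. grazing_tuple T' \<Longrightarrow> agree D (?tup f) T' \<Longrightarrow> \<Phi> B T'" by blast
  then show False using near[OF DB(1-3)] by blast
qed

lemma upd_restrict: "(x(g \<mapsto> a)) |` (insert g D) = (x |` D)(g \<mapsto> a)"
  by (auto simp: restrict_map_def fun_eq_iff)

lemma restr_upd:
  assumes "x(g \<mapsto> a) \<in> restr X (C \<union> {g})" "D \<subseteq> C"
  shows "(x |` D)(g \<mapsto> a) \<in> restr X (D \<union> {g})"
proof -
  have "x(g \<mapsto> a) |` (insert g D) \<in> restr X (insert g D)"
    using assms by (intro restr_restrict) auto
  then show ?thesis unfolding upd_restrict by simp
qed

text \<open>
  One window \<open>B\<close> can serve all sets \<open>C\<close> by being intersected with them. The converse of the implication from the window
  to \<open>C\<close> holds by restriction.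
\<close>

definition avo_via :: "('a, 'c) config set \<Rightarrow> 'a set \<Rightarrow> 'a set \<Rightarrow> bool" where
  "avo_via X B C \<longleftrightarrow> (\<forall>x\<in>restr X C. \<forall>a. (x |` (C \<inter> B))(\<one> \<mapsto> a) \<in> restr X (C \<inter> B \<union> {\<one>}) \<longrightarrow>
     x(\<one> \<mapsto> a) \<in> restr X (C \<union> {\<one>}))"

lemma avo_via_mono:
  assumes B: "avo_via X B C" "B \<subseteq> B'"
  shows "avo_via X B' C"
  unfolding avo_via_def
proof (intro ballI allI impI)
  fix x a assume x: "x \<in> restr X C" "(x |` (C \<inter> B'))(\<one> \<mapsto> a) \<in> restr X (C \<inter> B' \<union> {\<one>})"
  have sub: "C \<inter> B \<subseteq> C \<inter> B'" using B(2) by blast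
  from restr_upd[OF x(2) sub] have "(x |` (C \<inter> B))(\<one> \<mapsto> a) \<in> restr X (C \<inter> B \<union> {\<one>})"
    unfolding restrict_restrict_subset[OF sub] .
  then show "x(\<one> \<mapsto> a) \<in> restr X (C \<union> {\<one>})" using B(1) x(1) unfolding avo_via_def by blast
qed

text \<open>
  Let \<open>B \<subseteq> C\<close> witness that \<open>X\<close> is avo for \<open>C\<close>. An inductive interval \<open>C'\<close> close to \<open>C\<close> satisfies \<open>B \<subseteq> C' \<subseteq> C\<close>. A
  point of \<open>X|C'\<close> is the restriction of a point of \<open>X|C\<close>, to which the witness applies, and the conclusion restricts back to
  \<open>C'\<close>. Compactness then gives a common window.
\<close>

lemma uniformly_avo:
  fixes X :: "('a, 'c::finite) config set"
  assumes X: "II_avoshift G n H h k X"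
  shows "\<exists>B. finite B \<and> B \<subseteq> carrier G \<and> (\<forall>T. grazing_tuple T \<longrightarrow> avo_via X B (layers 0 T))"
proof (rule tuple_cover)
  fix T assume T: "grazing_tuple T"
  let ?C = "layers 0 T"
  have "inductive_interval G n H h k ?C"
    using T unfolding inductive_interval_iff grazing_tuple_def by blast
  then have "avo G X ?C" using X unfolding II_avoshift_def by blast
  then obtain B where B: "finite B" "B \<subseteq> ?C" "\<And>x a. x \<in> restr X ?C \<Longrightarrow>
      (x |` B)(\<one> \<mapsto> a) \<in> restr X (B \<union> {\<one>}) \<Longrightarrow> x(\<one> \<mapsto> a) \<in> restr X (?C \<union> {\<one>})"
    unfolding avo_def by blast
  obtain D where D: "finite D" "\<And>T'. grazing_tuple T' \<Longrightarrow> agree D T T' \<Longrightarrow> layers 0 T' \<subseteq> ?C"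
    using layers_controlled[OF T] by blast
  obtain E where E: "finite E" "\<And>T'. grazing_tuple T' \<Longrightarrow> agree E T T' \<Longrightarrow> ?C \<inter> B = layers 0 T' \<inter> B"
    using layers_local_finite[OF B(1)] T by blast
  have "avo_via X B (layers 0 T')" if T': "grazing_tuple T'" "agree (D \<union> E) T T'" for T'
    unfolding avo_via_def
  proof (intro ballI allI impI)
    let ?C' = "layers 0 T'"
    have sub: "?C' \<subseteq> ?C" using D(2)[OF T'(1) agree_mono[OF T'(2)]] by blast
    have "?C \<inter> B = ?C' \<inter> B" using E(2)[OF T'(1) agree_mono[OF T'(2)]] by blast
    then have BC': "?C' \<inter> B = B" using B(2) by blast
    then have BC: "B \<subseteq> ?C'" by blast
    fix x a assume x: "x \<in> restr X ?C'" and ext: "(x |` (?C' \<inter> B))(\<one> \<mapsto> a) \<in> restr X (?C' \<inter> B \<union> {\<one>})"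
    obtain z where z: "z \<in> X" "x = z |` ?C'" using x restr_iff by blast
    have "(z |` ?C) |` B = x |` B"
      unfolding z(2) restrict_restrict_subset[OF BC] restrict_restrict_subset[OF B(2)] ..
    then have "((z |` ?C) |` B)(\<one> \<mapsto> a) \<in> restr X (B \<union> {\<one>})" using ext unfolding BC' by simp
    moreover have "z |` ?C \<in> restr X ?C" using z(1) restr_iff by blast
    ultimately have "(z |` ?C)(\<one> \<mapsto> a) \<in> restr X (?C \<union> {\<one>})" by (intro B(3))
    from restr_upd[OF this sub] show "x(\<one> \<mapsto> a) \<in> restr X (?C' \<union> {\<one>})"
      unfolding restrict_restrict_subset[OF sub] z(2) .
  qed
  moreover have "B \<subseteq> carrier G" using B(2) layers_carrier by blast
  ultimately show "\<exists>D B. finite D \<and> finite B \<and> B \<subseteq> carrier G \<and>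
      (\<forall>T'. grazing_tuple T' \<longrightarrow> agree D T T' \<longrightarrow> avo_via X B (layers 0 T'))"
    using D(1) E(1) B(1) by (intro exI[of _ "D \<union> E"] exI[of _ B]) simp
qed (rule avo_via_mono)

end

section \<open>The patterns of an II-avoshift on a uniform window\<close>

context group
begin

text \<open>
  If arbitrarily large windows could be filled around \<open>P\<close> without a forbidden pattern, the fillings would accumulate at a
  point of the SFT extending \<open>P\<close>.
\<close>

lemma eventually_refutes:
  fixes F :: "('a, 'c::finite) config set"
  assumes F: "pattern_set G F" and P: "finite (dom P)" "dom P \<subseteq> carrier G"
    and no: "\<And>y. y \<in> SFT G F \<Longrightarrow> \<not> P \<subseteq>\<^sub>m y"
  shows "\<exists>B0. finite B0 \<and> B0 \<subseteq> carrier G \<and>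
    (\<forall>B. finite B \<longrightarrow> B0 \<subseteq> B \<longrightarrow> B \<subseteq> carrier G \<longrightarrow> refutes B F P)"
proof (rule ccontr)
  assume neg: "\<not> ?thesis"
  have neg': "\<exists>B. finite B \<and> B0 \<subseteq> B \<and> B \<subseteq> carrier G \<and> \<not> refutes B F P"
    if B0: "finite B0" "B0 \<subseteq> carrier G" for B0
  proof (rule ccontr)
    assume "\<not> ?thesis"
    then have "\<forall>B. finite B \<longrightarrow> B0 \<subseteq> B \<longrightarrow> B \<subseteq> carrier G \<longrightarrow> refutes B F P" by blast
    with B0 have "\<exists>B0. finite B0 \<and> B0 \<subseteq> carrier G \<and>
        (\<forall>B. finite B \<longrightarrow> B0 \<subseteq> B \<longrightarrow> B \<subseteq> carrier G \<longrightarrow> refutes B F P)"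
      by (intro exI[of _ B0] conjI)
    with neg show False by (rule notE)
  qed
  define \<Phi> where "\<Phi> D x \<longleftrightarrow> P \<subseteq>\<^sub>m x \<and> dom x \<subseteq> carrier G \<and> D \<inter> carrier G \<subseteq> dom x \<and>
      (\<forall>Q\<in>F. \<forall>g\<in>D \<inter> carrier G. \<not> occ_at g Q x)" for D and x :: "('a, 'c) config"
  have "\<exists>f. \<forall>D. finite D \<longrightarrow> (\<exists>x. \<Phi> D x \<and> (\<forall>i\<in>D. x i = f i))"
  proof (rule compact_finite_valued)
    fix D :: "'a set" assume D: "finite D"
    have "finite (D \<inter> carrier G \<union> dom P)" "D \<inter> carrier G \<union> dom P \<subseteq> carrier G" using D P by auto
    from neg'[OF this] obtain B where B: "D \<inter> carrier G \<union> dom P \<subseteq> B" "B \<subseteq> carrier G" "\<not> refutes B F P"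
      by blast
    have "dom P \<subseteq> B" using B(1) by blast
    then obtain x where x: "dom x = B" "P \<subseteq>\<^sub>m x" "\<not> occurs_within B F x"
      using B(3) unfolding refutes_def by blast
    have "\<forall>Q\<in>F. \<forall>g\<in>D \<inter> carrier G. \<not> occ_at g Q x"
      using x(3) B(1) unfolding occurs_within_def by blast
    then have "\<Phi> D x" unfolding \<Phi>_def using x(1,2) B(1,2) by simp
    then show "\<exists>x. \<Phi> D x" by blast
  next
    fix D D' :: "'a set" and x assume "\<Phi> D' x" "D \<subseteq> D'"
    then show "\<Phi> D x" unfolding \<Phi>_def by blast
  qed
  then obtain f where f': "\<forall>D. finite D \<longrightarrow> (\<exists>x. \<Phi> D x \<and> (\<forall>i\<in>D. x i = f i))" ..
  have f: "\<exists>x. \<Phi> D x \<and> (\<forall>i\<in>D. x i = f i)" if "finite D" for D by (rule mp[OF spec[OF f'] that])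
  have dom: "dom f = carrier G"
  proof -
    have "f g \<noteq> None \<longleftrightarrow> g \<in> carrier G" for g
    proof -
      obtain x where x: "\<Phi> {g} x" "x g = f g" using f[of "{g}"] by auto
      have "g \<in> dom x \<longleftrightarrow> g \<in> carrier G" using x(1) unfolding \<Phi>_def by blast
      then show ?thesis using x(2) by (simp add: domIff)
    qed
    then show ?thesis by auto
  qed
  have Pf: "P \<subseteq>\<^sub>m f" unfolding map_le_def
  proof (rule ballI)
    fix d assume d: "d \<in> dom P"
    obtain x where x: "\<Phi> {d} x" "x d = f d" using f[of "{d}"] by auto
    then have "P d = x d" using d unfolding \<Phi>_def map_le_def by blast
    then show "P d = f d" using x(2) by simp
  qed
  have "avoids F f" unfolding avoids_def
  proof (intro ballI notI)
    fix Q g assume Q: "Q \<in> F" "g \<in> carrier G" "occ_at g Q f"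
    have "finite (insert g ((\<lambda>d. g \<otimes> d) ` dom Q))" using pattern_setD(2)[OF F Q(1)] by simp
    from f[OF this] obtain x where x: "\<Phi> (insert g ((\<lambda>d. g \<otimes> d) ` dom Q)) x"
      "\<forall>i\<in>insert g ((\<lambda>d. g \<otimes> d) ` dom Q). x i = f i" by blast
    have "occ_at g Q x" using Q(3) by (rule occ_at_cong) (use x(2) in simp)
    moreover have "\<not> occ_at g Q x" using x(1) Q(1,2) unfolding \<Phi>_def by blast
    ultimately show False by blast
  qed
  then show False using no[of f] dom Pf SFT_iff by blast
qed

lemma restr_shift:
  assumes "pattern_set G F" "g \<in> carrier G" "S \<subseteq> carrier G" "x \<in> restr (SFT G F) S"
  shows "shift G g x \<in> restr (SFT G F) (g <# S)"
proof -
  obtain y where y: "y \<in> SFT G F" "x = y |` S" using assms(4) restr_iff by blast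
  have "shift G g y \<in> SFT G F" by (rule shift_SFT[OF assms(2,1) y(1)])
  moreover have "shift G g x = shift G g y |` (g <# S)"
    unfolding y(2) by (rule shift_restrict[OF assms(2,3)])
  ultimately show ?thesis unfolding restr_iff by blast
qed

lemma not_restr_not_occ_at:
  assumes F: "pattern_set G F" and y: "y \<in> SFT G F" and P: "dom P \<subseteq> carrier G" "P \<notin> restr (SFT G F) (dom P)"
    and g: "g \<in> carrier G"
  shows "\<not> occ_at g P y"
proof
  assume "occ_at g P y"
  then have "occ_at (inv g \<otimes> g) P (shift G (inv g) y)"
    using shift_occ_at[of "inv g" g P y] g P(1) by simp
  then have occ: "occ_at \<one> P (shift G (inv g) y)" using g by simp
  have "P = shift G (inv g) y |` dom P"
  proof
    fix d show "P d = (shift G (inv g) y |` dom P) d"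
    proof (cases "d \<in> dom P")
      case True
      then have "shift G (inv g) y (\<one> \<otimes> d) = P d" using occ unfolding occ_at_def by blast
      then show ?thesis using True P(1) by (simp add: restrict_map_def subset_iff)
    qed (auto simp: restrict_map_def)
  qed
  then show False using P(2) shift_SFT[OF _ F y, of "inv g"] g restr_iff[of P _ "dom P"] by auto
qed

lemma finite_configs: "finite B \<Longrightarrow> finite {P :: ('a, 'c::finite) config. dom P \<subseteq> B}"
proof -
  assume B: "finite B"
  have "{P :: ('a, 'c) config. dom P \<subseteq> B} = (\<Union>D\<in>Pow B. {P. dom P = D \<and> ran P \<subseteq> UNIV})" by auto
  moreover have "finite {P :: ('a, 'c) config. dom P = D \<and> ran P \<subseteq> UNIV}" if "D \<in> Pow B" for D
    using that B by (intro finite_set_of_finite_maps) (auto intro: finite_subset)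
  ultimately show ?thesis using B by simp
qed

end

context polycyclic
begin

text \<open>
  The relation used with the building principle for completeness: for configurations avoiding \<open>Ps\<close>, membership in the
  restriction of \<open>X\<close> propagates from \<open>S\<close> to \<open>S'\<close>.
\<close>

definition admissible_extension :: "('a, 'c::finite) config set \<Rightarrow> ('a, 'c) config set \<Rightarrow> 'a set \<Rightarrow> 'a set \<Rightarrow> bool" where
  "admissible_extension Ps X S S' \<longleftrightarrow>
     (\<forall>x. dom x = S' \<longrightarrow> avoids Ps x \<longrightarrow> x |` S \<in> restr X S \<longrightarrow> x \<in> restr X S')"

text \<open>
  For increasing unions this is compactness of the SFT: a configuration belongs to the restriction if all its finite
  parts do.
\<close>

lemma extension_relation_admissible_extension:
  fixes F Ps :: "('a, 'c::finite) config set"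
  assumes F: "pattern_set G F" and Ps: "pattern_set G Ps"
  shows "extension_relation (admissible_extension Ps (SFT G F))"
  unfolding extension_relation_def
proof (intro conjI allI ballI impI)
  fix S assume "S \<subseteq> carrier G"
  show "admissible_extension Ps (SFT G F) S S"
    unfolding admissible_extension_def using restrict_dom_self by metis
next
  fix S S' S'' assume S: "S \<subseteq> S'" "S' \<subseteq> S''" "admissible_extension Ps (SFT G F) S S'"
    "admissible_extension Ps (SFT G F) S' S''"
  show "admissible_extension Ps (SFT G F) S S''" unfolding admissible_extension_def
  proof (intro allI impI)
    fix x assume x: "dom x = S''" "avoids Ps x" "x |` S \<in> restr (SFT G F) S"
    have "dom (x |` S') = S'" using x(1) S(2) by auto
    moreover have "(x |` S') |` S \<in> restr (SFT G F) S"
      unfolding restrict_restrict_subset[OF S(1)] by (rule x(3))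
    ultimately have "x |` S' \<in> restr (SFT G F) S'"
      using S(3) avoids_restrict[OF x(2)] unfolding admissible_extension_def by blast
    then show "x \<in> restr (SFT G F) S''" using S(4) x unfolding admissible_extension_def by blast
  qed
next
  fix g S S' assume g: "g \<in> carrier G" and S: "S \<subseteq> S'" "S' \<subseteq> carrier G"
    "admissible_extension Ps (SFT G F) S S'"
  show "admissible_extension Ps (SFT G F) (g <# S) (g <# S')" unfolding admissible_extension_def
  proof (intro allI impI)
    fix x assume x: "dom x = g <# S'" "avoids Ps x" "x |` (g <# S) \<in> restr (SFT G F) (g <# S)"
    have gS: "g <# S \<subseteq> carrier G" "g <# S' \<subseteq> carrier G" using g S by (auto simp: l_coset_def)
    have g': "inv g \<in> carrier G" using g by simp
    have translate_back: "inv g <# (g <# A) = A" if "A \<subseteq> carrier G" for A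
      using translate_inverse[of "inv g" A] g that by simp
    let ?x = "shift G (inv g) x"
    have dom: "dom ?x = S'" using shift_dom[of "inv g" x] g x(1) gS S(2) translate_back by simp
    have avoid: "avoids Ps ?x" using shift_avoids[OF g' Ps x(2)] .
    have "shift G (inv g) (x |` (g <# S)) \<in> restr (SFT G F) (inv g <# (g <# S))"
      by (rule restr_shift[OF F g' gS(1) x(3)])
    then have "?x |` S \<in> restr (SFT G F) S"
      unfolding shift_restrict[OF g' gS(1)] using translate_back[of S] S by simp
    then have "?x \<in> restr (SFT G F) S'"
      using S(3) dom avoid unfolding admissible_extension_def by blast
    then have "shift G g ?x \<in> restr (SFT G F) (g <# S')" by (rule restr_shift[OF F g S(2)])
    moreover have "shift G g ?x = x" by (rule shift_inv[OF g]) (use x(1) gS in simp)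
    ultimately show "x \<in> restr (SFT G F) (g <# S')" by simp
  qed
next
  fix S :: "nat \<Rightarrow> 'a set"
  assume S: "\<forall>j. S j \<subseteq> S (Suc j) \<and> S j \<subseteq> carrier G \<and> admissible_extension Ps (SFT G F) (S j) (S (Suc j))"
  show "admissible_extension Ps (SFT G F) (S 0) (\<Union>j. S j)" unfolding admissible_extension_def
  proof (intro allI impI)
    fix x assume x: "dom x = (\<Union>j. S j)" "avoids Ps x" "x |` S 0 \<in> restr (SFT G F) (S 0)"
    have mono: "S i \<subseteq> S j" if "i \<le> j" for i j by (rule lift_Suc_mono_le[of S, OF _ that]) (use S in blast)
    have all: "x |` S j \<in> restr (SFT G F) (S j)" for j
    proof (induction j)
      case 0
      then show ?case by (rule x(3))
    next
      case (Suc j)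
      have "dom (x |` S (Suc j)) = S (Suc j)" using x(1) by auto
      moreover have "S j \<subseteq> S (Suc j)" using S by blast
      then have "(x |` S (Suc j)) |` S j \<in> restr (SFT G F) (S j)"
        using Suc restrict_restrict_subset by metis
      moreover have "admissible_extension Ps (SFT G F) (S j) (S (Suc j))" using S by blast
      ultimately show ?case using avoids_restrict[OF x(2)] unfolding admissible_extension_def by blast
    qed
    show "x \<in> restr (SFT G F) (\<Union>j. S j)"
    proof (rule SFT_restr_compact[OF F x(1)])
      show "(\<Union>j. S j) \<subseteq> carrier G" using S by blast
      fix D assume D: "finite D" "D \<subseteq> (\<Union>j. S j)"
      have "\<exists>j. D \<subseteq> S j"
        using D
      proof (induction rule: finite_induct)
        case (insert d D)
        then obtain i j where ij: "d \<in> S i" "D \<subseteq> S j" by auto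
        have "S i \<subseteq> S (max i j)" "S j \<subseteq> S (max i j)" by (rule mono, simp)+
        then have "insert d D \<subseteq> S (max i j)" using ij by blast
        then show ?case by blast
      qed simp
      then obtain j where j: "D \<subseteq> S j" by blast
      from restr_restrict[OF all[of j] this] show "x |` D \<in> restr (SFT G F) D"
        unfolding restrict_restrict_subset[OF j] .
    qed
  qed
qed

text \<open>
  Occurrences can be translated, so it is enough to look at domains that contain \<open>\<one>\<close>. The empty pattern covers the case of
  empty \<open>X\<close>: it belongs to the set exactly then.
\<close>

definition based_complement :: "('a, 'c) config set \<Rightarrow> 'a set \<Rightarrow> ('a, 'c) config set" where
  "based_complement X B = {P. dom P \<subseteq> B \<and> (dom P = {} \<or> \<one> \<in> dom P) \<and> P \<notin> restr X (dom P)}"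

text \<open>
  The window \<open>B\<close> contains the quotients of the positions in each given pattern, so that each given pattern, moved to contain \<open>\<one>\<close>,
  is a pattern on a subset of \<open>B\<close>; and the SFT is avo through \<open>B\<close> for all inductive intervals.
\<close>

context
  fixes F :: "('a, 'c::finite) config set" and B :: "'a set"
  assumes F: "pattern_set G F" and B: "finite B" "B \<subseteq> carrier G" "\<one> \<in> B"
    and F_B: "\<forall>Q\<in>F. \<forall>d\<in>dom Q. \<forall>d'\<in>dom Q. inv d \<otimes> d' \<in> B"
    and avoB: "\<forall>T. grazing_tuple T \<longrightarrow> avo_via (SFT G F) B (layers 0 T)"
begin

lemma pattern_set_based_complement: "pattern_set G (based_complement (SFT G F) B)"
proof -
  have "based_complement (SFT G F) B \<subseteq> {P. dom P \<subseteq> B}" unfolding based_complement_def by blast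
  then have "finite (based_complement (SFT G F) B)" using finite_configs[OF B(1)] finite_subset by blast
  moreover have "finite (dom P)" "dom P \<subseteq> carrier G" if "P \<in> based_complement (SFT G F) B" for P
    using that B finite_subset[of "dom P" B] unfolding based_complement_def by auto
  ultimately show ?thesis unfolding pattern_set_def by blast
qed

lemma SFT_avoids_based_complement: "y \<in> SFT G F \<Longrightarrow> avoids (based_complement (SFT G F) B) y"
  unfolding avoids_def
proof (intro ballI)
  fix P g assume y: "y \<in> SFT G F" and P: "P \<in> based_complement (SFT G F) B" and g: "g \<in> carrier G"
  have "dom P \<subseteq> carrier G" "P \<notin> restr (SFT G F) (dom P)" using P B unfolding based_complement_def by auto
  then show "\<not> occ_at g P y" using not_restr_not_occ_at[OF F y _ _ g] by blast
qed

lemma not_avoids_if_SFT_empty: "SFT G F = {} \<Longrightarrow> \<not> avoids (based_complement (SFT G F) B) x"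
proof -
  assume "SFT G F = {}"
  then have "Map.empty \<in> based_complement (SFT G F) B" unfolding based_complement_def restr_def by simp
  moreover have "occ_at \<one> Map.empty x" unfolding occ_at_def by simp
  ultimately show ?thesis unfolding avoids_def by blast
qed

text \<open>
  A forbidden pattern \<open>Q\<close> with \<open>d \<in> dom Q\<close>, translated by \<open>inv d\<close>, is a pattern on \<open>B\<close> containing \<open>\<one>\<close> that occurs in no point, so it
  belongs to the new set.
\<close>

lemma SFT_based_complement: "SFT G (based_complement (SFT G F) B) = SFT G F"
proof
  show "SFT G F \<subseteq> SFT G (based_complement (SFT G F) B)"
  proof
    fix y assume y: "y \<in> SFT G F"
    then have "dom y = carrier G" unfolding SFT_iff by blast
    then show "y \<in> SFT G (based_complement (SFT G F) B)" unfolding SFT_iff using SFT_avoids_based_complement[OF y] by blast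
  qed
  show "SFT G (based_complement (SFT G F) B) \<subseteq> SFT G F"
  proof
    fix y assume y: "y \<in> SFT G (based_complement (SFT G F) B)"
    then have dom: "dom y = carrier G" and av: "avoids (based_complement (SFT G F) B) y" unfolding SFT_iff by blast+
    have "avoids F y" unfolding avoids_def
    proof (intro ballI notI)
      fix Q g assume Q: "Q \<in> F" "g \<in> carrier G" "occ_at g Q y"
      have Qc: "dom Q \<subseteq> carrier G" using pattern_setD(1)[OF F Q(1)] by blast
      have noX: "\<not> occ_at a Q z" if "z \<in> SFT G F" "a \<in> carrier G" for z a
        using that Q(1) unfolding SFT_iff avoids_def by blast
      show False
      proof (cases "dom Q = {}")
        case True
        then have "occ_at \<one> Q z" for z unfolding occ_at_def by simp
        then have "SFT G F = {}" using noX[of _ \<one>] by blast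
        then show False using not_avoids_if_SFT_empty av by blast
      next
        case False
        then obtain d where d: "d \<in> dom Q" by blast
        have dc: "d \<in> carrier G" using d Qc by blast
        let ?P = "shift G (inv d) Q"
        have domP: "dom ?P = inv d <# dom Q" using shift_dom[of "inv d" Q] dc Qc by simp
        have in_domP: "inv d \<otimes> d' \<in> dom ?P" if "d' \<in> dom Q" for d'
          unfolding domP l_coset_def using that by (rule UN_I) simp
        have "dom ?P \<subseteq> B"
        proof
          fix a assume "a \<in> dom ?P"
          then obtain d' where d': "d' \<in> dom Q" "a = inv d \<otimes> d'" unfolding domP l_coset_def by blast
          show "a \<in> B" unfolding d'(2) by (rule bspec[OF bspec[OF bspec[OF F_B Q(1)] d] d'(1)])
        qed
        moreover have "\<one> \<in> dom ?P" using in_domP[OF d] dc by simp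
        moreover have "?P \<notin> restr (SFT G F) (dom ?P)"
        proof
          assume "?P \<in> restr (SFT G F) (dom ?P)"
          then obtain z where z: "z \<in> SFT G F" "?P = z |` dom ?P" unfolding restr_iff by blast
          have "occ_at (inv d) Q z" unfolding occ_at_def
          proof (rule ballI)
            fix d' assume d': "d' \<in> dom Q"
            then have "d' \<in> carrier G" using Qc by blast
            then have "?P (inv d \<otimes> d') = Q d'" using shift_apply[of "inv d" d' Q] dc by simp
            moreover have "?P (inv d \<otimes> d') = z (inv d \<otimes> d')"
              using fun_cong[OF z(2), of "inv d \<otimes> d'"] in_domP[OF d'] by (simp add: restrict_map_def)
            ultimately show "z (inv d \<otimes> d') = Q d'" by simp
          qed
          then show False using noX[OF z(1), of "inv d"] dc by simp
        qed
        ultimately have "?P \<in> based_complement (SFT G F) B" unfolding based_complement_def by blast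
        moreover have "occ_at (g \<otimes> d) ?P y" unfolding occ_at_def
        proof (rule ballI)
          fix a assume "a \<in> dom ?P"
          then obtain d' where d': "d' \<in> dom Q" "a = inv d \<otimes> d'" unfolding domP l_coset_def by blast
          then have d'c: "d' \<in> carrier G" using Qc by blast
          have "g \<otimes> d \<otimes> a = g \<otimes> d'" unfolding d'(2) using Q(2) dc d'c by (simp add: m_assoc inv_solve_left' r_inv_ex m_assoc[symmetric])
          moreover have "?P a = Q d'" unfolding d'(2) using shift_apply[of "inv d" d' Q] dc d'c by simp
          ultimately show "y (g \<otimes> d \<otimes> a) = ?P a" using Q(3) d'(1) unfolding occ_at_def by simp
        qed
        ultimately show False using av Q(2) dc unfolding avoids_def by blast
      qed
    qed
    then show "y \<in> SFT G F" unfolding SFT_iff using dom by blast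
  qed
qed

text \<open>
  In a one-point step the values on \<open>C \<inter> B\<close> and at \<open>\<one>\<close> form a pattern on a subset of \<open>B\<close> containing \<open>\<one>\<close>. As it is avoided by the new patterns, it is
  a pattern of \<open>X\<close>, and the avo property extends this to all of \<open>C\<close>. The building principle leads from the empty set to the given interval.
\<close>

lemma avoids_based_complement_imp_restr:
  assumes T: "grazing_tuple T" and x: "dom x = layers 0 T" "avoids (based_complement (SFT G F) B) x"
  shows "x \<in> restr (SFT G F) (layers 0 T)"
proof -
  have base: "admissible_extension (based_complement (SFT G F) B) (SFT G F) (layers 0 T) (layers 0 T \<union> {\<one>})" if T: "grazing_tuple T" for T
    unfolding admissible_extension_def
  proof (intro allI impI)
    let ?C = "layers 0 T"
    fix x :: "('a, 'c) config"
    assume x: "dom x = ?C \<union> {\<one>}" "avoids (based_complement (SFT G F) B) x" "x |` ?C \<in> restr (SFT G F) ?C"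
    obtain a where a: "x \<one> = Some a" using x(1) by blast
    have xC: "(x |` ?C)(\<one> \<mapsto> a) = x"
    proof
      fix g show "((x |` ?C)(\<one> \<mapsto> a)) g = x g"
        using a x(1) by (cases "g \<in> ?C") (auto simp: restrict_map_def domIff set_eq_iff)
    qed
    let ?P = "((x |` ?C) |` (?C \<inter> B))(\<one> \<mapsto> a)"
    have Px: "?P \<subseteq>\<^sub>m x"
      unfolding map_le_def using a by (auto simp: restrict_map_def split: if_splits)
    have domP: "dom ?P = ?C \<inter> B \<union> {\<one>}" using x(1) by auto
    have "?P \<in> restr (SFT G F) (?C \<inter> B \<union> {\<one>})"
    proof (rule ccontr)
      assume "?P \<notin> restr (SFT G F) (?C \<inter> B \<union> {\<one>})"
      then have "?P \<in> based_complement (SFT G F) B" unfolding based_complement_def mem_Collect_eq domP using B(3) by blast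
      moreover have "occ_at \<one> ?P x" unfolding occ_at_def
      proof (rule ballI)
        fix d assume d: "d \<in> dom ?P"
        then have "d \<in> carrier G" unfolding domP using B(2) by auto
        moreover have "?P d = x d" using Px d unfolding map_le_def by blast
        ultimately show "x (\<one> \<otimes> d) = ?P d" by simp
      qed
      ultimately show False using x(2) unfolding avoids_def by blast
    qed
    then have "(x |` ?C)(\<one> \<mapsto> a) \<in> restr (SFT G F) (?C \<union> {\<one>})"
      using avoB T x(3) unfolding avo_via_def by blast
    then show "x \<in> restr (SFT G F) (?C \<union> {\<one>})" unfolding xC .
  qed
  have "admissible_extension (based_complement (SFT G F) B) (SFT G F) {} (layers 0 T)"
    by (rule extend_empty[OF extension_relation_admissible_extension[OF F pattern_set_based_complement] base _ T]) simp_all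
  moreover have "x |` {} \<in> restr (SFT G F) {}"
  proof -
    have "SFT G F \<noteq> {}" using not_avoids_if_SFT_empty x(2) by blast
    then obtain z where z: "z \<in> SFT G F" by blast
    have "x |` {} = z |` {}" by (simp add: restrict_map_def fun_eq_iff)
    then show ?thesis using z unfolding restr_iff by blast
  qed
  ultimately show ?thesis using x unfolding admissible_extension_def by blast
qed

lemma avoids_based_complement_extend:
  assumes T: "grazing_tuple T" and x: "dom x = layers 0 T" "avoids (based_complement (SFT G F) B) x"
  shows "\<exists>a. avoids (based_complement (SFT G F) B) (x(\<one> \<mapsto> a))"
proof -
  let ?C = "layers 0 T"
  obtain z where z: "z \<in> SFT G F" "x = z |` ?C" using avoids_based_complement_imp_restr[OF assms] restr_iff by blast
  have "dom z = carrier G" using z(1) SFT_iff by blast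
  then have "\<one> \<in> dom z" by simp
  then obtain a where a: "z \<one> = Some a" by blast
  have "x(\<one> \<mapsto> a) \<subseteq>\<^sub>m z"
    unfolding z(2) map_le_def using a by (auto simp: restrict_map_def split: if_splits)
  then have "avoids (based_complement (SFT G F) B) (x(\<one> \<mapsto> a))" using avoids_le[OF SFT_avoids_based_complement[OF z(1)]] by blast
  then show ?thesis by blast
qed

end

end

section \<open>Every II-avoshift has a certificate\<close>

context polycyclic
begin

lemma fits_mono:
  assumes fit: "fits B Ps" and sub: "B \<subseteq> B'"
  shows "fits B' Ps"
  unfolding fits_def
proof (intro ballI conjI)
  fix P d assume Pd: "P \<in> Ps" "d \<in> dom P"
  note f = fit[unfolded fits_def, rule_format, OF Pd]
  show "inv d \<in> B'" using f sub by blast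
  show "inv d \<otimes> d' \<in> B'" if "d' \<in> dom P" for d'
    using conjunct2[OF f, rule_format, OF that] sub by blast
qed

lemma occ_at_upd:
  assumes occ: "occ_at g P (x(\<one> \<mapsto> a))" and no: "\<not> occ_at g P x" and g: "g \<in> carrier G" and P: "dom P \<subseteq> carrier G"
  shows "\<exists>d\<in>dom P. g = inv d"
proof (rule ccontr)
  assume neg: "\<not> ?thesis"
  have "g \<otimes> d \<noteq> \<one>" if "d \<in> dom P" for d
  proof
    assume "g \<otimes> d = \<one>"
    then have "g = inv d" using inv_equality[of g d] g P that by auto
    then show False using neg that by blast
  qed
  then have "occ_at g P x" by (intro occ_at_cong[OF occ]) simp
  then show False using no by blast
qed

text \<open>
  Otherwise for every finite \<open>D \<supseteq> W\<close> there is a configuration on \<open>C \<inter> D\<close> avoiding \<open>Ps\<close> that cannot be continued to \<open>\<one>\<close>. A limit of them avoids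
  \<open>Ps\<close> on \<open>C\<close>, so it can be continued by some letter \<open>a\<close>. Inside \<open>W\<close>, where all occurrences covering \<open>\<one>\<close> take place, the limit agrees with one of
  the configurations, which therefore can also be continued by \<open>a\<close>.
\<close>

lemma locally_extendable:
  fixes Ps :: "('a, 'c::finite) config set"
  assumes Ps: "pattern_set G Ps" and C: "C \<subseteq> carrier G"
    and W: "finite W" "W \<subseteq> carrier G" and fit: "fits W Ps"
    and ext: "\<And>x. dom x = C \<Longrightarrow> avoids Ps x \<Longrightarrow> \<exists>a. avoids Ps (x(\<one> \<mapsto> a))"
  shows "\<exists>D. finite D \<and> W \<subseteq> D \<and> D \<subseteq> carrier G \<and>
    (\<forall>x. dom x = C \<inter> D \<longrightarrow> avoids Ps x \<longrightarrow> (\<exists>a. avoids Ps (x(\<one> \<mapsto> a))))"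
proof (rule ccontr)
  assume neg: "\<not> ?thesis"
  have bad: "\<exists>x. dom x = C \<inter> D \<and> avoids Ps x \<and> (\<forall>a. \<not> avoids Ps (x(\<one> \<mapsto> a)))"
    if D: "finite D" "W \<subseteq> D" "D \<subseteq> carrier G" for D
  proof (rule ccontr)
    assume "\<not> ?thesis"
    then have "\<forall>x. dom x = C \<inter> D \<longrightarrow> avoids Ps x \<longrightarrow> (\<exists>a. avoids Ps (x(\<one> \<mapsto> a)))" by blast
    with D have "\<exists>D. finite D \<and> W \<subseteq> D \<and> D \<subseteq> carrier G \<and>
        (\<forall>x. dom x = C \<inter> D \<longrightarrow> avoids Ps x \<longrightarrow> (\<exists>a. avoids Ps (x(\<one> \<mapsto> a))))"
      by (intro exI[of _ D] conjI)
    with neg show False by (rule notE)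
  qed
  define \<Phi> where "\<Phi> D x \<longleftrightarrow> avoids Ps x \<and> dom x \<subseteq> C \<and> C \<inter> D \<subseteq> dom x \<and>
      (\<forall>a. \<not> avoids Ps (x(\<one> \<mapsto> a)))" for D and x :: "('a, 'c) config"
  have "\<exists>f. \<forall>D. finite D \<longrightarrow> (\<exists>x. \<Phi> D x \<and> (\<forall>i\<in>D. x i = f i))"
  proof (rule compact_finite_valued)
    fix D :: "'a set" assume D: "finite D"
    have "finite (D \<inter> carrier G \<union> W)" "W \<subseteq> D \<inter> carrier G \<union> W" "D \<inter> carrier G \<union> W \<subseteq> carrier G"
      using D W by auto
    from bad[OF this] obtain x where x: "dom x = C \<inter> (D \<inter> carrier G \<union> W)" "avoids Ps x"
      "\<forall>a. \<not> avoids Ps (x(\<one> \<mapsto> a))" by blast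
    have "C \<inter> D \<subseteq> dom x" "dom x \<subseteq> C" using x(1) C by auto
    then have "\<Phi> D x" unfolding \<Phi>_def using x(2,3) by simp
    then show "\<exists>x. \<Phi> D x" by blast
  next
    fix D D' :: "'a set" and x assume "\<Phi> D' x" "D \<subseteq> D'"
    then show "\<Phi> D x" unfolding \<Phi>_def by blast
  qed
  then obtain f where f': "\<forall>D. finite D \<longrightarrow> (\<exists>x. \<Phi> D x \<and> (\<forall>i\<in>D. x i = f i))" ..
  have f: "\<exists>x. \<Phi> D x \<and> (\<forall>i\<in>D. x i = f i)" if "finite D" for D by (rule mp[OF spec[OF f'] that])
  have "f g \<noteq> None \<longleftrightarrow> g \<in> C" for g
  proof -
    obtain x where x: "\<Phi> {g} x" "x g = f g" using f[of "{g}"] by auto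
    have "g \<in> dom x \<longleftrightarrow> g \<in> C" using x(1) unfolding \<Phi>_def by blast
    then show ?thesis using x(2) by (simp add: domIff)
  qed
  then have "dom f = C" by auto
  moreover have "avoids Ps f"
  proof (rule avoids_local[OF Ps])
    fix D :: "'a set" assume "finite D"
    from f[OF this] show "\<exists>x. avoids Ps x \<and> (\<forall>g\<in>D. x g = f g)" unfolding \<Phi>_def by blast
  qed
  ultimately obtain a where a: "avoids Ps (f(\<one> \<mapsto> a))" using ext by blast
  obtain x where x: "\<Phi> W x" "\<forall>i\<in>W. x i = f i" using f[OF W(1)] by blast
  have "\<not> avoids Ps (x(\<one> \<mapsto> a))" using x(1) unfolding \<Phi>_def by blast
  then obtain P g where P: "P \<in> Ps" "g \<in> carrier G" "occ_at g P (x(\<one> \<mapsto> a))"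
    unfolding avoids_def by blast
  have "\<not> occ_at g P x" using x(1) P(1,2) unfolding \<Phi>_def avoids_def by blast
  then obtain d where d: "d \<in> dom P" "g = inv d"
    using occ_at_upd[OF P(3) _ P(2)] pattern_setD(1)[OF Ps P(1)] by blast
  have "occ_at g P (f(\<one> \<mapsto> a))" using P(3)
  proof (rule occ_at_cong)
    fix d' assume "d' \<in> dom P"
    then have "g \<otimes> d' \<in> W" using fit P(1) d unfolding fits_def by blast
    then show "(x(\<one> \<mapsto> a)) (g \<otimes> d') = (f(\<one> \<mapsto> a)) (g \<otimes> d')" using x(2) by simp
  qed
  then show False using a P(1,2) unfolding avoids_def by blast
qed

text \<open>
  A window \<open>B\<close> larger than \<open>D\<close> by the sizes of the patterns sees all occurrences in the restriction to \<open>D\<close>. Hence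
  avoiding \<open>Ps\<close> within \<open>B\<close> implies avoiding \<open>Ps\<close> completely on \<open>D\<close>.
\<close>

lemma one_step_extendable_if_locally:
  fixes Ps :: "('a, 'c::finite) config set"
  assumes Ps: "pattern_set G Ps" and D: "D \<subseteq> carrier G" and fit: "fits D Ps"
    and loc: "\<And>x. dom x = C \<inter> D \<Longrightarrow> avoids Ps x \<Longrightarrow> \<exists>a. avoids Ps (x(\<one> \<mapsto> a))"
    and B: "D \<subseteq> B" "\<one> \<in> B" "B \<subseteq> carrier G"
    and near: "\<And>P d e. P \<in> Ps \<Longrightarrow> d \<in> dom P \<Longrightarrow> e \<in> D \<Longrightarrow> e \<otimes> inv d \<in> B"
  shows "one_step_extendable B Ps C"
  unfolding one_step_extendable_def
proof (intro allI impI)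
  fix x :: "('a, 'c) config" assume x: "dom x = C \<inter> B" "\<not> occurs_within B Ps x"
  have "dom (x |` D) = C \<inter> D" using x(1) B(1) by auto
  moreover have "avoids Ps (x |` D)" unfolding avoids_def
  proof (intro ballI notI)
    fix P g assume P: "P \<in> Ps" "g \<in> carrier G" "occ_at g P (x |` D)"
    have occ: "occ_at g P x" using occ_at_le[OF P(3) map_le_restrict] .
    show False
    proof (cases "dom P = {}")
      case True
      then have "occ_at \<one> P x" unfolding occ_at_def by simp
      then show False using x(2) P(1) B(2) unfolding occurs_within_def by blast
    next
      case False
      then obtain d where d: "d \<in> dom P" by blast
      have dc: "d \<in> carrier G" using pattern_setD(1)[OF Ps P(1) d] .
      have "(x |` D) (g \<otimes> d) \<noteq> None" using P(3) d unfolding occ_at_def by (auto simp: domIff)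
      then have "g \<otimes> d \<in> D" by (auto simp: restrict_map_def split: if_splits)
      from near[OF P(1) d this] have "g \<in> B" using P(2) dc by (simp add: m_assoc)
      then show False using x(2) P(1) occ unfolding occurs_within_def by blast
    qed
  qed
  ultimately obtain a where a: "avoids Ps ((x |` D)(\<one> \<mapsto> a))" using loc by blast
  have "\<not> occurs_within B Ps (x(\<one> \<mapsto> a))"
  proof
    assume "occurs_within B Ps (x(\<one> \<mapsto> a))"
    then obtain P g where P: "P \<in> Ps" "g \<in> B" "occ_at g P (x(\<one> \<mapsto> a))"
      unfolding occurs_within_def by blast
    have g: "g \<in> carrier G" using P(2) B(3) by blast
    have "\<not> occ_at g P x" using x(2) P(1,2) unfolding occurs_within_def by blast
    then obtain d where d: "d \<in> dom P" "g = inv d"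
      using occ_at_upd[OF P(3) _ g] pattern_setD(1)[OF Ps P(1)] by blast
    have "occ_at g P ((x |` D)(\<one> \<mapsto> a))" using P(3)
    proof (rule occ_at_cong)
      fix d' assume "d' \<in> dom P"
      then have "g \<otimes> d' \<in> D" using fit P(1) d unfolding fits_def by blast
      then show "(x(\<one> \<mapsto> a)) (g \<otimes> d') = ((x |` D)(\<one> \<mapsto> a)) (g \<otimes> d')" by simp
    qed
    then show False using a P(1) g unfolding avoids_def by blast
  qed
  then show "\<exists>a. \<not> occurs_within B Ps (x(\<one> \<mapsto> a))" by blast
qed

text \<open>
  The set \<open>D\<close> obtained for one inductive interval also serves all inductive intervals that have the same intersection with \<open>D\<close>, and these include all
  nearby ones.
\<close>

lemma uniformly_extendable:
  fixes Ps :: "('a, 'c::finite) config set"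
  assumes Ps: "pattern_set G Ps"
    and W: "finite W" "W \<subseteq> carrier G" and fit: "fits W Ps"
    and ext: "\<And>T x. grazing_tuple T \<Longrightarrow> dom x = layers 0 T \<Longrightarrow> avoids Ps x \<Longrightarrow> \<exists>a. avoids Ps (x(\<one> \<mapsto> a))"
  shows "\<exists>B0. finite B0 \<and> B0 \<subseteq> carrier G \<and> (\<forall>T. grazing_tuple T \<longrightarrow>
    (\<forall>B. B0 \<subseteq> B \<longrightarrow> B \<subseteq> carrier G \<longrightarrow> one_step_extendable B Ps (layers 0 T)))"
proof (rule tuple_cover)
  fix T assume T: "grazing_tuple T"
  from locally_extendable[OF Ps layers_carrier[of 0 T] W fit ext[OF T]]
  obtain D where D': "finite D \<and> W \<subseteq> D \<and> D \<subseteq> carrier G \<and>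
    (\<forall>x. dom x = layers 0 T \<inter> D \<longrightarrow> avoids Ps x \<longrightarrow> (\<exists>a. avoids Ps (x(\<one> \<mapsto> a))))" by blast
  then have D: "finite D" "W \<subseteq> D" "D \<subseteq> carrier G"
    "\<And>x. dom x = layers 0 T \<inter> D \<Longrightarrow> avoids Ps x \<Longrightarrow> \<exists>a. avoids Ps (x(\<one> \<mapsto> a))"
    by simp_all
  have fitD: "fits D Ps" by (rule fits_mono[OF fit D(2)])
  define B0 where "B0 = insert \<one> (D \<union> (\<Union>P\<in>Ps. \<Union>d\<in>dom P. (\<lambda>e. e \<otimes> inv d) ` D))"
  have "finite B0" unfolding B0_def using D(1) pattern_setD(2,3)[OF Ps] by simp
  moreover have "B0 \<subseteq> carrier G"
  proof -
    have "e \<otimes> inv d \<in> carrier G" if "P \<in> Ps" "d \<in> dom P" "e \<in> D" for P d e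
      using pattern_setD(1)[OF Ps that(1,2)] that(3) D(3) by auto
    then show ?thesis unfolding B0_def using D(3) by auto
  qed
  moreover obtain E where E: "finite E"
    "\<And>T'. grazing_tuple T' \<Longrightarrow> agree E T T' \<Longrightarrow> layers 0 T \<inter> D = layers 0 T' \<inter> D"
    using layers_local_finite[OF D(1)] T by blast
  moreover have "one_step_extendable B Ps (layers 0 T')"
    if T': "grazing_tuple T'" "agree E T T'" and B: "B0 \<subseteq> B" "B \<subseteq> carrier G" for T' B
  proof (rule one_step_extendable_if_locally[OF Ps D(3) fitD])
    show "\<exists>a. avoids Ps (x(\<one> \<mapsto> a))" if "dom x = layers 0 T' \<inter> D" "avoids Ps x" for x
      using D(4)[of x] E(2)[OF T'] that by simp
    show "D \<subseteq> B" "\<one> \<in> B" "B \<subseteq> carrier G" using B unfolding B0_def by auto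
    show "e \<otimes> inv d \<in> B" if "P \<in> Ps" "d \<in> dom P" "e \<in> D" for P d e
    proof -
      have "e \<otimes> inv d \<in> B0" unfolding B0_def
        by (rule insertI2, rule UnI2, intro UN_I[OF that(1)] UN_I[OF that(2)] imageI that(3))
      then show ?thesis using B(1) by blast
    qed
  qed
  ultimately show "\<exists>D B. finite D \<and> finite B \<and> B \<subseteq> carrier G \<and> (\<forall>T'. grazing_tuple T' \<longrightarrow> agree D T T' \<longrightarrow>
      (\<forall>B'. B \<subseteq> B' \<longrightarrow> B' \<subseteq> carrier G \<longrightarrow> one_step_extendable B' Ps (layers 0 T')))"
    by (intro exI[of _ E] exI[of _ B0]) simp
next
  fix B B' :: "'a set" and T
  assume "\<forall>A. B \<subseteq> A \<longrightarrow> A \<subseteq> carrier G \<longrightarrow> one_step_extendable A Ps (layers 0 T)" "B \<subseteq> B'"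
  then show "\<forall>A. B' \<subseteq> A \<longrightarrow> A \<subseteq> carrier G \<longrightarrow> one_step_extendable A Ps (layers 0 T)"
    by (meson subset_trans)
qed

text \<open>
  The patterns are those of \<open>based_complement\<close> for a uniform window enlarged by the quotients of positions in \<open>F\<close>. Each condition on a certificate
  then holds for all windows containing a suitable finite set, and the union of these sets is \<open>B0\<close>.
\<close>

theorem certificate_complete:
  fixes F :: "('a, 'c::finite) config set"
  assumes F: "pattern_set G F" and avo: "II_avoshift G n H h k (SFT G F)"
  shows "\<exists>Ps B0. pattern_set G Ps \<and> finite B0 \<and> B0 \<subseteq> carrier G \<and>
    (\<forall>B. finite B \<longrightarrow> B0 \<subseteq> B \<longrightarrow> B \<subseteq> carrier G \<longrightarrow> certificate F Ps B)"
proof -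
  obtain B1 where B1: "finite B1" "B1 \<subseteq> carrier G"
    "\<And>T. grazing_tuple T \<Longrightarrow> avo_via (SFT G F) B1 (layers 0 T)"
    using uniformly_avo[OF avo] by blast
  \<comment> \<open>The window that \<open>fits\<close> asks for.\<close>
  define N where "N Ps = (\<Union>P\<in>Ps. \<Union>d\<in>dom P. insert (inv d) ((\<lambda>d'. inv d \<otimes> d') ` dom P))"
    for Ps :: "('a, 'c) config set"
  have N: "finite (N Ps)" "N Ps \<subseteq> carrier G" if "pattern_set G Ps" for Ps
  proof -
    show "finite (N Ps)" unfolding N_def using pattern_setD(2,3)[OF that] by simp
    have "insert (inv d) ((\<lambda>d'. inv d \<otimes> d') ` dom P) \<subseteq> carrier G" if P: "P \<in> Ps" "d \<in> dom P" for P d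
    proof (intro insert_subsetI image_subsetI)
      note dc = pattern_setD(1)[OF \<open>pattern_set G Ps\<close> P(1)]
      show "inv d \<in> carrier G" using dc[OF P(2)] by simp
      fix d' assume "d' \<in> dom P"
      from dc[OF this] dc[OF P(2)] show "inv d \<otimes> d' \<in> carrier G" by simp
    qed
    then show "N Ps \<subseteq> carrier G" unfolding N_def by (intro UN_least)
  qed
  define B2 where "B2 = insert \<one> (B1 \<union> N F)"
  have B2: "finite B2" "B2 \<subseteq> carrier G" "\<one> \<in> B2" unfolding B2_def using B1 N[OF F] by auto
  have F_B2: "\<forall>Q\<in>F. \<forall>d\<in>dom Q. \<forall>d'\<in>dom Q. inv d \<otimes> d' \<in> B2"
  proof (intro ballI)
    fix Q d d' assume Q: "Q \<in> F" "d \<in> dom Q" "d' \<in> dom Q"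
    have "inv d \<otimes> d' \<in> insert (inv d) ((\<lambda>d'. inv d \<otimes> d') ` dom Q)" using Q(3) by (rule insertI2[OF imageI])
    then have "inv d \<otimes> d' \<in> N F" unfolding N_def by (intro UN_I[OF Q(1)] UN_I[OF Q(2)])
    then show "inv d \<otimes> d' \<in> B2" unfolding B2_def by simp
  qed
  have avoB2: "\<forall>T. grazing_tuple T \<longrightarrow> avo_via (SFT G F) B2 (layers 0 T)"
  proof (intro allI impI)
    fix T assume T: "grazing_tuple T"
    have "B1 \<subseteq> B2" unfolding B2_def by blast
    with B1(3)[OF T] show "avo_via (SFT G F) B2 (layers 0 T)" by (rule avo_via_mono)
  qed
  define Ps where "Ps = based_complement (SFT G F) B2"
  have Ps: "pattern_set G Ps" unfolding Ps_def by (rule pattern_set_based_complement[OF F B2 F_B2 avoB2])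
  have eq: "SFT G Ps = SFT G F" unfolding Ps_def by (rule SFT_based_complement[OF F B2 F_B2 avoB2])
  have based: "based Ps" unfolding based_def Ps_def based_complement_def by blast
  have fit: "fits (N Ps) Ps" unfolding fits_def
  proof (intro ballI conjI)
    fix P d assume P: "P \<in> Ps" "d \<in> dom P"
    show "inv d \<in> N Ps" unfolding N_def by (intro UN_I[OF P(1)] UN_I[OF P(2)] insertI1)
    show "inv d \<otimes> d' \<in> N Ps" if "d' \<in> dom P" for d'
      unfolding N_def by (intro UN_I[OF P(1)] UN_I[OF P(2)] insertI2 imageI that)
  qed
  have ext: "\<exists>a. avoids Ps (x(\<one> \<mapsto> a))" if "grazing_tuple T" "dom x = layers 0 T" "avoids Ps x" for T x
    using that(3) unfolding Ps_def by (rule avoids_based_complement_extend[OF F B2 F_B2 avoB2 that(1,2)])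
  have not_le: "\<not> Q \<subseteq>\<^sub>m y" if Q: "Q \<in> Fs" and Fs: "pattern_set G Fs" "y \<in> SFT G Fs" for Q y and Fs :: "('a, 'c) config set"
  proof
    assume le: "Q \<subseteq>\<^sub>m y"
    have "occ_at \<one> Q y" unfolding occ_at_def
    proof (rule ballI)
      fix d assume d: "d \<in> dom Q"
      have "d \<in> carrier G" using pattern_setD(1)[OF Fs(1) Q d] .
      moreover have "Q d = y d" using le d unfolding map_le_def by blast
      ultimately show "y (\<one> \<otimes> d) = Q d" by simp
    qed
    moreover have "avoids Fs y" using Fs(2) SFT_iff by blast
    ultimately show False using Q unfolding avoids_def by blast
  qed
  have ref: "\<exists>B0. finite B0 \<and> B0 \<subseteq> carrier G \<and> (\<forall>P\<in>Qs. \<forall>B. finite B \<longrightarrow> B0 \<subseteq> B \<longrightarrow> B \<subseteq> carrier G \<longrightarrow> refutes B Fs P)"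
    if Qs: "pattern_set G Qs" and Fs: "pattern_set G Fs" "SFT G Fs = SFT G Qs" for Qs Fs :: "('a, 'c) config set"
  proof -
    let ?R = "\<lambda>P B0. finite B0 \<and> B0 \<subseteq> carrier G \<and> (\<forall>B. finite B \<longrightarrow> B0 \<subseteq> B \<longrightarrow> B \<subseteq> carrier G \<longrightarrow> refutes B Fs P)"
    have "\<exists>B0. ?R P B0" if P: "P \<in> Qs" for P
    proof (rule eventually_refutes[OF Fs(1)])
      show "finite (dom P)" "dom P \<subseteq> carrier G" using Qs P unfolding pattern_set_def by auto
      show "\<not> P \<subseteq>\<^sub>m y" if "y \<in> SFT G Fs" for y
        using not_le[OF P Qs] that unfolding Fs(2) by blast
    qed
    then have "\<forall>P\<in>Qs. \<exists>B0. ?R P B0" by (rule ballI)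
    from bchoice[OF this] obtain b where b: "\<forall>P\<in>Qs. ?R P (b P)" ..
    have "finite (\<Union>(b ` Qs))" using b pattern_setD(3)[OF Qs] by blast
    moreover have "\<Union>(b ` Qs) \<subseteq> carrier G" using b by blast
    moreover have "refutes B Fs P" if "P \<in> Qs" "finite B" "\<Union>(b ` Qs) \<subseteq> B" "B \<subseteq> carrier G" for P B
    proof -
      have "b P \<subseteq> B" using that by blast
      then show ?thesis using bspec[OF b that(1)] that(2,4) by blast
    qed
    ultimately show ?thesis by (intro exI[of _ "\<Union>(b ` Qs)"]) simp
  qed
  from ref[OF Ps F eq[symmetric]] obtain B3 where B3': "finite B3 \<and> B3 \<subseteq> carrier G \<and>
    (\<forall>P\<in>Ps. \<forall>B. finite B \<longrightarrow> B3 \<subseteq> B \<longrightarrow> B \<subseteq> carrier G \<longrightarrow> refutes B F P)" ..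
  from ref[OF F Ps eq] obtain B4 where B4': "finite B4 \<and> B4 \<subseteq> carrier G \<and>
    (\<forall>P\<in>F. \<forall>B. finite B \<longrightarrow> B4 \<subseteq> B \<longrightarrow> B \<subseteq> carrier G \<longrightarrow> refutes B Ps P)" ..
  from uniformly_extendable[OF Ps N[OF Ps] fit ext] obtain B5 where B5': "finite B5 \<and> B5 \<subseteq> carrier G \<and>
    (\<forall>T. grazing_tuple T \<longrightarrow>
      (\<forall>B. B5 \<subseteq> B \<longrightarrow> B \<subseteq> carrier G \<longrightarrow> one_step_extendable B Ps (layers 0 T)))" ..
  note B3 = conjunct1[OF B3'] conjunct1[OF conjunct2[OF B3']] conjunct2[OF conjunct2[OF B3'], rule_format]
  note B4 = conjunct1[OF B4'] conjunct1[OF conjunct2[OF B4']] conjunct2[OF conjunct2[OF B4'], rule_format]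
  note B5 = conjunct1[OF B5'] conjunct1[OF conjunct2[OF B5']] conjunct2[OF conjunct2[OF B5'], rule_format]
  let ?B0 = "insert \<one> (N Ps \<union> B3 \<union> B4 \<union> B5)"
  have "finite ?B0" "?B0 \<subseteq> carrier G" using N[OF Ps] B3(1,2) B4(1,2) B5(1,2) by auto
  moreover have "certificate F Ps B" if B: "finite B" "?B0 \<subseteq> B" "B \<subseteq> carrier G" for B
    unfolding certificate_def
  proof (intro conjI ballI allI impI based)
    show "\<one> \<in> B" using B(2) by blast
    show "fits B Ps" by (rule fits_mono[OF fit]) (use B(2) in blast)
    show "refutes B F P" if "P \<in> Ps" for P by (rule B3(3)[OF that B(1) _ B(3)]) (use B(2) in blast)
    show "refutes B Ps P" if "P \<in> F" for P by (rule B4(3)[OF that B(1) _ B(3)]) (use B(2) in blast)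
    show "one_step_extendable B Ps (layers 0 T)" if "grazing_tuple T" for T
      by (rule B5(3)[OF that _ B(3)]) (use B(2) in blast)
  qed
  ultimately show ?thesis using Ps by (intro exI[of _ Ps] exI[of _ ?B0]) simp
qed

end

section \<open>The group multiplication on codes is computable\<close>

text \<open>
  Reading a list code at a fixed index. The code of a nonempty list is the successor of a pair code, hence the
  subtraction; beyond the end of the list the value is 0.
\<close>

definition entry :: "nat \<Rightarrow> nat \<Rightarrow> nat" where
  "entry l c = pfst (((\<lambda>c. psnd (c - 1)) ^^ l) c - 1)"

lemma comp_entry: "computable f \<Longrightarrow> computable (\<lambda>x. entry l (f x))"
proof -
  assume f: "computable f"
  have "computable (\<lambda>x. ((\<lambda>c. psnd (c - 1)) ^^ l) (f x))"
    by (induction l) (simp_all add: f comp_psnd comp_diff comp_const)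
  then show ?thesis unfolding entry_def by (intro comp_pfst comp_diff comp_const)
qed

lemma entry_list_encode: "l < length xs \<Longrightarrow> entry l (list_encode xs) = xs ! l"
proof -
  assume l: "l < length xs"
  have "((\<lambda>c. psnd (c - 1)) ^^ l) (list_encode xs) = list_encode (drop l xs)" for l
  proof (induction l)
    case (Suc l)
    have "prod_encode (0, 0) = 0" by (simp add: prod_encode_def)
    then have 0: "prod_decode 0 = (0, 0)" using prod_encode_inverse[of "(0, 0)"] by simp
    have "psnd (list_encode ys - 1) = list_encode (tl ys)" for ys
      by (cases ys) (simp_all add: 0)
    then show ?case using Suc by (simp add: drop_Suc drop_tl)
  qed simp
  moreover have "drop l xs = xs ! l # drop (Suc l) xs" using l by (simp add: Cons_nth_drop_Suc)
  ultimately show ?thesis unfolding entry_def by simp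
qed

lemma comp_list_encode_map:
  "(\<And>l. computable (f l)) \<Longrightarrow> computable (\<lambda>x. list_encode (map (\<lambda>l. f l x) ls))"
proof (induction ls)
  case (Cons l ls)
  have "computable (\<lambda>x. Suc (prod_encode (f l x, list_encode (map (\<lambda>l. f l x) ls))))"
    by (intro comp_Suc comp_pair Cons)
  then show ?case by simp
qed (simp add: comp_const)

lemma prod_encode_mono: "a \<le> a' \<Longrightarrow> b \<le> b' \<Longrightarrow> prod_encode (a, b) \<le> prod_encode (a', b')"
  unfolding prod_encode_def using triangle_mono[of "a + b" "a' + b'"] by simp

lemma list_encode_map_mono:
  "(\<And>l. l \<in> set ls \<Longrightarrow> f l \<le> g l) \<Longrightarrow> list_encode (map f ls) \<le> list_encode (map g ls)"
  by (induction ls) (simp_all add: prod_encode_mono)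

lemma dec_Ball_set: "(\<And>l. decidable (Q l)) \<Longrightarrow> decidable (\<lambda>x. \<forall>l\<in>set ls. Q l x)"
proof (induction ls)
  case Nil
  then show ?case using dec_const[of True] by simp
next
  case (Cons l ls)
  then have "decidable (\<lambda>x. Q l x \<and> (\<forall>l\<in>set ls. Q l x))" by (intro dec_conj) auto
  then show ?case by simp
qed

lemma dec_all_fixed: "(\<And>l. decidable (Q l)) \<Longrightarrow> decidable (\<lambda>x. \<forall>l<m::nat. Q l x)"
  using dec_Ball_set[of Q "[0..<m]"] by (simp add: Ball_def)

lemma dec_ex_fixed: 
  assumes "\<And>l. decidable (Q l)" shows "decidable (\<lambda>x. \<exists>l<m::nat. Q l x)"
proof -
  have "decidable (\<lambda>x. \<not> (\<forall>l<m. \<not> Q l x))" by (intro dec_not dec_all_fixed assms)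
  then show ?thesis by simp
qed

lemma int_encode_cases:
  obtains (nonneg) a where "t = int a" "int_encode t = 2 * a"
  | (neg) b where "t = - int (Suc b)" "int_encode t = Suc (2 * b)"
proof (cases "t \<ge> 0")
  case True
  then show thesis using nonneg[of "nat t"] by (simp add: int_encode_def sum_encode_def)
next
  case False
  then show thesis using neg[of "nat (- t - 1)"] by (simp add: int_encode_def sum_encode_def)
qed

lemma int_encode_0: "int_encode 0 = 0" by (simp add: int_encode_def sum_encode_def)

lemma int_encode_eq_0: "int_encode t = 0 \<longleftrightarrow> t = 0"
  using int_encode_eq[of t 0] by (simp add: int_encode_0)

lemma int_encode_nonneg: "int_encode (int a) = 2 * a" by (simp add: int_encode_def sum_encode_def)

text \<open>
  In the integer coding nonnegative numbers have even and negative numbers odd codes. Crossing between -1 and 0 is the special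
  case.
\<close>

lemma comp_int_inc: "computable (\<lambda>v. int_encode (int_decode v + 1))"
proof -
  have "computable (\<lambda>v. if even v then v + 2 else if v = 1 then 0 else v - 2)"
    by (intro comp_if dec_even dec_eq comp_add comp_diff comp_const comp_id)
  moreover have "int_encode (int_decode v + 1) = (if even v then v + 2 else if v = 1 then 0 else v - 2)" for v
  proof (cases "int_decode v" rule: int_encode_cases)
    case (nonneg a)
    have v: "v = 2 * a" using nonneg(2) by simp
    have "int_decode v + 1 = int (Suc a)" using nonneg(1) by simp
    then have "int_encode (int_decode v + 1) = 2 * Suc a" by (simp only: int_encode_nonneg)
    then show ?thesis using v by simp
  next
    case (neg b)
    have v: "v = Suc (2 * b)" using neg(2) by simp
    show ?thesis
    proof (cases b)
      case 0
      then show ?thesis using neg(1) v by (simp add: int_encode_0)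
    next
      case (Suc c)
      then have "int_decode v + 1 = - int (Suc c)" using neg(1) by simp
      moreover have "int_encode (- int (Suc c)) = Suc (2 * c)" by (simp add: int_encode_def sum_encode_def)
      ultimately have "int_encode (int_decode v + 1) = Suc (2 * c)" by (simp only:)
      moreover have "(if even v then v + 2 else if v = 1 then 0 else v - 2) = Suc (2 * c)"
        using v Suc by simp
      ultimately show ?thesis by (simp only:)
    qed
  qed
  ultimately show ?thesis by simp
qed

lemma comp_int_dec: "computable (\<lambda>v. int_encode (int_decode v + - 1))"
proof -
  have "computable (\<lambda>v. if v = 0 then 1 else if even v then v - 2 else v + 2)"
    by (intro comp_if dec_even dec_eq comp_add comp_diff comp_const comp_id)
  moreover have "int_encode (int_decode v + - 1) = (if v = 0 then 1 else if even v then v - 2 else v + 2)" for v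
  proof (cases "int_decode v" rule: int_encode_cases)
    case (nonneg a)
    have v: "v = 2 * a" using nonneg(2) by simp
    show ?thesis
    proof (cases a)
      case 0
      then show ?thesis using nonneg(1) v by (simp add: int_encode_def sum_encode_def)
    next
      case (Suc c)
      then have "int_decode v + - 1 = int c" using nonneg(1) by simp
      then show ?thesis using v Suc by (simp add: int_encode_nonneg)
    qed
  next
    case (neg b)
    have v: "v = Suc (2 * b)" using neg(2) by simp
    have "int_decode v + - 1 = - int (Suc (Suc b))" using neg(1) by simp
    moreover have "int_encode (- int (Suc (Suc b))) = Suc (2 * Suc b)" by (simp add: int_encode_def sum_encode_def)
    ultimately have "int_encode (int_decode v + - 1) = Suc (2 * Suc b)" by (simp only:)
    moreover have "(if v = 0 then 1 else if even v then v - 2 else v + 2) = Suc (2 * Suc b)"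
      using v by simp
    ultimately show ?thesis by (simp only:)
  qed
  ultimately show ?thesis by simp
qed

text \<open>
  The integer with code \<open>b x\<close> says how often to iterate: \<open>f\<close> if it is nonnegative, and \<open>g\<close>, in the application the inverse of \<open>f\<close>,
  if it is negative.
\<close>

lemma comp_iterate_int:
  assumes "computable f" "computable g" "computable a" "computable b"
  shows "computable (\<lambda>x. if even (b x) then (f ^^ (b x div 2)) (a x) else (g ^^ (Suc (b x) div 2)) (a x))"
proof -
  have "computable (\<lambda>x. ((\<lambda>y. f y) ^^ (b x div 2)) (a x))" 
    by (intro comp_funpow comp_div2 assms comp_compose[OF assms(1) comp_psnd[OF comp_id]])
  moreover have "computable (\<lambda>x. ((\<lambda>y. g y) ^^ (Suc (b x) div 2)) (a x))"
    by (intro comp_funpow comp_div2 comp_Suc assms comp_compose[OF assms(2) comp_psnd[OF comp_id]])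
  ultimately show ?thesis by (intro comp_if dec_even assms)
qed

context polycyclic
begin

definition normal_exponents :: "(nat \<Rightarrow> int) \<Rightarrow> bool" where
  "normal_exponents t \<longleftrightarrow> (\<forall>l<n. k (Suc l) = 0 \<or> t (Suc l) \<in> {0..<int (k (Suc l))})"

abbreviation elt :: "(nat \<Rightarrow> int) \<Rightarrow> nat \<Rightarrow> 'a" where "elt \<equiv> polycyclic_prod G h"

lemma polycyclic_prod_in_H:
  assumes "i \<le> n" "\<And>l. l < m \<Longrightarrow> e (Suc l) \<in> H i"
  shows "polycyclic_prod G e t m \<in> H i"
  using assms(2)
proof (induction m)
  case 0
  then show ?case using H_one[OF assms(1)] by simp
next
  case (Suc m)
  have "e (Suc m) [^] t (Suc m) \<in> H i"
    using subgroup_int_pow_closed[OF H_subgroup[OF assms(1)]] Suc.prems by simp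
  then show ?case using Suc by (simp add: H_mult[OF assms(1)])
qed

lemma h_in_H: "l < i \<Longrightarrow> i \<le> n \<Longrightarrow> h (Suc l) \<in> H i"
  using h_in[of l] H_mono[of "Suc l" i] by auto

lemma elt_in_H: "i \<le> n \<Longrightarrow> elt t i \<in> H i"
  by (rule polycyclic_prod_in_H) (auto intro: h_in_H)

lemma elt_cong: "(\<And>l. l < i \<Longrightarrow> t (Suc l) = t' (Suc l)) \<Longrightarrow> polycyclic_prod G e t i = polycyclic_prod G e t' i"
  by (induction i) simp_all

lemma elt_extend: "i \<le> m \<Longrightarrow> m \<le> n \<Longrightarrow> (\<And>l. i \<le> l \<Longrightarrow> l < m \<Longrightarrow> t (Suc l) = 0) \<Longrightarrow> elt t m = elt t i"
proof (induction m rule: dec_induct)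
  case (step m)
  then have "elt t m = elt t i" by simp
  moreover have "elt t i \<in> carrier G" using elt_in_H[of i t] H_carrier[of i] step by simp
  ultimately show ?case using step by simp
qed simp

text \<open>
  Normal form: peel off the power of the top generator, and move the part of its exponent that is a multiple of \<open>k\<close> into
  the lower subgroup.
\<close>

lemma elt_exists:
  "i \<le> n \<Longrightarrow> g \<in> H i \<Longrightarrow> \<exists>t. normal_exponents t \<and> (\<forall>l\<ge>i. t (Suc l) = 0) \<and> g = elt t i"
proof (induction i arbitrary: g)
  case 0
  then show ?case using H_0 by (intro exI[of _ "\<lambda>_. 0"]) (auto simp: normal_exponents_def)
next
  case (Suc i)
  then have i: "i < n" by simp
  let ?k = "int (k (Suc i))"
  obtain s :: int and u where su: "u \<in> H i" "g = h (Suc i) [^] s \<otimes> u"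
    using h_generates[OF i Suc.prems(2)] by blast
  have uc: "u \<in> carrier G" using su H_carrier[of i] i by simp
  let ?s = "s mod ?k"
  have q: "h (Suc i) [^] (s - ?s) \<in> H i" unfolding h_pow_iff[OF i] by simp
  then have "h (Suc i) [^] (s - ?s) \<otimes> u \<in> H i" using su i by (intro H_mult) auto
  then obtain t where t: "normal_exponents t" "\<forall>l\<ge>i. t (Suc l) = 0" "h (Suc i) [^] (s - ?s) \<otimes> u = elt t i"
    using Suc.IH i by force
  let ?t = "t(Suc i := ?s)"
  have "elt ?t i = elt t i" by (rule elt_cong) simp
  then have "elt ?t (Suc i) = h (Suc i) [^] ?s \<otimes> (h (Suc i) [^] (s - ?s) \<otimes> u)" using t(3) by simp
  also have "\<dots> = g" unfolding su(2) using i uc by (simp add: m_assoc[symmetric] int_pow_mult[symmetric])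
  finally have "g = elt ?t (Suc i)" ..
  moreover have "normal_exponents ?t" using t(1) by (auto simp: normal_exponents_def)
  moreover have "\<forall>l\<ge>Suc i. ?t (Suc l) = 0" using t(2) by simp
  ultimately show ?case by (intro exI[of _ ?t] conjI)
qed

lemma elt_unique:
  assumes "normal_exponents t" "normal_exponents t'"
  shows "i \<le> n \<Longrightarrow> elt t i = elt t' i \<Longrightarrow> l < i \<Longrightarrow> t (Suc l) = t' (Suc l)"
proof (induction i)
  case (Suc i)
  then have i: "i < n" by simp
  let ?x = "h (Suc i)"
  have eq: "?x [^] t (Suc i) \<otimes> elt t i = ?x [^] t' (Suc i) \<otimes> elt t' i" using Suc.prems by simp
  have dvd: "int (k (Suc i)) dvd t (Suc i) - t' (Suc i)"
    by (rule h_pow_mult_eqD[OF i elt_in_H elt_in_H eq]) (use i in auto)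
  have top: "t (Suc i) = t' (Suc i)"
  proof (cases "k (Suc i) = 0")
    case False
    then have "t (Suc i) \<in> {0..<int (k (Suc i))}" "t' (Suc i) \<in> {0..<int (k (Suc i))}"
      using assms i unfolding normal_exponents_def by auto
    then have "t (Suc i) mod int (k (Suc i)) = t (Suc i)" "t' (Suc i) mod int (k (Suc i)) = t' (Suc i)" by auto
    then show ?thesis using dvd by (metis mod_eq_dvd_iff)
  qed (use dvd in simp)
  have "elt t i = elt t' i"
    using eq unfolding top using i elt_in_H[of i] H_carrier[of i] by simp
  then show ?case using Suc top by (cases "l = i") auto
qed simp

text \<open>
  Index \<open>l\<close> of the vector belongs to the exponent of \<open>h (Suc l)\<close>.
\<close>

definition vcode :: "(nat \<Rightarrow> nat) \<Rightarrow> nat" where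
  "vcode v = list_encode (map v [0..<n])"

lemma entry_vcode [simp]: "l < n \<Longrightarrow> entry l (vcode v) = v l"
  unfolding vcode_def by (simp add: entry_list_encode)

lemma vcode_cong: "(\<And>l. l < n \<Longrightarrow> v l = w l) \<Longrightarrow> vcode v = vcode w"
  unfolding vcode_def by (intro arg_cong[of _ _ list_encode] map_cong) auto

lemma comp_vcode: "(\<And>l. computable (f l)) \<Longrightarrow> computable (\<lambda>x. vcode (\<lambda>l. f l x))"
  unfolding vcode_def by (rule comp_list_encode_map)

abbreviation code :: "'a \<Rightarrow> nat" where "code \<equiv> elem_code G n h k"

lemma code_elt:
  assumes t: "normal_exponents t"
  shows "code (elt t n) = vcode (\<lambda>l. int_encode (t (Suc l)))"
proof -
  have iff: "(\<forall>i\<in>{1..n}. k i = 0 \<or> t i \<in> {0..<int (k i)}) \<longleftrightarrow> normal_exponents t" for t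
  proof
    assume a: "normal_exponents t"
    show "\<forall>i\<in>{1..n}. k i = 0 \<or> t i \<in> {0..<int (k i)}"
    proof
      fix i assume "i \<in> {1..n}"
      then have "i - 1 < n" "Suc (i - 1) = i" by auto
      then show "k i = 0 \<or> t i \<in> {0..<int (k i)}" using a unfolding normal_exponents_def by metis
    qed
  qed (auto simp: normal_exponents_def)
  have upt: "[1..<Suc n] = map Suc [0..<n]" by (simp add: map_Suc_upt)
  have "(THE ts. exponents_of G n h k (elt t n) ts) = map t [1..<Suc n]"
  proof (rule the_equality)
    show "exponents_of G n h k (elt t n) (map t [1..<Suc n])"
      unfolding exponents_of_def using t iff by blast
    fix ts assume "exponents_of G n h k (elt t n) ts"
    then obtain t' where t': "normal_exponents t'" "ts = map t' [1..<Suc n]" "elt t n = elt t' n"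
      unfolding exponents_of_def iff by blast
    have "t' (Suc l) = t (Suc l)" if "l < n" for l
      using elt_unique[OF t t'(1) _ t'(3) that] by simp
    then show "ts = map t [1..<Suc n]" unfolding t'(2) upt by simp
  qed
  then show ?thesis unfolding elem_code_def vcode_def upt by (simp add: comp_def)
qed

lemma elt_of_H:
  assumes "i \<le> n" "g \<in> H i"
  obtains t where "normal_exponents t" "\<And>l. i \<le> l \<Longrightarrow> t (Suc l) = 0" "g = elt t i"
    "code g = vcode (\<lambda>l. int_encode (t (Suc l)))"
proof -
  obtain t where t: "normal_exponents t" "\<forall>l\<ge>i. t (Suc l) = 0" "g = elt t i"
    using elt_exists[OF assms] by blast
  have "g = elt t n" using elt_extend[OF assms(1) le_refl] t by simp
  then show thesis using that[OF t(1) _ t(3)] t(2) code_elt[OF t(1)] by simp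
qed

lemma code_inj:
  assumes "g \<in> carrier G" "g' \<in> carrier G" "code g = code g'"
  shows "g = g'"
proof -
  obtain t where t: "normal_exponents t" "g = elt t n" "code g = vcode (\<lambda>l. int_encode (t (Suc l)))"
    using elt_of_H[of n g] assms(1) H_n by auto
  obtain t' where t': "normal_exponents t'" "g' = elt t' n" "code g' = vcode (\<lambda>l. int_encode (t' (Suc l)))"
    using elt_of_H[of n g'] assms(2) H_n by auto
  have "t (Suc l) = t' (Suc l)" if "l < n" for l
  proof -
    have "entry l (code g) = entry l (code g')" using assms(3) by simp
    then show ?thesis using that unfolding t(3) t'(3) by (simp add: int_encode_eq)
  qed
  then show ?thesis unfolding t(2) t'(2) by (rule elt_cong)
qed

lemma code_top:
  assumes i: "i < n" and w: "w \<in> H i" and s: "k (Suc i) = 0 \<or> s \<in> {0..<int (k (Suc i))}"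
  shows "code (h (Suc i) [^] s \<otimes> w) = vcode (\<lambda>l. if l = i then int_encode s else entry l (code w))"
proof -
  obtain t where t: "normal_exponents t" "\<And>l. i \<le> l \<Longrightarrow> t (Suc l) = 0" "w = elt t i"
    "code w = vcode (\<lambda>l. int_encode (t (Suc l)))"
    using elt_of_H[of i w] w i by auto
  let ?t = "t(Suc i := s)"
  have norm: "normal_exponents ?t" using t(1) s by (auto simp: normal_exponents_def)
  have "elt ?t i = elt t i" by (rule elt_cong) simp
  then have "elt ?t (Suc i) = h (Suc i) [^] s \<otimes> w" using t(3) by simp
  moreover have "elt ?t n = elt ?t (Suc i)" by (rule elt_extend) (use i t(2) in auto)
  ultimately have "code (h (Suc i) [^] s \<otimes> w) = vcode (\<lambda>l. int_encode (?t (Suc l)))"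
    using code_elt[OF norm] by simp
  also have "\<dots> = vcode (\<lambda>l. if l = i then int_encode s else entry l (code w))"
    by (rule vcode_cong) (simp add: t(4))
  finally show ?thesis .
qed

text \<open>
  Codes allow splitting off the top exponent: the remaining factor is coded by the same vector with a zero at the top.
\<close>

lemma split_top:
  assumes i: "i < n" and a: "a \<in> H (Suc i)"
  obtains s t where "a = h (Suc i) [^] s \<otimes> elt t i" "k (Suc i) = 0 \<or> s \<in> {0..<int (k (Suc i))}"
    "entry i (code a) = int_encode s" "\<And>l. l < i \<Longrightarrow> entry l (code a) = int_encode (t (Suc l))"
    "code (elt t i) = vcode (\<lambda>l. if l = i then 0 else entry l (code a))"
proof -
  obtain t where t: "normal_exponents t" "\<And>l. Suc i \<le> l \<Longrightarrow> t (Suc l) = 0" "a = elt t (Suc i)"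
    "code a = vcode (\<lambda>l. int_encode (t (Suc l)))"
    using elt_of_H[of "Suc i" a] a i by auto
  have "k (Suc i) = 0 \<or> t (Suc i) \<in> {0..<int (k (Suc i))}" using t(1) i by (auto simp: normal_exponents_def)
  moreover have "code (elt t i) = vcode (\<lambda>l. if l = i then 0 else entry l (code a))"
  proof -
    let ?t = "t(Suc i := 0)"
    have "elt ?t n = elt ?t i" by (rule elt_extend) (use i t(2) in auto)
    moreover have "elt ?t i = elt t i" by (rule elt_cong) simp
    moreover have "normal_exponents ?t" using t(1) by (auto simp: normal_exponents_def)
    ultimately have "code (elt t i) = vcode (\<lambda>l. int_encode (?t (Suc l)))" using code_elt by metis
    also have "\<dots> = vcode (\<lambda>l. if l = i then 0 else entry l (code a))"
      by (rule vcode_cong) (simp add: t(4) int_encode_0)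
    finally show ?thesis .
  qed
  moreover have "entry l (code a) = int_encode (t (Suc l))" if "l < n" for l
    unfolding t(4) using that by simp
  moreover have "a = h (Suc i) [^] t (Suc i) \<otimes> elt t i" using t(3) by simp
  ultimately show thesis using i by (intro that[of "t (Suc i)" t]) simp_all
qed

text \<open>
  Computability of right multiplication by one fixed element, which is established for all elements of \<open>H i\<close> by induction on \<open>i\<close>.
\<close>

definition right_mult_computable :: "nat \<Rightarrow> 'a \<Rightarrow> bool" where
  "right_mult_computable i g \<longleftrightarrow> g \<in> H i \<and> (\<exists>f. computable f \<and> (\<forall>a\<in>H i. f (code a) = code (a \<otimes> g)))"

lemma right_mult_computable_mult:
  assumes i: "i \<le> n" and g: "right_mult_computable i g" and g': "right_mult_computable i g'"
  shows "right_mult_computable i (g \<otimes> g')"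
proof -
  obtain f where f: "g \<in> H i" "computable f" "\<And>a. a \<in> H i \<Longrightarrow> f (code a) = code (a \<otimes> g)"
    using g unfolding right_mult_computable_def by blast
  obtain f' where f': "g' \<in> H i" "computable f'" "\<And>a. a \<in> H i \<Longrightarrow> f' (code a) = code (a \<otimes> g')"
    using g' unfolding right_mult_computable_def by blast
  have "f' (f (code a)) = code (a \<otimes> (g \<otimes> g'))" if "a \<in> H i" for a
    using f(3)[OF that] f'(3)[OF H_mult[OF i that f(1)]] f(1) f'(1) that H_carrier[OF i] by (simp add: m_assoc)
  then show ?thesis unfolding right_mult_computable_def
    using H_mult[OF i f(1) f'(1)] comp_compose[OF f'(2) f(2)] by blast
qed

lemma right_mult_computable_one: "i \<le> n \<Longrightarrow> right_mult_computable i \<one>"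
  unfolding right_mult_computable_def using H_one H_carrier comp_id
  by (intro conjI exI[of _ "\<lambda>x. x"]) auto

lemma right_mult_computable_funpow:
  assumes "i \<le> n" "e \<in> H i" "a \<in> H i" "\<And>a. a \<in> H i \<Longrightarrow> f (code a) = code (a \<otimes> e)"
  shows "(f ^^ m) (code a) = code (a \<otimes> e [^] m)"
proof (induction m)
  case 0
  then show ?case using assms H_carrier[OF assms(1)] by simp
next
  case (Suc m)
  have ec: "e \<in> carrier G" "a \<in> carrier G" using assms H_carrier by auto
  have "e [^] (int m) \<in> H i" using subgroup_int_pow_closed[OF H_subgroup[OF assms(1)] assms(2)] .
  then have "a \<otimes> e [^] m \<in> H i" using H_mult[OF assms(1,3)] by (simp add: int_pow_int)
  from assms(4)[OF this] show ?case using Suc ec by (simp add: m_assoc)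
qed

text \<open>
  Right multiplication by a product of powers of fixed elements, whose exponents are part of the input, is an iteration
  of the multiplications by these elements and their inverses.
\<close>

lemma comp_polycyclic_prod:
  assumes i: "i \<le> n"
    and e: "\<And>l. l < m \<Longrightarrow> right_mult_computable i (e (Suc l)) \<and> right_mult_computable i (inv e (Suc l))"
  shows "\<exists>F. computable F \<and> (\<forall>a\<in>H i. \<forall>t c. (\<forall>l<m. entry l c = int_encode (t (Suc l))) \<longrightarrow>
    F (prod_encode (code a, c)) = code (a \<otimes> polycyclic_prod G e t m))"
  using e
proof (induction m)
  case 0
  have "\<forall>a\<in>H i. \<forall>t c. pfst (prod_encode (code a, c)) = code (a \<otimes> polycyclic_prod G e t 0)"
    using H_carrier[OF i] by simp
  then show ?case using comp_pfst[OF comp_id] by blast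
next
  case (Suc m)
  then obtain F where F: "computable F" "\<And>a t c. a \<in> H i \<Longrightarrow> \<forall>l<m. entry l c = int_encode (t (Suc l)) \<Longrightarrow>
    F (prod_encode (code a, c)) = code (a \<otimes> polycyclic_prod G e t m)" by force
  let ?e = "e (Suc m)"
  obtain f g where f: "computable f" "\<And>a. a \<in> H i \<Longrightarrow> f (code a) = code (a \<otimes> ?e)"
    and g: "computable g" "\<And>a. a \<in> H i \<Longrightarrow> g (code a) = code (a \<otimes> inv ?e)" and eH: "?e \<in> H i"
    using Suc.prems[of m] unfolding right_mult_computable_def by auto
  have ec: "?e \<in> carrier G" using H_carrier[OF i eH] .
  define F' where "F' x = F (prod_encode
      (if even (entry m (psnd x)) then (f ^^ (entry m (psnd x) div 2)) (pfst x)
       else (g ^^ (Suc (entry m (psnd x)) div 2)) (pfst x), psnd x))" for x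
  have "computable F'" unfolding F'_def
    by (intro comp_compose[OF F(1)] comp_pair comp_iterate_int f(1) g(1) comp_entry comp_pfst comp_psnd comp_id)
  moreover have "F' (prod_encode (code a, c)) = code (a \<otimes> polycyclic_prod G e t (Suc m))"
    if a: "a \<in> H i" and c: "\<forall>l<Suc m. entry l c = int_encode (t (Suc l))" for a t c
  proof -
    have cm: "entry m c = int_encode (t (Suc m))" using c by simp
    have iter: "(if even (entry m c) then (f ^^ (entry m c div 2)) (code a)
       else (g ^^ (Suc (entry m c) div 2)) (code a)) = code (a \<otimes> ?e [^] t (Suc m))"
    proof (cases "t (Suc m)" rule: int_encode_cases)
      case (nonneg p)
      then show ?thesis unfolding cm
        using right_mult_computable_funpow[OF i eH a f(2), of p] by (simp add: int_pow_int)
    next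
      case (neg p)
      have "?e [^] t (Suc m) = inv ?e [^] Suc p"
        unfolding neg(1) using int_pow_neg_int[OF ec, of "Suc p"] nat_pow_inv[OF ec, of "Suc p"] by simp
      then show ?thesis unfolding cm neg(2)
        using right_mult_computable_funpow[OF i H_inv[OF i eH] a g(2), of "Suc p"] by simp
    qed
    have eH': "?e [^] t (Suc m) \<in> H i" using subgroup_int_pow_closed[OF H_subgroup[OF i] eH] .
    have "F (prod_encode (code (a \<otimes> ?e [^] t (Suc m)), c)) = code (a \<otimes> ?e [^] t (Suc m) \<otimes> polycyclic_prod G e t m)"
      using F(2)[OF H_mult[OF i a eH'], of c t] c by simp
    moreover have "polycyclic_prod G e t m \<in> H i"
      by (rule polycyclic_prod_in_H[OF i]) (use Suc.prems in \<open>auto simp: right_mult_computable_def\<close>)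
    then have "a \<otimes> ?e [^] t (Suc m) \<otimes> polycyclic_prod G e t m = a \<otimes> polycyclic_prod G e t (Suc m)"
      using a ec H_carrier[OF i] by (simp add: m_assoc)
    ultimately have "F (prod_encode (code (a \<otimes> ?e [^] t (Suc m)), c)) = code (a \<otimes> polycyclic_prod G e t (Suc m))"
      by simp
    then show ?thesis unfolding F'_def prod_encode_inverse fst_conv snd_conv iter .
  qed
  ultimately show ?case by (intro exI[of _ F'] conjI ballI allI impI)
qed

lemma conj_polycyclic_prod:
  assumes y: "y \<in> carrier G" and e: "\<And>l. l < m \<Longrightarrow> e (Suc l) \<in> carrier G"
  shows "inv y \<otimes> polycyclic_prod G e t m \<otimes> y = polycyclic_prod G (\<lambda>j. inv y \<otimes> e j \<otimes> y) t m"
  using e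
proof (induction m)
  case 0
  then show ?case using y by simp
next
  case (Suc m)
  have hom: "(\<lambda>x. inv y \<otimes> x \<otimes> y) \<in> hom G G"
  proof (rule homI)
    fix a b assume ab: "a \<in> carrier G" "b \<in> carrier G"
    have "inv y \<otimes> a \<otimes> y \<otimes> (inv y \<otimes> b \<otimes> y) = inv y \<otimes> a \<otimes> (y \<otimes> inv y) \<otimes> b \<otimes> y"
      using ab y by (simp only: m_assoc m_closed inv_closed)
    then show "inv y \<otimes> (a \<otimes> b) \<otimes> y = inv y \<otimes> a \<otimes> y \<otimes> (inv y \<otimes> b \<otimes> y)"
      using ab y by (simp add: m_assoc)
  qed (use y in simp)
  let ?x = "e (Suc m) [^] t (Suc m)" and ?p = "polycyclic_prod G e t m"
  have x: "?x \<in> carrier G" using Suc.prems by simp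
  have p: "?p \<in> carrier G"
    using polycyclic_prod_in_H[of n m e t] Suc.prems H_n by simp
  have "inv y \<otimes> (?x \<otimes> ?p) \<otimes> y = (inv y \<otimes> ?x \<otimes> y) \<otimes> (inv y \<otimes> ?p \<otimes> y)"
    by (rule hom_mult[OF hom x p])
  moreover have "inv y \<otimes> ?x \<otimes> y = (inv y \<otimes> e (Suc m) \<otimes> y) [^] t (Suc m)"
    using hom_int_pow[OF hom _ is_group is_group, of "e (Suc m)"] Suc.prems by simp
  ultimately show ?case using Suc by simp
qed

text \<open>
  For \<open>a = x\<^sup>s u\<close> with \<open>u \<in> H i\<close> and a generator \<open>y = x\<^sup>\<epsilon>\<close> one has \<open>a y = x\<^sup>s y (y\<^sup>-\<^sup>1 u y)\<close>. The conjugate of \<open>u\<close> is the product of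
  powers of the conjugated generators, with the exponents of \<open>u\<close>, and the conjugated generators are fixed elements of \<open>H i\<close>. So it can be computed by
  multiplications in \<open>H i\<close>. What remains is the change of the top exponent by \<open>\<epsilon>\<close>.
\<close>

lemma right_mult_generator:
  assumes i: "i < n" and all: "\<And>g. g \<in> H i \<Longrightarrow> right_mult_computable i g"
    and eps: "\<epsilon> = 1 \<or> \<epsilon> = - 1"
  shows "right_mult_computable (Suc i) (h (Suc i) [^] (\<epsilon>::int))"
proof -
  let ?x = "h (Suc i)" and ?k = "int (k (Suc i))"
  let ?y = "?x [^] \<epsilon>"
  let ?e = "\<lambda>j. inv ?y \<otimes> h j \<otimes> ?y"
  have y: "?y \<in> H (Suc i)" using h_pow_in[OF i] .
  have yc: "?y \<in> carrier G" using i by simp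
  have i': "i \<le> n" using i by simp
  have eH: "?e (Suc l) \<in> H i" if "l < i" for l
    by (rule H_conj'[OF i y h_in_H[OF that i']])
  obtain F where F: "computable F" "\<And>a t c. a \<in> H i \<Longrightarrow> \<forall>l<i. entry l c = int_encode (t (Suc l)) \<Longrightarrow>
    F (prod_encode (code a, c)) = code (a \<otimes> polycyclic_prod G ?e t i)"
    using comp_polycyclic_prod[OF i', of i ?e] all eH H_inv[OF i'] by force
  \<comment> \<open>If the order \<open>k\<close> is finite, the top exponent leaves \<open>{0..<k}\<close> exactly when it reaches \<open>b\<close>. Then it is reset to \<open>b mod k\<close>,
    and the difference contributes the fixed element \<open>?z\<close> of \<open>H i\<close>.\<close>
  define b where "b = (if \<epsilon> = 1 then ?k else -1)"
  define succ where "succ v = int_encode (int_decode v + \<epsilon>)" for v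
  have succ: "computable succ" unfolding succ_def using eps comp_int_inc comp_int_dec by auto
  let ?z = "?x [^] (b - b mod ?k)"
  have z: "?z \<in> H i" unfolding h_pow_iff[OF i] by simp
  define f where "f c = (if k (Suc i) \<noteq> 0 \<and> succ (entry i c) = int_encode b
    then vcode (\<lambda>l. if l = i then int_encode (b mod ?k) else entry l (F (prod_encode (code ?z, c))))
    else vcode (\<lambda>l. if l = i then succ (entry i c) else entry l (F (prod_encode (code \<one>, c)))))" for c
  have pick: "computable (\<lambda>x. if l = i then p x else q x)" if "computable p" "computable q" for p q l
    using that by (cases "l = i") simp_all
  have "computable f" unfolding f_def
    by (intro comp_if dec_conj dec_const dec_eq comp_vcode pick comp_compose[OF succ] comp_entry
        comp_compose[OF F(1)] comp_pair comp_const comp_id)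
  moreover have "f (code a) = code (a \<otimes> ?y)" if a: "a \<in> H (Suc i)" for a
  proof -
    obtain s t where st: "a = ?x [^] s \<otimes> elt t i" "k (Suc i) = 0 \<or> s \<in> {0..<?k}"
      "entry i (code a) = int_encode s" "\<And>l. l < i \<Longrightarrow> entry l (code a) = int_encode (t (Suc l))"
      "code (elt t i) = vcode (\<lambda>l. if l = i then 0 else entry l (code a))"
      by (rule split_top[OF i a]) blast
    let ?u = "elt t i" and ?p = "polycyclic_prod G ?e t i"
    have uc: "?u \<in> carrier G" using elt_in_H[OF i'] H_carrier[OF i'] by simp
    have p: "?p \<in> H i" by (rule polycyclic_prod_in_H[OF i', of i ?e]) (rule eH)
    have pc: "?p \<in> carrier G" using H_carrier[OF i' p] .
    have conj: "inv ?y \<otimes> ?u \<otimes> ?y = ?p"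
      by (rule conj_polycyclic_prod[OF yc]) (rule H_carrier[OF i' h_in_H[OF _ i']])
    have "a \<otimes> ?y = ?x [^] s \<otimes> ?y \<otimes> (inv ?y \<otimes> ?u \<otimes> ?y)"
    proof -
      have "?x [^] s \<otimes> ?y \<otimes> (inv ?y \<otimes> ?u \<otimes> ?y) = ?x [^] s \<otimes> (?y \<otimes> inv ?y) \<otimes> ?u \<otimes> ?y"
        using yc uc i by (simp only: m_assoc m_closed inv_closed int_pow_closed h_carrier)
      then show ?thesis using st(1) yc uc i by simp
    qed
    then have ay: "a \<otimes> ?y = ?x [^] (s + \<epsilon>) \<otimes> ?p"
      unfolding conj using i by (simp add: int_pow_mult)
    have suc: "succ (entry i (code a)) = int_encode (s + \<epsilon>)" unfolding succ_def st(3) by simp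
    show ?thesis
    proof (cases "k (Suc i) \<noteq> 0 \<and> s + \<epsilon> = b")
      case True
      have "?x [^] b = ?x [^] (b mod ?k) \<otimes> ?z" using i by (simp add: int_pow_mult[symmetric])
      then have ay': "a \<otimes> ?y = ?x [^] (b mod ?k) \<otimes> (?z \<otimes> ?p)"
        unfolding ay using True i pc by (simp add: m_assoc)
      have Fz: "F (prod_encode (code ?z, code a)) = code (?z \<otimes> ?p)"
        using F(2)[OF z, of "code a" t] st(4) by simp
      have top: "code (?x [^] (b mod ?k) \<otimes> (?z \<otimes> ?p)) =
          vcode (\<lambda>l. if l = i then int_encode (b mod ?k) else entry l (code (?z \<otimes> ?p)))"
        by (rule code_top[OF i H_mult[OF i' z p]]) (use True in auto)
      have cond: "(k (Suc i) \<noteq> 0 \<and> int_encode (s + \<epsilon>) = int_encode b) = True" using True by simp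
      show ?thesis unfolding f_def suc Fz cond if_True ay' top ..
    next
      case False
      have one: "F (prod_encode (code \<one>, code a)) = code ?p"
        using F(2)[OF H_one[OF i'], of "code a" t] st(4) pc by simp
      have "k (Suc i) = 0 \<or> s + \<epsilon> \<in> {0..<?k}"
        using False st(2) eps unfolding b_def by auto
      from code_top[OF i p this] have "code (a \<otimes> ?y) = vcode (\<lambda>l. if l = i then int_encode (s + \<epsilon>) else entry l (code ?p))"
        unfolding ay .
      moreover have cond: "(k (Suc i) \<noteq> 0 \<and> int_encode (s + \<epsilon>) = int_encode b) = False"
        using False by (simp add: int_encode_eq)
      ultimately show ?thesis unfolding f_def suc one cond if_False by (simp only:)
    qed
  qed
  ultimately have "\<exists>f. computable f \<and> (\<forall>a\<in>H (Suc i). f (code a) = code (a \<otimes> ?y))"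
    by (intro exI[of _ f] conjI ballI)
  then show ?thesis using y unfolding right_mult_computable_def by simp
qed

text \<open>
  Right multiplication by an element of \<open>H i\<close> leaves the top exponent of an element of \<open>H (Suc i)\<close> unchanged.
\<close>

lemma right_mult_lower:
  assumes i: "i < n" and w: "right_mult_computable i w"
  shows "right_mult_computable (Suc i) w"
proof -
  obtain f where f: "w \<in> H i" "computable f" "\<And>a. a \<in> H i \<Longrightarrow> f (code a) = code (a \<otimes> w)"
    using w unfolding right_mult_computable_def by blast
  define f' where "f' c = vcode (\<lambda>l. if l = i then entry i c else
      entry l (f (vcode (\<lambda>l. if l = i then 0 else entry l c))))" for c
  have pick: "computable (\<lambda>x. if l = i then p x else q x)" if "computable p" "computable q" for p q l
    using that by (cases "l = i") simp_all
  have "computable f'" unfolding f'_def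
    by (intro comp_vcode pick comp_entry comp_compose[OF f(2)] comp_const comp_id)
  moreover have "f' (code a) = code (a \<otimes> w)" if a: "a \<in> H (Suc i)" for a
  proof -
    obtain s t where st: "a = h (Suc i) [^] s \<otimes> elt t i" "k (Suc i) = 0 \<or> s \<in> {0..<int (k (Suc i))}"
      "entry i (code a) = int_encode s" "\<And>l. l < i \<Longrightarrow> entry l (code a) = int_encode (t (Suc l))"
      "code (elt t i) = vcode (\<lambda>l. if l = i then 0 else entry l (code a))"
      by (rule split_top[OF i a]) blast
    have i': "i \<le> n" using i by simp
    note u = elt_in_H[OF i', of t]
    have "a \<otimes> w = h (Suc i) [^] s \<otimes> (elt t i \<otimes> w)"
      unfolding st(1) using i H_carrier[OF i' u] H_carrier[OF i' f(1)] by (simp add: m_assoc)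
    moreover have "code (h (Suc i) [^] s \<otimes> (elt t i \<otimes> w)) =
        vcode (\<lambda>l. if l = i then int_encode s else entry l (code (elt t i \<otimes> w)))"
      by (rule code_top[OF i H_mult[OF i' u f(1)] st(2)])
    ultimately show ?thesis unfolding f'_def st(5)[symmetric] f(3)[OF u] st(3) by simp
  qed
  moreover have "w \<in> H (Suc i)" using f(1) H_mono_Suc[OF i] by blast
  ultimately show ?thesis unfolding right_mult_computable_def by blast
qed

lemma right_mult_computable_all: "i \<le> n \<Longrightarrow> g \<in> H i \<Longrightarrow> right_mult_computable i g"
proof (induction i arbitrary: g)
  case 0
  then show ?case using H_0 right_mult_computable_one by simp
next
  case (Suc i)
  then have i: "i < n" "i \<le> n" by simp_all
  note IH = Suc.IH and Suc_i = Suc.prems(1)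
  let ?x = "h (Suc i)"
  have xc: "?x \<in> carrier G" using i by simp
  obtain t :: int and u where tu: "u \<in> H i" "g = ?x [^] t \<otimes> u" using h_generates[OF i(1) Suc.prems(2)] by blast
  have pow: "right_mult_computable (Suc i) ((?x [^] \<epsilon>) [^] (m::nat))" if "\<epsilon> = 1 \<or> \<epsilon> = - 1" for \<epsilon> :: int and m
  proof (induction m)
    case 0
    then show ?case using right_mult_computable_one[OF Suc.prems(1)] by simp
  next
    case (Suc m)
    have gen: "right_mult_computable (Suc i) (?x [^] \<epsilon>)"
      by (rule right_mult_generator[OF i(1) IH[OF i(2)] that])
    show ?case using right_mult_computable_mult[OF Suc_i Suc.IH gen] by simp
  qed
  have "right_mult_computable (Suc i) (?x [^] t)"
  proof (cases "t \<ge> 0")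
    case True
    then have "?x [^] t = (?x [^] (1::int)) [^] nat t" using pow_nat[OF True, where x = ?x and G = G] xc by simp
    then show ?thesis using pow by simp
  next
    case False
    then have "?x [^] t = (?x [^] (- 1::int)) [^] nat (- t)"
      using int_pow_def2[of G ?x t] nat_pow_inv[OF xc] int_pow_neg[OF xc, of 1] xc by simp
    then show ?thesis using pow by simp
  qed
  then show ?case unfolding tu(2)
    using right_mult_computable_mult[OF Suc.prems(1) _ right_mult_lower[OF i(1) Suc.IH[OF i(2) tu(1)]]] by blast
qed

text \<open>
  Right multiplication by the generators and their inverses is computable, and the exponents of the second factor say
  how often to apply it.
\<close>

theorem multiplication_computable:
  "\<exists>M. computable M \<and> (\<forall>a\<in>carrier G. \<forall>b\<in>carrier G. M (prod_encode (code a, code b)) = code (a \<otimes> b))"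
proof -
  have "right_mult_computable n (h (Suc l)) \<and> right_mult_computable n (inv h (Suc l))" if "l < n" for l
    using right_mult_computable_all[of n] h_in_H[OF that le_refl] H_inv[of n] by simp
  from comp_polycyclic_prod[OF le_refl[of n], of n h, OF this] obtain F where F: "computable F"
    "\<forall>a\<in>H n. \<forall>t c. (\<forall>l<n. entry l c = int_encode (t (Suc l))) \<longrightarrow> F (prod_encode (code a, c)) = code (a \<otimes> elt t n)"
    by blast
  have "F (prod_encode (code a, code b)) = code (a \<otimes> b)" if a: "a \<in> carrier G" and b: "b \<in> carrier G" for a b
  proof -
    obtain t where t: "b = elt t n" "code b = vcode (\<lambda>l. int_encode (t (Suc l)))"
      using elt_of_H[of n b] b H_n by auto
    have "\<forall>l<n. entry l (code b) = int_encode (t (Suc l))" unfolding t(2) by simp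
    then have "F (prod_encode (code a, code b)) = code (a \<otimes> elt t n)" using F(2) a H_n by simp
    then show ?thesis unfolding t(1)[symmetric] .
  qed
  then show ?thesis using F(1) by blast
qed

end

section \<open>Traces of inductive intervals on a finite window\<close>

text \<open>
  Finite grazing intervals are numbered by natural numbers: \<open>2 a\<close> stands for \<open>{1..a}\<close> and \<open>2 a - 1\<close> for \<open>{- a..-1}\<close>. For finite \<open>k\<close>
  they are cut off at \<open>k - 1\<close>, so that every number denotes a grazing interval.
\<close>

definition coded_interval :: "nat \<Rightarrow> nat \<Rightarrow> int set" where
  "coded_interval k v =
     (let a = int (if k = 0 then Suc v div 2 else min (Suc v div 2) (k - 1))
      in if even v then {1..a} else {- a..-1})"

text \<open>
  Membership modulo \<open>k\<close> of an exponent in normal form, expressed by its code \<open>e\<close>. For \<open>k = 0\<close> the codes of \<open>1, \<dots>, a\<close> are \<open>2, 4, \<dots>, 2 a\<close>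
  and those of \<open>-1, \<dots>, - a\<close> are \<open>1, 3, \<dots>, 2 a - 1\<close>. For finite \<open>k\<close> the normal exponents are nonnegative, and
  the residues of \<open>- a, \<dots>, -1\<close> are represented by \<open>k - a, \<dots>, k - 1\<close>.
\<close>

definition in_coded_interval :: "nat \<Rightarrow> nat \<Rightarrow> nat \<Rightarrow> bool" where
  "in_coded_interval k v e \<longleftrightarrow> e \<noteq> 0 \<and>
     (if k = 0 then e \<le> v \<and> (even e \<longleftrightarrow> even v) else if even v then e \<le> v else 2 * k \<le> Suc (e + v))"

lemma not_dvd_small: "x \<noteq> 0 \<Longrightarrow> \<bar>x\<bar> < int k \<Longrightarrow> \<not> int k dvd x"
  using zdvd_imp_le[of "int k" "\<bar>x\<bar>"] by auto

lemma grazes_coded_interval: "grazes k (coded_interval k v)"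
proof -
  define a where "a = int (if k = 0 then Suc v div 2 else min (Suc v div 2) (k - 1))"
  have T: "coded_interval k v = (if even v then {1..a} else {- a..-1})"
    unfolding coded_interval_def a_def by (simp add: Let_def)
  have ak: "a < int k" if "k \<noteq> 0" using that unfolding a_def by auto
  have nd: "\<not> int k dvd t" if "t \<noteq> 0" "\<bar>t\<bar> \<le> a" for t
  proof (cases "k = 0")
    case False
    then show ?thesis using ak that by (intro not_dvd_small) auto
  qed (use that in simp)
  have "\<forall>t\<in>coded_interval k v. \<not> int k dvd t" unfolding T using nd by auto
  moreover have "coded_interval k v = {} \<or> 1 \<in> coded_interval k v \<or> -1 \<in> coded_interval k v"
    unfolding T by auto
  moreover have "int_interval (coded_interval k v)" unfolding T by simp
  ultimately show ?thesis unfolding grazes_def by blast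
qed

lemma dvd_diff_same_range:
  assumes "t \<in> {0..<int k}" "s \<in> {0..<int k}" "int k dvd t - s"
  shows "t = s"
proof (rule ccontr)
  assume "t \<noteq> s"
  moreover have "\<bar>t - s\<bar> < int k" using assms(1,2) by (simp add: abs_less_iff)
  ultimately show False using not_dvd_small[of "t - s" k] assms(3) by simp
qed

lemma in_coded_interval_iff:
  assumes t: "k = 0 \<or> t \<in> {0..<int k}"
  shows "in_coded_interval k v (int_encode t) \<longleftrightarrow> t \<noteq> 0 \<and> (\<exists>s\<in>coded_interval k v. int k dvd t - s)"
proof (cases "t = 0")
  case True
  then show ?thesis by (simp add: in_coded_interval_def int_encode_0)
next
  case t0: False
  show ?thesis
  proof (cases "k = 0")
    case True
    have "in_coded_interval k v (int_encode t) \<longleftrightarrow> t \<in> coded_interval k v"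
    proof (cases t rule: int_encode_cases)
      case (nonneg a)
      then show ?thesis using t0 True unfolding in_coded_interval_def coded_interval_def
        by (auto simp: Let_def elim!: evenE oddE)
    next
      case (neg b)
      then show ?thesis using t0 True unfolding in_coded_interval_def coded_interval_def
        by (auto simp: Let_def elim!: evenE oddE)
    qed
    then show ?thesis using True t0 by auto
  next
    case False
    then obtain a where a: "t = int a" "0 < a" "a < k" using t t0 by (metis atLeastLessThan_iff gr0I nonneg_int_cases of_nat_0 of_nat_less_iff)
    have e: "int_encode t = 2 * a" unfolding a(1) by (rule int_encode_nonneg)
    show ?thesis
    proof (cases "even v")
      case True
      have "(\<exists>s\<in>coded_interval k v. int k dvd t - s) \<longleftrightarrow> t \<in> coded_interval k v"
      proof
        assume "\<exists>s\<in>coded_interval k v. int k dvd t - s"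
        then obtain s where s: "s \<in> coded_interval k v" "int k dvd t - s" by blast
        then have "s \<in> {0..<int k}" using True False unfolding coded_interval_def by (auto simp: Let_def)
        then have "t = s" using dvd_diff_same_range[OF _ _ s(2)] t False by blast
        then show "t \<in> coded_interval k v" using s(1) by simp
      qed (auto intro: bexI[of _ t])
      moreover have "t \<in> coded_interval k v \<longleftrightarrow> 2 * a \<le> v"
        using True False a unfolding coded_interval_def by (auto simp: Let_def)
      ultimately show ?thesis using t0 True False a(2) unfolding e in_coded_interval_def by simp
    next
      case odd: False
      have "(\<exists>s\<in>coded_interval k v. int k dvd t - s) \<longleftrightarrow> t - int k \<in> coded_interval k v"
      proof
        assume "\<exists>s\<in>coded_interval k v. int k dvd t - s"
        then obtain s where s: "s \<in> coded_interval k v" "int k dvd t - s" by blast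
        then have "s + int k \<in> {0..<int k}" using odd False unfolding coded_interval_def by (auto simp: Let_def)
        moreover have "int k dvd t - (s + int k)" using s(2) by (metis diff_diff_eq dvd_diff dvd_refl)
        ultimately have "t = s + int k" using dvd_diff_same_range t False by blast
        then show "t - int k \<in> coded_interval k v" using s(1) by simp
      qed (auto intro: bexI[of _ "t - int k"])
      moreover have "t - int k \<in> coded_interval k v \<longleftrightarrow> 2 * k \<le> Suc (2 * a + v)"
      proof -
        have "t - int k \<in> coded_interval k v \<longleftrightarrow> int k - int a \<le> int (min (Suc v div 2) (k - 1))"
          using odd False a unfolding coded_interval_def by (auto simp: Let_def)
        also have "\<dots> \<longleftrightarrow> k \<le> a + Suc v div 2" using a by auto
        also have "\<dots> \<longleftrightarrow> 2 * k \<le> Suc (2 * a + v)" using odd by (auto elim!: oddE)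
        finally show ?thesis .
      qed
      ultimately show ?thesis using t0 odd False a(2) unfolding e in_coded_interval_def by simp
    qed
  qed
qed

text \<open>
  For exponents of absolute value at most \<open>N\<close>, only the part of \<open>T\<close> between \<open>- (N + k)\<close> and \<open>N + k\<close> matters: for
  finite \<open>k\<close> this is all of \<open>T\<close>, and for \<open>k = 0\<close> congruence is equality. This part is a coded interval.
\<close>

lemma coded_interval_approximates:
  assumes T: "grazes k T"
  shows "\<exists>v \<le> 2 * (N + k). \<forall>t. \<bar>t\<bar> \<le> int N \<longrightarrow> (k = 0 \<or> t \<in> {0..<int k}) \<longrightarrow>
    ((\<exists>s\<in>coded_interval k v. int k dvd t - s) \<longleftrightarrow> (\<exists>s\<in>T. int k dvd t - s))"
proof -
  let ?B = "int (N + k)"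
  have approx: "(\<exists>s\<in>T'. int k dvd t - s) \<longleftrightarrow> (\<exists>s\<in>T. int k dvd t - s)"
    if T': "T' = T \<inter> {- ?B..?B}" and t: "\<bar>t\<bar> \<le> int N" for t T'
  proof
    assume "\<exists>s\<in>T. int k dvd t - s"
    then obtain s where s: "s \<in> T" "int k dvd t - s" by blast
    have "\<bar>s\<bar> \<le> ?B"
    proof (cases "k = 0")
      case True
      then show ?thesis using s(2) t by simp
    next
      case False
      then show ?thesis using grazes_bounded[OF T _ s(1)] by simp
    qed
    then have "s \<in> {- ?B..?B}" by (simp add: abs_le_iff)
    then show "\<exists>s\<in>T'. int k dvd t - s" unfolding T' using s by blast
  next
    assume "\<exists>s\<in>T'. int k dvd t - s"
    then show "\<exists>s\<in>T. int k dvd t - s" unfolding T' by blast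
  qed
  have pos: "\<exists>m \<le> N + k. T \<inter> {- ?B..?B} = {1..int m} \<and> (k = 0 \<or> m \<le> k - 1)"
    if T: "grazes k T" and 1: "1 \<in> T" for T
  proof -
    have ivl: "T = {1..} \<or> (\<exists>m\<ge>1. T = {1..m})"
      using int_interval_cases[OF grazes_interval[OF T] 1 grazes_0[OF T]] .
    have bounded: "x < int k" if "k \<noteq> 0" "x \<in> T" for x using grazes_bounded[OF T _ that(2)] that(1) by simp
    from ivl show ?thesis
    proof
      assume inf: "T = {1..}"
      have "k = 0"
      proof (rule ccontr)
        assume "k \<noteq> 0"
        then have "int k \<in> T" using inf by simp
        then show False using bounded[OF \<open>k \<noteq> 0\<close>] by blast
      qed
      then show ?thesis unfolding inf by (intro exI[of _ "N + k"]) auto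
    next
      assume "\<exists>m\<ge>1. T = {1..m}"
      then obtain m where m: "m \<ge> 1" "T = {1..m}" by blast
      have "k = 0 \<or> min (nat m) (N + k) \<le> k - 1"
        using bounded[of m] m by (cases "k = 0") auto
      moreover have "T \<inter> {- ?B..?B} = {1..int (min (nat m) (N + k))}" unfolding m(2) using m(1) by auto
      ultimately show ?thesis by (intro exI[of _ "min (nat m) (N + k)"]) simp
    qed
  qed
  have "\<exists>v \<le> 2 * (N + k). coded_interval k v = T \<inter> {- ?B..?B}"
  proof -
    consider "T = {}" | "1 \<in> T" | "-1 \<in> T" using T unfolding grazes_def by blast
    then show ?thesis
    proof cases
      case 1
      then show ?thesis by (intro exI[of _ 0]) (simp add: coded_interval_def)
    next
      case 2
      obtain m where m: "m \<le> N + k" "T \<inter> {- ?B..?B} = {1..int m}" "k = 0 \<or> m \<le> k - 1"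
        using pos[OF T 2] by blast
      have "coded_interval k (2 * m) = {1..int m}" using m(3) by (auto simp: coded_interval_def Let_def min_def)
      then show ?thesis using m by (intro exI[of _ "2 * m"]) simp
    next
      case 3
      have "1 \<in> uminus ` T" using 3 by (rule rev_image_eqI) simp
      then obtain m where m: "m \<le> N + k" "uminus ` T \<inter> {- ?B..?B} = {1..int m}" "k = 0 \<or> m \<le> k - 1"
        using pos[OF grazes_uminus[OF T]] by blast
      have eq: "T \<inter> {- ?B..?B} = {- int m..-1}"
      proof (rule Set.set_eqI)
        fix x
        have "x \<in> T \<longleftrightarrow> - x \<in> uminus ` T" by auto
        then have "x \<in> T \<inter> {- ?B..?B} \<longleftrightarrow> - x \<in> uminus ` T \<inter> {- ?B..?B}" by auto
        also have "\<dots> \<longleftrightarrow> - x \<in> {1..int m}" unfolding m(2) ..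
        finally show "x \<in> T \<inter> {- ?B..?B} \<longleftrightarrow> x \<in> {- int m..-1}" by auto
      qed
      show ?thesis
      proof (cases m)
        case 0
        then show ?thesis unfolding eq by (intro exI[of _ 0]) (simp add: coded_interval_def)
      next
        case (Suc p)
        have "coded_interval k (Suc (2 * p)) = {- int m..-1}"
          using m(3) Suc by (auto simp: coded_interval_def Let_def min_def)
        then show ?thesis unfolding eq using m(1) Suc by (intro exI[of _ "Suc (2 * p)"]) simp
      qed
    qed
  qed
  then obtain v where v: "v \<le> 2 * (N + k)" "coded_interval k v = T \<inter> {- ?B..?B}" by blast
  show ?thesis using approx[OF v(2)] v(1) by blast
qed

lemma abs_le_int_encode: "\<bar>t\<bar> \<le> int (int_encode t)"
  by (cases t rule: int_encode_cases) simp_all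

context polycyclic
begin

lemma layers_elt_iff:
  assumes T: "grazing_tuple T" and t: "normal_exponents t"
  shows "elt t n \<in> layers 0 T \<longleftrightarrow>
    (\<exists>l<n. (\<forall>j<n. l < j \<longrightarrow> t (Suc j) = 0) \<and> t (Suc l) \<noteq> 0 \<and> (\<exists>s\<in>T l. int (k (Suc l)) dvd t (Suc l) - s))"
proof
  assume "elt t n \<in> layers 0 T"
  then obtain l where l: "l < n" "elt t n \<in> layer l (T l)" by (auto simp: layers_def)
  then have "elt t n \<in> H (Suc l)" using layer_subset by blast
  then obtain t' where t': "normal_exponents t'" "\<forall>j\<ge>Suc l. t' (Suc j) = 0" "elt t n = elt t' (Suc l)"
    using elt_exists[of "Suc l" "elt t n"] l(1) by auto
  have "elt t' n = elt t' (Suc l)" by (rule elt_extend) (use l(1) t'(2) in auto)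
  then have "t (Suc j) = t' (Suc j)" if "j < n" for j
    using elt_unique[OF t t'(1) le_refl _ that] t'(3) by simp
  then have zero: "\<forall>j<n. l < j \<longrightarrow> t (Suc j) = 0" using t'(2) by auto
  then have "elt t n = elt t (Suc l)" using l(1) by (intro elt_extend) auto
  then have "h (Suc l) [^] t (Suc l) \<otimes> elt t l \<in> layer l (T l)" using l(2) by simp
  then obtain s where s: "s \<in> T l" "int (k (Suc l)) dvd t (Suc l) - s"
    using h_pow_layer_iff[OF l(1) elt_in_H] l(1) by auto
  have "\<not> int (k (Suc l)) dvd s" using T l(1) s(1) unfolding grazing_tuple_def grazes_def by blast
  then have "t (Suc l) \<noteq> 0" using s(2) by auto
  then show "\<exists>l<n. (\<forall>j<n. l < j \<longrightarrow> t (Suc j) = 0) \<and> t (Suc l) \<noteq> 0 \<and> (\<exists>s\<in>T l. int (k (Suc l)) dvd t (Suc l) - s)"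
    using l(1) zero s by blast
next
  assume "\<exists>l<n. (\<forall>j<n. l < j \<longrightarrow> t (Suc j) = 0) \<and> t (Suc l) \<noteq> 0 \<and> (\<exists>s\<in>T l. int (k (Suc l)) dvd t (Suc l) - s)"
  then obtain l where l: "l < n" "\<forall>j<n. l < j \<longrightarrow> t (Suc j) = 0" "\<exists>s\<in>T l. int (k (Suc l)) dvd t (Suc l) - s" by blast
  have "elt t n = elt t (Suc l)" using l(1,2) by (intro elt_extend) auto
  moreover have "h (Suc l) [^] t (Suc l) \<otimes> elt t l \<in> layer l (T l)"
    using h_pow_layer_iff[OF l(1) elt_in_H] l by auto
  ultimately show "elt t n \<in> layers 0 T" using l(1) by (auto simp: layers_def)
qed

definition coded_tuple :: "nat \<Rightarrow> nat \<Rightarrow> int set" where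
  "coded_tuple u l = coded_interval (k (Suc l)) (entry l u)"

definition in_coded_layers :: "nat \<Rightarrow> nat \<Rightarrow> bool" where
  "in_coded_layers u c \<longleftrightarrow> (\<exists>l<n. (\<forall>j<n. l < j \<longrightarrow> entry j c = 0) \<and>
     in_coded_interval (k (Suc l)) (entry l u) (entry l c))"

lemma grazing_coded_tuple: "grazing_tuple (coded_tuple u)"
  unfolding grazing_tuple_def coded_tuple_def using grazes_coded_interval by blast

lemma in_coded_layers_iff:
  assumes g: "g \<in> carrier G"
  shows "in_coded_layers u (code g) \<longleftrightarrow> g \<in> layers 0 (coded_tuple u)"
proof -
  obtain t where t: "normal_exponents t" "g = elt t n" "code g = vcode (\<lambda>l. int_encode (t (Suc l)))"
    using elt_of_H[of n g] g H_n by auto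
  have eq: "((\<forall>j<n. l < j \<longrightarrow> entry j (code g) = 0) \<and> in_coded_interval (k (Suc l)) (entry l u) (entry l (code g)))
    \<longleftrightarrow> ((\<forall>j<n. l < j \<longrightarrow> t (Suc j) = 0) \<and> t (Suc l) \<noteq> 0 \<and> (\<exists>s\<in>coded_tuple u l. int (k (Suc l)) dvd t (Suc l) - s))"
    if l: "l < n" for l
  proof -
    have "k (Suc l) = 0 \<or> t (Suc l) \<in> {0..<int (k (Suc l))}" using t(1) l unfolding normal_exponents_def by blast
    from in_coded_interval_iff[OF this] show ?thesis
      unfolding t(3) coded_tuple_def using l by (simp add: int_encode_eq_0)
  qed
  show ?thesis
    unfolding in_coded_layers_def layers_elt_iff[OF grazing_coded_tuple t(1), folded t(2)]
    by (rule ex_cong1, rule conj_cong[OF refl], rule eq)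
qed

text \<open>
  Windows of this form are finite and exhaust the group, so the search runs over them. They are balls only in the
  sense of the enumeration of the group by codes.
\<close>

definition ball :: "nat \<Rightarrow> 'a set" where
  "ball N = {g \<in> carrier G. code g < N}"

definition tuple_bound :: "nat \<Rightarrow> nat" where
  "tuple_bound N = vcode (\<lambda>_. 2 * (N + (\<Sum>l<n. k (Suc l))))"

lemma entry_le: "entry l c \<le> c"
proof -
  have le: "pfst c \<le> c" "psnd c \<le> c" for c
    using le_prod_encode_1[of "pfst c" "psnd c"] le_prod_encode_2[of "psnd c" "pfst c"] by simp_all
  have "((\<lambda>c. psnd (c - 1)) ^^ l) c \<le> c"
  proof (induction l)
    case (Suc l)
    have "psnd (((\<lambda>c. psnd (c - 1)) ^^ l) c - 1) \<le> ((\<lambda>c. psnd (c - 1)) ^^ l) c - 1" by (rule le)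
    then show ?case using Suc by simp
  qed simp
  then show ?thesis unfolding entry_def using le(1)[of "((\<lambda>c. psnd (c - 1)) ^^ l) c - 1"] by linarith
qed

text \<open>
  Elements of the window have bounded exponents, so each inductive interval meets the window in the same set as one of
  finitely many coded inductive intervals.
\<close>

lemma coded_tuple_approximates:
  assumes T: "grazing_tuple T"
  shows "\<exists>u\<le>tuple_bound N. layers 0 (coded_tuple u) \<inter> ball N = layers 0 T \<inter> ball N"
proof -
  let ?P = "\<lambda>l v. v \<le> 2 * (N + k (Suc l)) \<and> (\<forall>t. \<bar>t\<bar> \<le> int N \<longrightarrow> (k (Suc l) = 0 \<or> t \<in> {0..<int (k (Suc l))}) \<longrightarrow>
    ((\<exists>s\<in>coded_interval (k (Suc l)) v. int (k (Suc l)) dvd t - s) \<longleftrightarrow> (\<exists>s\<in>T l. int (k (Suc l)) dvd t - s)))"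
  have "\<exists>v. l < n \<longrightarrow> ?P l v" for l
  proof (cases "l < n")
    case True
    then have "grazes (k (Suc l)) (T l)" using T unfolding grazing_tuple_def by simp
    from coded_interval_approximates[OF this] show ?thesis by (simp only: True simp_thms)
  qed simp
  then have "\<forall>l. \<exists>v. l < n \<longrightarrow> ?P l v" by (rule allI)
  from choice[OF this] obtain v where v': "\<forall>l. l < n \<longrightarrow> ?P l (v l)" ..
  have v: "?P l (v l)" if "l < n" for l by (rule mp[OF spec[OF v'] that])
  have "vcode v \<le> tuple_bound N"
    unfolding tuple_bound_def vcode_def
  proof (rule list_encode_map_mono)
    fix l assume "l \<in> set [0..<n]"
    then have l: "l < n" by simp
    have "k (Suc l) \<le> (\<Sum>l<n. k (Suc l))" using l by (intro member_le_sum) auto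
    then have "2 * (N + k (Suc l)) \<le> 2 * (N + (\<Sum>l<n. k (Suc l)))" by simp
    then show "v l \<le> 2 * (N + (\<Sum>l<n. k (Suc l)))" by (rule order_trans[OF conjunct1[OF v[OF l]]])
  qed
  moreover have "layers 0 (coded_tuple (vcode v)) \<inter> ball N = layers 0 T \<inter> ball N"
  proof -
    have "g \<in> layers 0 (coded_tuple (vcode v)) \<longleftrightarrow> g \<in> layers 0 T" if g: "g \<in> ball N" for g
    proof -
      have gc: "g \<in> carrier G" "code g < N" using g unfolding ball_def by auto
      obtain t where t: "normal_exponents t" "g = elt t n" "code g = vcode (\<lambda>l. int_encode (t (Suc l)))"
        using elt_of_H[of n g] gc(1) H_n by auto
      have eq: "(\<exists>s\<in>coded_tuple (vcode v) l. int (k (Suc l)) dvd t (Suc l) - s) \<longleftrightarrow> (\<exists>s\<in>T l. int (k (Suc l)) dvd t (Suc l) - s)"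
        if l: "l < n" for l
      proof -
        have "int_encode (t (Suc l)) = entry l (code g)" unfolding t(3) using l by simp
        then have "int_encode (t (Suc l)) < N" using entry_le[of l "code g"] gc(2) by linarith
        then have "\<bar>t (Suc l)\<bar> \<le> int N" using abs_le_int_encode[of "t (Suc l)"] by linarith
        note small = this
        have range: "k (Suc l) = 0 \<or> t (Suc l) \<in> {0..<int (k (Suc l))}"
          using t(1) l unfolding normal_exponents_def by blast
        have tup: "coded_tuple (vcode v) l = coded_interval (k (Suc l)) (v l)"
          unfolding coded_tuple_def entry_vcode[OF l] ..
        show ?thesis unfolding tup
          by (rule mp[OF mp[OF spec[OF conjunct2[OF v[OF l]], of "t (Suc l)"] small] range])
      qed
      show ?thesis
        unfolding t(2) layers_elt_iff[OF grazing_coded_tuple t(1)] layers_elt_iff[OF T t(1)]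
        by (rule ex_cong1, rule conj_cong[OF refl], rule conj_cong[OF refl], rule conj_cong[OF refl], rule eq)
    qed
    then show ?thesis by blast
  qed
  ultimately show ?thesis by blast
qed

lemma one_step_extendable_cong:
  "C \<inter> B = C' \<inter> B \<Longrightarrow> one_step_extendable B Ps C \<longleftrightarrow> one_step_extendable B Ps C'"
  unfolding one_step_extendable_def by simp

lemma all_one_step_extendable_iff:
  "(\<forall>T. grazing_tuple T \<longrightarrow> one_step_extendable (ball N) Ps (layers 0 T)) \<longleftrightarrow>
   (\<forall>u<Suc (tuple_bound N). one_step_extendable (ball N) Ps (layers 0 (coded_tuple u)))"
proof
  assume a: "\<forall>u<Suc (tuple_bound N). one_step_extendable (ball N) Ps (layers 0 (coded_tuple u))"
  show "\<forall>T. grazing_tuple T \<longrightarrow> one_step_extendable (ball N) Ps (layers 0 T)"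
  proof (intro allI impI)
    fix T assume "grazing_tuple T"
    from coded_tuple_approximates[OF this, of N] obtain u where u: "u \<le> tuple_bound N"
      "layers 0 (coded_tuple u) \<inter> ball N = layers 0 T \<inter> ball N" by blast
    show "one_step_extendable (ball N) Ps (layers 0 T)"
      using a u(1) one_step_extendable_cong[OF u(2), of Ps] by auto
  qed
qed (use grazing_coded_tuple in blast)

end

section \<open>Codes of group elements and of patterns\<close>

lemma set_encode_less: "A \<subseteq> {..<m} \<Longrightarrow> set_encode A < 2 ^ m"
proof (induction m arbitrary: A)
  case (Suc m)
  have "A - {m} \<subseteq> {..<m}" using Suc.prems by (auto simp: less_Suc_eq)
  then have less: "set_encode (A - {m}) < 2 ^ m" by (rule Suc.IH)
  have fin: "finite (A - {m})" using Suc.prems finite_subset by blast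
  show ?case
  proof (cases "m \<in> A")
    case True
    then have "set_encode A = 2 ^ m + set_encode (A - {m})"
      using set_encode_insert[OF fin, of m] by (simp add: insert_absorb)
    then show ?thesis using less by simp
  next
    case False
    then show ?thesis using less by simp
  qed
qed simp

lemma prod_encode_less: "a < a' \<Longrightarrow> b < b' \<Longrightarrow> prod_encode (a, b) < prod_encode (a', b')"
proof -
  assume "a < a'" "b < b'"
  then have "prod_encode (Suc a, b) \<le> prod_encode (a', b')" by (intro prod_encode_mono) auto
  moreover have "prod_encode (a, b) < prod_encode (Suc a, b)"
    unfolding prod_encode_def by simp
  ultimately show ?thesis by simp
qed

context polycyclic
begin

definition valid_code :: "nat \<Rightarrow> bool" where
  "valid_code c \<longleftrightarrow> c = vcode (\<lambda>l. entry l c) \<and>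
     (\<forall>l<n. k (Suc l) = 0 \<or> (even (entry l c) \<and> entry l c < 2 * k (Suc l)))"

lemma valid_code_iff: "valid_code c \<longleftrightarrow> c \<in> code ` carrier G"
proof
  assume "c \<in> code ` carrier G"
  then obtain g where g: "g \<in> carrier G" "c = code g" by blast
  obtain t where t: "normal_exponents t" "code g = vcode (\<lambda>l. int_encode (t (Suc l)))"
    using elt_of_H[of n g] g(1) H_n by auto
  have "c = vcode (\<lambda>l. entry l c)" unfolding g(2) t(2) by (rule vcode_cong) simp
  moreover have "k (Suc l) = 0 \<or> (even (entry l c) \<and> entry l c < 2 * k (Suc l))" if l: "l < n" for l
  proof (cases "k (Suc l) = 0")
    case False
    then have "0 \<le> t (Suc l)" "t (Suc l) < int (k (Suc l))" using t(1) l unfolding normal_exponents_def by auto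
    then obtain a where a: "t (Suc l) = int a" "a < k (Suc l)" by (metis nonneg_int_cases of_nat_less_iff)
    have "entry l c = 2 * a" unfolding g(2) t(2) using l a(1) by (simp add: int_encode_nonneg)
    then show ?thesis using a(2) by simp
  qed simp
  ultimately show "valid_code c" unfolding valid_code_def by blast
next
  assume c: "valid_code c"
  define t where "t i = int_decode (entry (i - 1) c)" for i
  have "normal_exponents t" unfolding normal_exponents_def
  proof (intro allI impI)
    fix l assume l: "l < n"
    show "k (Suc l) = 0 \<or> t (Suc l) \<in> {0..<int (k (Suc l))}"
    proof (cases "k (Suc l) = 0")
      case False
      then have e: "even (entry l c)" "entry l c < 2 * k (Suc l)" using c l unfolding valid_code_def by auto
      then obtain a where a: "entry l c = 2 * a" by (elim evenE)
      then have "t (Suc l) = int a" unfolding t_def by (simp flip: int_encode_nonneg)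
      then show ?thesis using e(2) a by simp
    qed simp
  qed
  from code_elt[OF this] have "code (elt t n) = vcode (\<lambda>l. entry l c)" unfolding t_def by simp
  then have "code (elt t n) = c" using c unfolding valid_code_def by simp
  moreover have "elt t n \<in> carrier G" using elt_in_H[OF le_refl] H_n by simp
  ultimately show "c \<in> code ` carrier G" by blast
qed

lemma dec_valid_code: "computable f \<Longrightarrow> decidable (\<lambda>x. valid_code (f x))"
proof -
  assume f: "computable f"
  have "decidable (\<lambda>c. c = vcode (\<lambda>l. entry l c) \<and>
     (\<forall>l<n. k (Suc l) = 0 \<or> (even (entry l c) \<and> entry l c < 2 * k (Suc l))))"
    by (intro dec_conj dec_eq comp_vcode comp_entry dec_all_fixed dec_disj dec_const dec_even dec_less comp_const comp_id)
  then have "decidable valid_code" unfolding valid_code_def .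
  from dec_compose[OF this f] show ?thesis .
qed

lemma dec_in_coded_layers:
  assumes "computable f" "computable g"
  shows "decidable (\<lambda>x. in_coded_layers (f x) (g x))"
proof -
  have interval: "decidable (\<lambda>x. in_coded_interval k (a x) (b x))" if "computable a" "computable b" for k a b
  proof (cases "k = 0")
    case True
    have "decidable (\<lambda>x. b x \<noteq> 0 \<and> (b x \<le> a x \<and> (even (b x) \<longleftrightarrow> even (a x))))"
      by (intro dec_conj dec_not dec_eq dec_le dec_iff dec_even comp_const that)
    then show ?thesis unfolding in_coded_interval_def using True by simp
  next
    case False
    have "decidable (\<lambda>x. b x \<noteq> 0 \<and> ((even (a x) \<and> b x \<le> a x) \<or> (\<not> even (a x) \<and> 2 * k \<le> Suc (b x + a x))))"
      by (intro dec_conj dec_not dec_eq dec_le dec_disj dec_even comp_const comp_Suc comp_add that)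
    moreover have "(if even (a x) then b x \<le> a x else 2 * k \<le> Suc (b x + a x)) \<longleftrightarrow>
        ((even (a x) \<and> b x \<le> a x) \<or> (\<not> even (a x) \<and> 2 * k \<le> Suc (b x + a x)))" for x by simp
    ultimately show ?thesis unfolding in_coded_interval_def using False by simp
  qed
  show ?thesis unfolding in_coded_layers_def
    by (intro dec_ex_fixed dec_conj dec_all_fixed dec_imp dec_const dec_eq comp_entry comp_const interval assms)
qed

lemma comp_tuple_bound: "computable f \<Longrightarrow> computable (\<lambda>x. tuple_bound (f x))"
proof -
  assume f: "computable f"
  have "computable (\<lambda>x. vcode (\<lambda>_. (f x + (\<Sum>l<n. k (Suc l))) + (f x + (\<Sum>l<n. k (Suc l)))))"
    by (intro comp_vcode comp_add f comp_const)
  then show ?thesis unfolding tuple_bound_def mult_2 .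
qed

abbreviation pcode :: "('a, 'c::finite) config \<Rightarrow> nat" where "pcode \<equiv> pattern_code G n h k"

definition finite_config :: "('a, 'c) config \<Rightarrow> bool" where
  "finite_config P \<longleftrightarrow> finite (dom P) \<and> dom P \<subseteq> carrier G"

lemma set_decode_pcode:
  assumes "finite_config P"
  shows "set_decode (pcode P) = {prod_encode (code g, to_nat a) | g a. P g = Some a}"
proof -
  have "{prod_encode (code g, to_nat a) | g a. P g = Some a} = (\<lambda>g. prod_encode (code g, to_nat (the (P g)))) ` dom P"
    by (force simp: image_iff)
  then have "finite {prod_encode (code g, to_nat a) | g a. P g = Some a}"
    using assms unfolding finite_config_def by simp
  then show ?thesis unfolding pattern_code_def by (rule set_encode_inverse)
qed

lemma mem_pcode:
  assumes P: "finite_config P" and g: "g \<in> carrier G"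
  shows "prod_encode (code g, to_nat a) \<in> set_decode (pcode P) \<longleftrightarrow> P g = Some a"
proof
  assume "prod_encode (code g, to_nat a) \<in> set_decode (pcode P)"
  then obtain g' a' where ga: "P g' = Some a'" "code g = code g'" "to_nat a = to_nat a'"
    unfolding set_decode_pcode[OF P] by auto
  have "g' \<in> carrier G" using P ga(1) unfolding finite_config_def by blast
  then have "g = g'" using code_inj[OF g _ ga(2)] by blast
  moreover have "a = a'" using ga(3) by simp
  ultimately show "P g = Some a" using ga(1) by simp
qed (use set_decode_pcode[OF P] in blast)

lemma mem_pcodeE:
  assumes P: "finite_config P" and q: "q \<in> set_decode (pcode P)"
  obtains g a where "g \<in> carrier G" "P g = Some a" "q = prod_encode (code g, to_nat a)"
proof -
  obtain g a where ga: "P g = Some a" "q = prod_encode (code g, to_nat a)"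
    using q unfolding set_decode_pcode[OF P] by blast
  have "g \<in> carrier G" using P ga(1) unfolding finite_config_def by blast
  then show thesis using that ga by blast
qed

lemma ball_pcode_iff:
  assumes P: "finite_config P"
  shows "(\<forall>q\<in>set_decode (pcode P). \<Psi> (pfst q) (psnd q)) \<longleftrightarrow> (\<forall>g a. P g = Some a \<longrightarrow> \<Psi> (code g) (to_nat a))"
proof
  assume a: "\<forall>q\<in>set_decode (pcode P). \<Psi> (pfst q) (psnd q)"
  show "\<forall>g a. P g = Some a \<longrightarrow> \<Psi> (code g) (to_nat a)"
  proof (intro allI impI)
    fix g a assume "P g = Some a"
    then have "prod_encode (code g, to_nat a) \<in> set_decode (pcode P)" unfolding set_decode_pcode[OF P] by blast
    from bspec[OF a this] show "\<Psi> (code g) (to_nat a)" by simp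
  qed
next
  assume a: "\<forall>g a. P g = Some a \<longrightarrow> \<Psi> (code g) (to_nat a)"
  show "\<forall>q\<in>set_decode (pcode P). \<Psi> (pfst q) (psnd q)"
  proof
    fix q assume "q \<in> set_decode (pcode P)"
    then obtain g c where gc: "P g = Some c" "q = prod_encode (code g, to_nat c)"
      unfolding set_decode_pcode[OF P] by blast
    show "\<Psi> (pfst q) (psnd q)" unfolding gc(2) using a gc(1) by simp
  qed
qed

lemma pcode_inj:
  assumes P: "finite_config P" and Q: "finite_config Q" and eq: "pcode P = pcode Q"
  shows "P = Q"
proof
  fix g
  show "P g = Q g"
  proof (cases "g \<in> carrier G")
    case True
    have same: "P g = Some a \<longleftrightarrow> Q g = Some a" for a
      using mem_pcode[OF P True, of a] mem_pcode[OF Q True, of a] eq by simp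
    show ?thesis
    proof (cases "P g")
      case None
      then have "Q g \<noteq> Some (the (Q g))" using same[of "the (Q g)"] by simp
      then show ?thesis using None by (cases "Q g") simp_all
    next
      case (Some a)
      then show ?thesis using same[of a] by simp
    qed
  next
    case False
    then have "g \<notin> dom P" "g \<notin> dom Q" using P Q unfolding finite_config_def by auto
    then show ?thesis by (simp add: domIff)
  qed
qed

lemma to_nat_less_Suc_Max: "to_nat (a :: 'c::finite) < Suc (Max (range (to_nat :: 'c \<Rightarrow> nat)))"
  by (simp add: less_Suc_eq_le)

text \<open>
  The parameter \<open>A\<close> is the set of the codes of letters, a fixed finite set of numbers. The last condition makes the coded
  relation single-valued.
\<close>

definition valid_pattern :: "nat set \<Rightarrow> nat \<Rightarrow> bool" where
  "valid_pattern A x \<longleftrightarrow> (\<forall>q\<in>set_decode x. valid_code (pfst q) \<and> psnd q \<in> A \<and>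
     (\<forall>q'\<in>set_decode x. pfst q = pfst q' \<longrightarrow> psnd q = psnd q'))"

lemma valid_pattern_iff:
  "valid_pattern (range (to_nat :: 'c::finite \<Rightarrow> nat)) x \<longleftrightarrow>
    (\<exists>P :: ('a, 'c) config. finite_config P \<and> x = pcode P)" (is "valid_pattern ?A x \<longleftrightarrow> _")
proof
  assume "\<exists>P :: ('a, 'c) config. finite_config P \<and> x = pcode P"
  then obtain P :: "('a, 'c) config" where P: "finite_config P" "x = pcode P" by blast
  show "valid_pattern ?A x" unfolding valid_pattern_def P(2)
  proof (intro ballI conjI impI)
    fix q assume "q \<in> set_decode (pcode P)"
    then obtain g a where ga: "g \<in> carrier G" "P g = Some a" "q = prod_encode (code g, to_nat a)"
      by (rule mem_pcodeE[OF P(1)]) blast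
    show "valid_code (pfst q)" unfolding ga(3) valid_code_iff using ga(1) by simp
    show "psnd q \<in> ?A" unfolding ga(3) by simp
    fix q' assume "q' \<in> set_decode (pcode P)"
    then obtain g' a' where ga': "g' \<in> carrier G" "P g' = Some a'" "q' = prod_encode (code g', to_nat a')"
      by (rule mem_pcodeE[OF P(1)]) blast
    assume "pfst q = pfst q'"
    then have "g = g'" using code_inj[OF ga(1) ga'(1)] unfolding ga(3) ga'(3) by simp
    then show "psnd q = psnd q'" using ga ga' by simp
  qed
next
  assume x: "valid_pattern ?A x"
  define P :: "('a, 'c) config" where "P g = (if g \<in> carrier G \<and> (\<exists>a::'c. prod_encode (code g, to_nat a) \<in> set_decode x)
    then Some (SOME a. prod_encode (code g, to_nat a) \<in> set_decode x) else None)" for g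
  have P_iff: "P g = Some a \<longleftrightarrow> g \<in> carrier G \<and> prod_encode (code g, to_nat a) \<in> set_decode x" for g a
  proof
    assume "P g = Some a"
    then have g: "g \<in> carrier G" "\<exists>a::'c. prod_encode (code g, to_nat a) \<in> set_decode x"
      and a: "a = (SOME a. prod_encode (code g, to_nat a) \<in> set_decode x)"
      unfolding P_def by (auto split: if_splits)
    then show "g \<in> carrier G \<and> prod_encode (code g, to_nat a) \<in> set_decode x"
      using someI_ex[OF g(2)] by simp
  next
    assume ga: "g \<in> carrier G \<and> prod_encode (code g, to_nat a) \<in> set_decode x"
    then have ex: "\<exists>a::'c. prod_encode (code g, to_nat a) \<in> set_decode x" by blast
    let ?b = "SOME a::'c. prod_encode (code g, to_nat a) \<in> set_decode x"
    have b: "prod_encode (code g, to_nat ?b) \<in> set_decode x" using someI_ex[OF ex] .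
    have "\<forall>q'\<in>set_decode x. pfst (prod_encode (code g, to_nat a)) = pfst q' \<longrightarrow> psnd (prod_encode (code g, to_nat a)) = psnd q'"
      using x ga unfolding valid_pattern_def by blast
    from bspec[OF this b] have "a = ?b" by simp
    moreover have "P g = Some ?b" unfolding P_def using ga ex by simp
    ultimately show "P g = Some a" by simp
  qed
  have dom: "dom P \<subseteq> carrier G" using P_iff by blast
  have "code ` dom P \<subseteq> pfst ` set_decode x"
  proof
    fix c assume "c \<in> code ` dom P"
    then obtain g a where "c = code g" "P g = Some a" by blast
    then have "prod_encode (c, to_nat a) \<in> set_decode x" using P_iff by simp
    then show "c \<in> pfst ` set_decode x" by (rule rev_image_eqI) simp
  qed
  then have "finite (code ` dom P)" by (rule finite_subset) simp
  moreover have "inj_on code (dom P)" using code_inj dom by (auto intro!: inj_onI)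
  ultimately have "finite (dom P)" using finite_imageD by blast
  then have P: "finite_config P" unfolding finite_config_def using dom by simp
  have "set_decode (pcode P) = set_decode x"
  proof (rule Set.set_eqI)
    fix q
    show "q \<in> set_decode (pcode P) \<longleftrightarrow> q \<in> set_decode x"
    proof
      assume "q \<in> set_decode x"
      then have "valid_code (pfst q)" "psnd q \<in> ?A" using x unfolding valid_pattern_def by blast+
      then obtain g and a :: 'c where ga: "g \<in> carrier G" "pfst q = code g" "psnd q = to_nat a"
        unfolding valid_code_iff by blast
      then have q: "q = prod_encode (code g, to_nat a)" using prod_decode_inverse[of q] prod.collapse[of "prod_decode q"] by simp
      then have "P g = Some a" using P_iff ga(1) \<open>q \<in> set_decode x\<close> by simp
      then show "q \<in> set_decode (pcode P)" unfolding q using mem_pcode[OF P ga(1)] by simp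
    next
      assume "q \<in> set_decode (pcode P)"
      then obtain g a where "g \<in> carrier G" "P g = Some a" "q = prod_encode (code g, to_nat a)"
        by (rule mem_pcodeE[OF P]) blast
      then show "q \<in> set_decode x" using P_iff by simp
    qed
  qed
  then have "x = pcode P" by (metis set_decode_inverse)
  then show "\<exists>P :: ('a, 'c) config. finite_config P \<and> x = pcode P" using P by blast
qed

text \<open>
  A strict upper bound for the codes of configurations whose domain lies in the window.
\<close>

definition config_bound :: "nat set \<Rightarrow> nat \<Rightarrow> nat" where
  "config_bound A N = 2 ^ prod_encode (N, Suc (Max A))"

lemma pcode_less:
  fixes P :: "('a, 'c::finite) config"
  assumes P: "finite_config P" and N: "dom P \<subseteq> ball N"
  shows "pcode P < config_bound (range (to_nat :: 'c \<Rightarrow> nat)) N"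
proof -
  let ?m = "prod_encode (N, Suc (Max (range (to_nat :: 'c \<Rightarrow> nat))))"
  have "set_decode (pcode P) \<subseteq> {..<?m}"
  proof
    fix q assume "q \<in> set_decode (pcode P)"
    then obtain g a where ga: "g \<in> carrier G" "P g = Some a" "q = prod_encode (code g, to_nat a)"
      by (rule mem_pcodeE[OF P]) blast
    have "g \<in> ball N" using N ga(2) by blast
    then have "code g < N" unfolding ball_def by simp
    then show "q \<in> {..<?m}"
      unfolding ga(3) using prod_encode_less[OF _ to_nat_less_Suc_Max] by simp
  qed
  then have "set_encode (set_decode (pcode P)) < 2 ^ ?m" by (rule set_encode_less)
  then show ?thesis unfolding config_bound_def by simp
qed

end

section \<open>Certificates in terms of codes\<close>

context polycyclic
begin

text \<open>
  The parts of a certificate are restated for codes, with bounded quantifiers only. In these definitions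
  \<open>M\<close> is the multiplication on codes, \<open>A\<close> the set of the codes of letters, \<open>N\<close> the size of the window, and \<open>F\<close>, \<open>Ps\<close>, \<open>P\<close>, \<open>x\<close> are codes.
\<close>

definition occurs_code :: "(nat \<Rightarrow> nat) \<Rightarrow> nat \<Rightarrow> nat \<Rightarrow> nat \<Rightarrow> bool" where
  "occurs_code M N Ps x \<longleftrightarrow> (\<exists>P\<in>set_decode Ps. \<exists>g<N. valid_code g \<and>
     (\<forall>q\<in>set_decode P. prod_encode (M (prod_encode (g, pfst q)), psnd q) \<in> set_decode x))"

text \<open>
  The bound on the letter keeps the quantifier bounded; the equivalence makes the domain equal to the part of the window given by \<open>S\<close>.
\<close>

definition domain_code :: "nat set \<Rightarrow> (nat \<Rightarrow> bool) \<Rightarrow> nat \<Rightarrow> nat \<Rightarrow> bool" where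
  "domain_code A S N x \<longleftrightarrow> (\<forall>q\<in>set_decode x. pfst q < N) \<and>
     (\<forall>g<N. (\<exists>a<Suc (Max A). prod_encode (g, a) \<in> set_decode x) \<longleftrightarrow> valid_code g \<and> S g)"

definition refutes_code :: "(nat \<Rightarrow> nat) \<Rightarrow> nat set \<Rightarrow> nat \<Rightarrow> nat \<Rightarrow> nat \<Rightarrow> bool" where
  "refutes_code M A N F P \<longleftrightarrow> (\<forall>q\<in>set_decode P. pfst q < N) \<and>
     (\<forall>x<config_bound A N. valid_pattern A x \<longrightarrow> domain_code A (\<lambda>_. True) N x \<longrightarrow>
        (\<forall>q\<in>set_decode P. q \<in> set_decode x) \<longrightarrow> occurs_code M N F x)"

text \<open>
  Adding a power of two to the code of a configuration inserts one more pair of a position and a letter.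
\<close>

definition extendable_code :: "(nat \<Rightarrow> nat) \<Rightarrow> nat set \<Rightarrow> nat \<Rightarrow> nat \<Rightarrow> nat \<Rightarrow> bool" where
  "extendable_code M A N Ps u \<longleftrightarrow>
     (\<forall>x<config_bound A N. valid_pattern A x \<longrightarrow> domain_code A (in_coded_layers u) N x \<longrightarrow>
        \<not> occurs_code M N Ps x \<longrightarrow>
        (\<exists>a<Suc (Max A). a \<in> A \<and> \<not> occurs_code M N Ps (x + 2 ^ prod_encode (code \<one>, a))))"

definition based_code :: "nat set \<Rightarrow> nat \<Rightarrow> bool" where
  "based_code A Ps \<longleftrightarrow> (\<forall>P\<in>set_decode Ps. P = 0 \<or> (\<exists>a<Suc (Max A). prod_encode (code \<one>, a) \<in> set_decode P))"

text \<open>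
  The inverse of a position is found by bounded search for its defining equation.
\<close>

definition fits_code :: "(nat \<Rightarrow> nat) \<Rightarrow> nat \<Rightarrow> nat \<Rightarrow> bool" where
  "fits_code M N Ps \<longleftrightarrow> (\<forall>P\<in>set_decode Ps. \<forall>q\<in>set_decode P. \<exists>g<N. valid_code g \<and>
     M (prod_encode (g, pfst q)) = code \<one> \<and> (\<forall>q'\<in>set_decode P. M (prod_encode (g, pfst q')) < N))"

definition certificate_code :: "(nat \<Rightarrow> nat) \<Rightarrow> nat set \<Rightarrow> nat \<Rightarrow> nat \<Rightarrow> nat \<Rightarrow> bool" where
  "certificate_code M A F Ps N \<longleftrightarrow> code \<one> < N \<and> based_code A Ps \<and> fits_code M N Ps \<and>
     (\<forall>P\<in>set_decode Ps. refutes_code M A N F P) \<and> (\<forall>Q\<in>set_decode F. refutes_code M A N Ps Q) \<and>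
     (\<forall>u<Suc (tuple_bound N). extendable_code M A N Ps u)"

lemma ex_valid_code_iff: "(\<exists>g<N. valid_code g \<and> \<Psi> g) \<longleftrightarrow> (\<exists>g\<in>ball N. \<Psi> (code g))"
  unfolding valid_code_iff ball_def by blast

lemma pattern_set_finite_config: "pattern_set G Ps \<Longrightarrow> P \<in> Ps \<Longrightarrow> finite_config P"
  unfolding pattern_set_def finite_config_def by blast

lemma set_decode_patterns_code:
  "pattern_set G Ps \<Longrightarrow> set_decode (patterns_code G n h k Ps) = pcode ` Ps"
  unfolding patterns_code_def pattern_set_def by simp

lemma domain_code_iff:
  fixes x :: "('a, 'c::finite) config"
  assumes x: "finite_config x"
  shows "domain_code (range (to_nat :: 'c \<Rightarrow> nat)) S N (pcode x) \<longleftrightarrow> dom x = {g \<in> ball N. S (code g)}"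
proof -
  let ?A = "range (to_nat :: 'c \<Rightarrow> nat)"
  have xc: "g \<in> carrier G" if "g \<in> dom x" for g using x that unfolding finite_config_def by blast
  have ex: "(\<exists>a<Suc (Max ?A). prod_encode (code g, a) \<in> set_decode (pcode x)) \<longleftrightarrow> g \<in> dom x"
    if g: "g \<in> carrier G" for g
  proof
    assume "\<exists>a<Suc (Max ?A). prod_encode (code g, a) \<in> set_decode (pcode x)"
    then obtain a where "prod_encode (code g, a) \<in> set_decode (pcode x)" by blast
    then obtain g' a' where ga: "g' \<in> carrier G" "x g' = Some a'" "prod_encode (code g, a) = prod_encode (code g', to_nat a')"
      by (rule mem_pcodeE[OF x]) blast
    then have "g = g'" using code_inj[OF g ga(1)] by simp
    then show "g \<in> dom x" using ga(2) by blast
  next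
    assume "g \<in> dom x"
    then obtain a where "x g = Some a" by blast
    then have "prod_encode (code g, to_nat a) \<in> set_decode (pcode x)" using mem_pcode[OF x g] by simp
    then show "\<exists>a<Suc (Max ?A). prod_encode (code g, a) \<in> set_decode (pcode x)"
      using to_nat_less_Suc_Max[of a] by blast
  qed
  have valid: "valid_code c" if mem: "prod_encode (c, a) \<in> set_decode (pcode x)" for c a
  proof -
    obtain g' a' where "g' \<in> carrier G" "x g' = Some a'" "prod_encode (c, a) = prod_encode (code g', to_nat a')"
      by (rule mem_pcodeE[OF x mem]) blast
    then show ?thesis unfolding valid_code_iff by simp
  qed
  have 1: "(\<forall>q\<in>set_decode (pcode x). pfst q < N) \<longleftrightarrow> dom x \<subseteq> ball N"
  proof -
    have "(\<forall>q\<in>set_decode (pcode x). pfst q < N) \<longleftrightarrow> (\<forall>g a. x g = Some a \<longrightarrow> code g < N)"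
      by (rule ball_pcode_iff[OF x])
    also have "\<dots> \<longleftrightarrow> dom x \<subseteq> ball N"
    proof
      assume a: "\<forall>g a. x g = Some a \<longrightarrow> code g < N"
      show "dom x \<subseteq> ball N"
      proof
        fix g assume g: "g \<in> dom x"
        then obtain a where "x g = Some a" by blast
        then show "g \<in> ball N" using a xc[OF g] unfolding ball_def by simp
      qed
    next
      assume sub: "dom x \<subseteq> ball N"
      show "\<forall>g a. x g = Some a \<longrightarrow> code g < N"
      proof (intro allI impI)
        fix g a assume "x g = Some a"
        then have "g \<in> dom x" by blast
        then have "g \<in> ball N" using sub by blast
        then show "code g < N" unfolding ball_def by simp
      qed
    qed
    finally show ?thesis .
  qed
  have 2: "(\<forall>g<N. (\<exists>a<Suc (Max ?A). prod_encode (g, a) \<in> set_decode (pcode x)) \<longleftrightarrow> valid_code g \<and> S g)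
      \<longleftrightarrow> (\<forall>g\<in>ball N. g \<in> dom x \<longleftrightarrow> S (code g))"
  proof
    assume a: "\<forall>g<N. (\<exists>a<Suc (Max ?A). prod_encode (g, a) \<in> set_decode (pcode x)) \<longleftrightarrow> valid_code g \<and> S g"
    show "\<forall>g\<in>ball N. g \<in> dom x \<longleftrightarrow> S (code g)"
    proof
      fix g assume "g \<in> ball N"
      then have g: "g \<in> carrier G" "code g < N" unfolding ball_def by auto
      have v: "valid_code (code g)" unfolding valid_code_iff using g(1) by blast
      have "(\<exists>b<Suc (Max ?A). prod_encode (code g, b) \<in> set_decode (pcode x)) \<longleftrightarrow> valid_code (code g) \<and> S (code g)"
        by (rule mp[OF spec[OF a] g(2)])
      then show "g \<in> dom x \<longleftrightarrow> S (code g)" unfolding ex[OF g(1)] using v by simp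
    qed
  next
    assume a: "\<forall>g\<in>ball N. g \<in> dom x \<longleftrightarrow> S (code g)"
    show "\<forall>g<N. (\<exists>a<Suc (Max ?A). prod_encode (g, a) \<in> set_decode (pcode x)) \<longleftrightarrow> valid_code g \<and> S g"
    proof (intro allI impI)
      fix c assume c: "c < N"
      show "(\<exists>a<Suc (Max ?A). prod_encode (c, a) \<in> set_decode (pcode x)) \<longleftrightarrow> valid_code c \<and> S c"
      proof (cases "valid_code c")
        case True
        then obtain g where g: "g \<in> carrier G" "c = code g" unfolding valid_code_iff by blast
        then have "g \<in> ball N" using c unfolding ball_def by simp
        from bspec[OF a this] show ?thesis unfolding g(2) ex[OF g(1)] using True g(2) by simp
      next
        case False
        then show ?thesis using valid by blast
      qed
    qed
  qed
  show ?thesis unfolding domain_code_def 1 2 by blast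
qed

lemma finite_ball: "finite (ball N)"
proof -
  have "inj_on code (ball N)" using code_inj unfolding ball_def by (auto intro!: inj_onI)
  moreover have "code ` ball N \<subseteq> {..<N}" unfolding ball_def by auto
  then have "finite (code ` ball N)" by (rule finite_subset) simp
  ultimately show ?thesis by (rule finite_imageD[rotated])
qed

lemma finite_config_ball: "dom x \<subseteq> ball N \<Longrightarrow> finite_config x"
proof -
  assume x: "dom x \<subseteq> ball N"
  then have "finite (dom x)" using finite_ball by (rule finite_subset)
  moreover have "ball N \<subseteq> carrier G" unfolding ball_def by blast
  ultimately show ?thesis unfolding finite_config_def using x by blast
qed

text \<open>
  Quantification over all configurations on a part of the window is a bounded quantification over codes.
\<close>

lemma all_configs_iff:
  fixes \<Theta> :: "nat \<Rightarrow> bool"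
  shows "(\<forall>x<config_bound (range (to_nat :: 'c::finite \<Rightarrow> nat)) N. valid_pattern (range (to_nat :: 'c \<Rightarrow> nat)) x \<longrightarrow>
      domain_code (range (to_nat :: 'c \<Rightarrow> nat)) S N x \<longrightarrow> \<Theta> x) \<longleftrightarrow>
    (\<forall>x :: ('a, 'c) config. dom x = {g \<in> ball N. S (code g)} \<longrightarrow> \<Theta> (pcode x))" (is "?l \<longleftrightarrow> ?r")
proof
  let ?A = "range (to_nat :: 'c \<Rightarrow> nat)"
  assume l: ?l
  show ?r
  proof (intro allI impI)
    fix x :: "('a, 'c) config" assume x: "dom x = {g \<in> ball N. S (code g)}"
    have fin: "finite_config x" by (rule finite_config_ball[of _ N]) (use x in blast)
    have "pcode x < config_bound ?A N" by (rule pcode_less[OF fin]) (use x in blast)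
    moreover have "valid_pattern ?A (pcode x)" using fin valid_pattern_iff by blast
    moreover have "domain_code ?A S N (pcode x)" using domain_code_iff[OF fin] x by blast
    ultimately show "\<Theta> (pcode x)" using l by blast
  qed
next
  let ?A = "range (to_nat :: 'c \<Rightarrow> nat)"
  assume r: ?r
  show ?l
  proof (intro allI impI)
    fix x assume "valid_pattern ?A x" and d: "domain_code ?A S N x"
    then obtain P :: "('a, 'c) config" where P: "finite_config P" "x = pcode P" using valid_pattern_iff by blast
    have "dom P = {g \<in> ball N. S (code g)}" using d unfolding P(2) domain_code_iff[OF P(1)] .
    then show "\<Theta> x" unfolding P(2) using r by blast
  qed
qed

lemma pcode_upd:
  fixes x :: "('a, 'c::finite) config"
  assumes x: "finite_config x" and e: "\<one> \<notin> dom x"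
  shows "pcode (x(\<one> \<mapsto> a)) = pcode x + 2 ^ prod_encode (code \<one>, to_nat a)"
proof -
  let ?q = "prod_encode (code \<one>, to_nat a)"
  have x': "finite_config (x(\<one> \<mapsto> a))" using x unfolding finite_config_def by simp
  have "set_decode (pcode (x(\<one> \<mapsto> a))) = insert ?q (set_decode (pcode x))"
  proof (rule Set.set_eqI)
    fix q
    show "q \<in> set_decode (pcode (x(\<one> \<mapsto> a))) \<longleftrightarrow> q \<in> insert ?q (set_decode (pcode x))"
    proof
      assume "q \<in> set_decode (pcode (x(\<one> \<mapsto> a)))"
      then obtain g b where g: "(x(\<one> \<mapsto> a)) g = Some b" "q = prod_encode (code g, to_nat b)"
        unfolding set_decode_pcode[OF x'] by blast
      show "q \<in> insert ?q (set_decode (pcode x))"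
      proof (cases "g = \<one>")
        case True
        then show ?thesis using g by simp
      next
        case False
        then have "x g = Some b" using g(1) by simp
        then show ?thesis unfolding set_decode_pcode[OF x] g(2) by blast
      qed
    next
      assume "q \<in> insert ?q (set_decode (pcode x))"
      then show "q \<in> set_decode (pcode (x(\<one> \<mapsto> a)))"
      proof
        assume "q = ?q"
        moreover have "(x(\<one> \<mapsto> a)) \<one> = Some a" by simp
        ultimately show ?thesis unfolding set_decode_pcode[OF x'] by blast
      next
        assume "q \<in> set_decode (pcode x)"
        then obtain g b where g: "x g = Some b" "q = prod_encode (code g, to_nat b)"
          unfolding set_decode_pcode[OF x] by blast
        then have "g \<noteq> \<one>" using e by blast
        then have "(x(\<one> \<mapsto> a)) g = Some b" using g(1) by simp
        then show ?thesis unfolding set_decode_pcode[OF x'] g(2) by blast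
      qed
    qed
  qed
  moreover have "?q \<notin> set_decode (pcode x)" using mem_pcode[OF x one_closed] e by (auto simp: domIff)
  ultimately have "set_encode (set_decode (pcode (x(\<one> \<mapsto> a)))) = 2 ^ ?q + set_encode (set_decode (pcode x))"
    by simp
  then show ?thesis by simp
qed

lemma based_code_iff:
  fixes Ps :: "('a, 'c::finite) config set"
  assumes Ps: "pattern_set G Ps"
  shows "based_code (range (to_nat :: 'c \<Rightarrow> nat)) (patterns_code G n h k Ps) \<longleftrightarrow> based Ps"
proof -
  let ?A = "range (to_nat :: 'c \<Rightarrow> nat)"
  have "(pcode P = 0 \<or> (\<exists>a<Suc (Max ?A). prod_encode (code \<one>, a) \<in> set_decode (pcode P))) \<longleftrightarrow> dom P = {} \<or> \<one> \<in> dom P"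
    if "P \<in> Ps" for P
  proof -
    have P: "finite_config P" by (rule pattern_set_finite_config[OF Ps that])
    have emp: "finite_config (Map.empty :: ('a, 'c) config)" unfolding finite_config_def by simp
    have "pcode (Map.empty :: ('a, 'c) config) = 0" unfolding pattern_code_def by simp
    then have "pcode P = 0 \<longleftrightarrow> dom P = {}" using pcode_inj[OF P emp] by auto
    moreover have "(\<exists>a<Suc (Max ?A). prod_encode (code \<one>, a) \<in> set_decode (pcode P)) \<longleftrightarrow> \<one> \<in> dom P"
    proof
      assume "\<exists>a<Suc (Max ?A). prod_encode (code \<one>, a) \<in> set_decode (pcode P)"
      then obtain a where "prod_encode (code \<one>, a) \<in> set_decode (pcode P)" by blast
      then obtain g' a' where ga: "g' \<in> carrier G" "P g' = Some a'" "prod_encode (code \<one>, a) = prod_encode (code g', to_nat a')"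
        by (rule mem_pcodeE[OF P]) blast
      then have "\<one> = g'" using code_inj[OF one_closed ga(1)] by simp
      then show "\<one> \<in> dom P" using ga(2) by blast
    next
      assume "\<one> \<in> dom P"
      then obtain a where "P \<one> = Some a" by blast
      then have "prod_encode (code \<one>, to_nat a) \<in> set_decode (pcode P)" using mem_pcode[OF P one_closed] by simp
      then show "\<exists>a<Suc (Max ?A). prod_encode (code \<one>, a) \<in> set_decode (pcode P)"
        using to_nat_less_Suc_Max[of a] by blast
    qed
    ultimately show ?thesis by simp
  qed
  then show ?thesis unfolding based_code_def based_def set_decode_patterns_code[OF Ps] by (simp cong: ball_cong)
qed

context
  fixes M :: "nat \<Rightarrow> nat"
  assumes M: "\<forall>a\<in>carrier G. \<forall>b\<in>carrier G. M (prod_encode (code a, code b)) = code (a \<otimes> b)"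
begin

lemma M_code: "a \<in> carrier G \<Longrightarrow> b \<in> carrier G \<Longrightarrow> M (prod_encode (code a, code b)) = code (a \<otimes> b)"
  using M by blast

lemma occurs_code_iff:
  fixes x :: "('a, 'c::finite) config"
  assumes Ps: "pattern_set G Ps" and x: "finite_config x"
  shows "occurs_code M N (patterns_code G n h k Ps) (pcode x) \<longleftrightarrow> occurs_within (ball N) Ps x"
proof -
  have one: "(\<forall>q\<in>set_decode (pcode P). prod_encode (M (prod_encode (code g, pfst q)), psnd q) \<in> set_decode (pcode x))
      \<longleftrightarrow> occ_at g P x" if P: "P \<in> Ps" and g: "g \<in> ball N" for P g
  proof -
    have gc: "g \<in> carrier G" using g unfolding ball_def by simp
    have "(\<forall>q\<in>set_decode (pcode P). prod_encode (M (prod_encode (code g, pfst q)), psnd q) \<in> set_decode (pcode x))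
      \<longleftrightarrow> (\<forall>d a. P d = Some a \<longrightarrow> prod_encode (M (prod_encode (code g, code d)), to_nat a) \<in> set_decode (pcode x))"
      by (rule ball_pcode_iff[OF pattern_set_finite_config[OF Ps P]])
    also have "\<dots> \<longleftrightarrow> (\<forall>d a. P d = Some a \<longrightarrow> x (g \<otimes> d) = Some a)"
    proof -
      have "prod_encode (M (prod_encode (code g, code d)), to_nat a) \<in> set_decode (pcode x) \<longleftrightarrow> x (g \<otimes> d) = Some a"
        if "P d = Some a" for d a
      proof -
        have dc: "d \<in> carrier G" using pattern_setD(1)[OF Ps P] that by blast
        show ?thesis unfolding M_code[OF gc dc] by (rule mem_pcode[OF x m_closed[OF gc dc]])
      qed
      then show ?thesis by (simp cong: imp_cong)
    qed
    also have "\<dots> \<longleftrightarrow> occ_at g P x"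
    proof
      assume a: "\<forall>d a. P d = Some a \<longrightarrow> x (g \<otimes> d) = Some a"
      show "occ_at g P x" unfolding occ_at_def
      proof
        fix d assume "d \<in> dom P"
        then obtain a where "P d = Some a" by blast
        then show "x (g \<otimes> d) = P d" using a by simp
      qed
    next
      assume occ: "occ_at g P x"
      show "\<forall>d a. P d = Some a \<longrightarrow> x (g \<otimes> d) = Some a"
      proof (intro allI impI)
        fix d a assume "P d = Some a"
        then show "x (g \<otimes> d) = Some a" using bspec[OF occ[unfolded occ_at_def], of d] by auto
      qed
    qed
    finally show ?thesis .
  qed
  have "occurs_code M N (patterns_code G n h k Ps) (pcode x) \<longleftrightarrow> (\<exists>P\<in>Ps. \<exists>g\<in>ball N.
      \<forall>q\<in>set_decode (pcode P). prod_encode (M (prod_encode (code g, pfst q)), psnd q) \<in> set_decode (pcode x))"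
    unfolding occurs_code_def set_decode_patterns_code[OF Ps] ex_valid_code_iff by simp
  also have "\<dots> \<longleftrightarrow> occurs_within (ball N) Ps x"
    unfolding occurs_within_def by (rule bex_cong[OF refl], rule bex_cong[OF refl], rule one)
  finally show ?thesis .
qed

lemma refutes_code_iff:
  fixes F :: "('a, 'c::finite) config set"
  assumes F: "pattern_set G F" and P: "finite_config P"
  shows "refutes_code M (range (to_nat :: 'c \<Rightarrow> nat)) N (patterns_code G n h k F) (pcode P) \<longleftrightarrow> refutes (ball N) F P"
proof -
  let ?A = "range (to_nat :: 'c \<Rightarrow> nat)"
  have dom: "(\<forall>q\<in>set_decode (pcode P). pfst q < N) \<longleftrightarrow> dom P \<subseteq> ball N"
  proof -
    have "(\<forall>q\<in>set_decode (pcode P). pfst q < N) \<longleftrightarrow> (\<forall>g a. P g = Some a \<longrightarrow> code g < N)"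
      by (rule ball_pcode_iff[OF P])
    also have "\<dots> \<longleftrightarrow> dom P \<subseteq> ball N"
      using P unfolding finite_config_def ball_def by auto
    finally show ?thesis .
  qed
  have le: "(\<forall>q\<in>set_decode (pcode P). q \<in> set_decode (pcode x)) \<longleftrightarrow> P \<subseteq>\<^sub>m x" if x: "finite_config x" for x :: "('a, 'c) config"
  proof -
    have "(\<forall>q\<in>set_decode (pcode P). prod_encode (pfst q, psnd q) \<in> set_decode (pcode x)) \<longleftrightarrow>
        (\<forall>g a. P g = Some a \<longrightarrow> prod_encode (code g, to_nat a) \<in> set_decode (pcode x))"
      by (rule ball_pcode_iff[OF P])
    also have "\<dots> \<longleftrightarrow> (\<forall>g a. P g = Some a \<longrightarrow> x g = Some a)"
    proof -
      have "prod_encode (code g, to_nat a) \<in> set_decode (pcode x) \<longleftrightarrow> x g = Some a" if "P g = Some a" for g a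
        by (rule mem_pcode[OF x]) (use that P in \<open>auto simp: finite_config_def\<close>)
      then show ?thesis by (simp cong: imp_cong)
    qed
    also have "\<dots> \<longleftrightarrow> P \<subseteq>\<^sub>m x"
    proof
      assume a: "\<forall>g a. P g = Some a \<longrightarrow> x g = Some a"
      show "P \<subseteq>\<^sub>m x" unfolding map_le_def
      proof
        fix g assume "g \<in> dom P"
        then obtain a where "P g = Some a" by blast
        then show "P g = x g" using a by simp
      qed
    next
      assume a: "P \<subseteq>\<^sub>m x"
      show "\<forall>g a. P g = Some a \<longrightarrow> x g = Some a"
      proof (intro allI impI)
        fix g a assume ga: "P g = Some a"
        then have "P g = x g" using bspec[OF a[unfolded map_le_def], of g] by auto
        then show "x g = Some a" using ga by simp
      qed
    qed
    finally show ?thesis by simp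
  qed
  have "refutes_code M ?A N (patterns_code G n h k F) (pcode P) \<longleftrightarrow> dom P \<subseteq> ball N \<and>
     (\<forall>x :: ('a, 'c) config. dom x = {g \<in> ball N. True} \<longrightarrow> (\<forall>q\<in>set_decode (pcode P). q \<in> set_decode (pcode x)) \<longrightarrow>
        occurs_code M N (patterns_code G n h k F) (pcode x))"
    unfolding refutes_code_def dom all_configs_iff ..
  also have "\<dots> \<longleftrightarrow> refutes (ball N) F P"
  proof -
    have "((\<forall>q\<in>set_decode (pcode P). q \<in> set_decode (pcode x)) \<longrightarrow> occurs_code M N (patterns_code G n h k F) (pcode x))
        \<longleftrightarrow> (P \<subseteq>\<^sub>m x \<longrightarrow> occurs_within (ball N) F x)" if "dom x = ball N" for x :: "('a, 'c) config"
    proof -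
      have x: "finite_config x" by (rule finite_config_ball[of _ N]) (use that in simp)
      show ?thesis unfolding le[OF x] occurs_code_iff[OF F x] ..
    qed
    then show ?thesis unfolding refutes_def by (simp cong: imp_cong)
  qed
  finally show ?thesis .
qed

lemma extendable_code_iff:
  fixes Ps :: "('a, 'c::finite) config set"
  assumes Ps: "pattern_set G Ps"
  shows "extendable_code M (range (to_nat :: 'c \<Rightarrow> nat)) N (patterns_code G n h k Ps) u \<longleftrightarrow>
    one_step_extendable (ball N) Ps (layers 0 (coded_tuple u))"
proof -
  let ?A = "range (to_nat :: 'c \<Rightarrow> nat)" and ?p = "patterns_code G n h k Ps"
  have dom: "{g \<in> ball N. in_coded_layers u (code g)} = layers 0 (coded_tuple u) \<inter> ball N"
    using in_coded_layers_iff unfolding ball_def by blast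
  have "extendable_code M ?A N ?p u \<longleftrightarrow>
     (\<forall>x :: ('a, 'c) config. dom x = layers 0 (coded_tuple u) \<inter> ball N \<longrightarrow> \<not> occurs_code M N ?p (pcode x) \<longrightarrow>
       (\<exists>a<Suc (Max ?A). a \<in> ?A \<and> \<not> occurs_code M N ?p (pcode x + 2 ^ prod_encode (code \<one>, a))))"
    unfolding extendable_code_def all_configs_iff dom ..
  also have "\<dots> \<longleftrightarrow> one_step_extendable (ball N) Ps (layers 0 (coded_tuple u))"
  proof -
    have "(\<not> occurs_code M N ?p (pcode x) \<longrightarrow>
       (\<exists>a<Suc (Max ?A). a \<in> ?A \<and> \<not> occurs_code M N ?p (pcode x + 2 ^ prod_encode (code \<one>, a)))) \<longleftrightarrow>
       (\<not> occurs_within (ball N) Ps x \<longrightarrow> (\<exists>a. \<not> occurs_within (ball N) Ps (x(\<one> \<mapsto> a))))"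
      if d: "dom x = layers 0 (coded_tuple u) \<inter> ball N" for x :: "('a, 'c) config"
    proof -
      have x: "finite_config x" by (rule finite_config_ball[of _ N]) (use d in blast)
      have e: "\<one> \<notin> dom x" using one_notin_layers[OF grazing_coded_tuple] d by blast
      have x': "finite_config (x(\<one> \<mapsto> a))" for a using x unfolding finite_config_def by simp
      have "occurs_code M N ?p (pcode x + 2 ^ prod_encode (code \<one>, to_nat a)) \<longleftrightarrow> occurs_within (ball N) Ps (x(\<one> \<mapsto> a))" for a
        unfolding pcode_upd[OF x e, symmetric] by (rule occurs_code_iff[OF Ps x'])
      note upd = this
      have "(\<exists>a<Suc (Max ?A). a \<in> ?A \<and> \<not> occurs_code M N ?p (pcode x + 2 ^ prod_encode (code \<one>, a))) \<longleftrightarrow>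
          (\<exists>a :: 'c. \<not> occurs_code M N ?p (pcode x + 2 ^ prod_encode (code \<one>, to_nat a)))"
        using to_nat_less_Suc_Max by blast
      then show ?thesis unfolding upd occurs_code_iff[OF Ps x] by simp
    qed
    then show ?thesis unfolding one_step_extendable_def by (simp cong: imp_cong)
  qed
  finally show ?thesis .
qed

lemma fits_code_iff:
  fixes Ps :: "('a, 'c::finite) config set"
  assumes Ps: "pattern_set G Ps"
  shows "fits_code M N (patterns_code G n h k Ps) \<longleftrightarrow> fits (ball N) Ps"
proof -
  have one: "(\<forall>q\<in>set_decode (pcode P). \<exists>g<N. valid_code g \<and> M (prod_encode (g, pfst q)) = code \<one> \<and>
      (\<forall>q'\<in>set_decode (pcode P). M (prod_encode (g, pfst q')) < N)) \<longleftrightarrow>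
    (\<forall>d\<in>dom P. inv d \<in> ball N \<and> (\<forall>d'\<in>dom P. inv d \<otimes> d' \<in> ball N))" if "P \<in> Ps" for P
  proof -
    have P: "finite_config P" by (rule pattern_set_finite_config[OF Ps that])
    have Pc: "d \<in> carrier G" if "d \<in> dom P" for d using P that unfolding finite_config_def by blast
    have inner: "(\<forall>q'\<in>set_decode (pcode P). M (prod_encode (code g, pfst q')) < N) \<longleftrightarrow> (\<forall>d'\<in>dom P. g \<otimes> d' \<in> ball N)"
      if g: "g \<in> carrier G" for g
    proof -
      have "(\<forall>q'\<in>set_decode (pcode P). M (prod_encode (code g, pfst q')) < N) \<longleftrightarrow>
          (\<forall>d a. P d = Some a \<longrightarrow> M (prod_encode (code g, code d)) < N)" by (rule ball_pcode_iff[OF P])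
      also have "\<dots> \<longleftrightarrow> (\<forall>d\<in>dom P. M (prod_encode (code g, code d)) < N)" by auto
      also have "\<dots> \<longleftrightarrow> (\<forall>d'\<in>dom P. g \<otimes> d' \<in> ball N)"
        by (rule ball_cong[OF refl]) (use M_code[OF g Pc] m_closed[OF g Pc] in \<open>simp add: ball_def\<close>)
      finally show ?thesis .
    qed
    have outer: "(\<exists>g<N. valid_code g \<and> M (prod_encode (g, code d)) = code \<one> \<and>
      (\<forall>q'\<in>set_decode (pcode P). M (prod_encode (g, pfst q')) < N)) \<longleftrightarrow>
      inv d \<in> ball N \<and> (\<forall>d'\<in>dom P. inv d \<otimes> d' \<in> ball N)" if d: "d \<in> dom P" for d
    proof -
      have dc: "d \<in> carrier G" using Pc d .
      have "(\<exists>g<N. valid_code g \<and> M (prod_encode (g, code d)) = code \<one> \<and>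
        (\<forall>q'\<in>set_decode (pcode P). M (prod_encode (g, pfst q')) < N)) \<longleftrightarrow>
        (\<exists>g\<in>ball N. M (prod_encode (code g, code d)) = code \<one> \<and>
        (\<forall>q'\<in>set_decode (pcode P). M (prod_encode (code g, pfst q')) < N))" by (rule ex_valid_code_iff)
      also have "\<dots> \<longleftrightarrow> (\<exists>g\<in>ball N. g = inv d \<and> (\<forall>d'\<in>dom P. g \<otimes> d' \<in> ball N))"
      proof (rule bex_cong[OF refl])
        fix g assume "g \<in> ball N"
        then have g: "g \<in> carrier G" unfolding ball_def by simp
        have "M (prod_encode (code g, code d)) = code \<one> \<longleftrightarrow> g = inv d"
        proof
          assume "M (prod_encode (code g, code d)) = code \<one>"
          then have "g \<otimes> d = \<one>" unfolding M_code[OF g dc] using code_inj[OF m_closed[OF g dc] one_closed] by blast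
          then show "g = inv d" using inv_equality[of g d] g dc by simp
        next
          assume "g = inv d"
          then show "M (prod_encode (code g, code d)) = code \<one>" unfolding M_code[OF g dc] using dc by simp
        qed
        then show "(M (prod_encode (code g, code d)) = code \<one> \<and>
          (\<forall>q'\<in>set_decode (pcode P). M (prod_encode (code g, pfst q')) < N)) \<longleftrightarrow>
          (g = inv d \<and> (\<forall>d'\<in>dom P. g \<otimes> d' \<in> ball N))" unfolding inner[OF g] by simp
      qed
      also have "\<dots> \<longleftrightarrow> inv d \<in> ball N \<and> (\<forall>d'\<in>dom P. inv d \<otimes> d' \<in> ball N)" by blast
      finally show ?thesis .
    qed
    have "(\<forall>q\<in>set_decode (pcode P). \<exists>g<N. valid_code g \<and> M (prod_encode (g, pfst q)) = code \<one> \<and>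
        (\<forall>q'\<in>set_decode (pcode P). M (prod_encode (g, pfst q')) < N)) \<longleftrightarrow>
      (\<forall>d a. P d = Some a \<longrightarrow> (\<exists>g<N. valid_code g \<and> M (prod_encode (g, code d)) = code \<one> \<and>
        (\<forall>q'\<in>set_decode (pcode P). M (prod_encode (g, pfst q')) < N)))"
      by (rule ball_pcode_iff[OF P])
    also have "\<dots> \<longleftrightarrow> (\<forall>d\<in>dom P. \<exists>g<N. valid_code g \<and> M (prod_encode (g, code d)) = code \<one> \<and>
        (\<forall>q'\<in>set_decode (pcode P). M (prod_encode (g, pfst q')) < N))" by auto
    also have "\<dots> \<longleftrightarrow> (\<forall>d\<in>dom P. inv d \<in> ball N \<and> (\<forall>d'\<in>dom P. inv d \<otimes> d' \<in> ball N))"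
      by (rule ball_cong[OF refl outer])
    finally show ?thesis .
  qed
  have "fits_code M N (patterns_code G n h k Ps) \<longleftrightarrow> (\<forall>P\<in>Ps. \<forall>q\<in>set_decode (pcode P). \<exists>g<N. valid_code g \<and>
     M (prod_encode (g, pfst q)) = code \<one> \<and> (\<forall>q'\<in>set_decode (pcode P). M (prod_encode (g, pfst q')) < N))"
    unfolding fits_code_def set_decode_patterns_code[OF Ps] by simp
  also have "\<dots> \<longleftrightarrow> fits (ball N) Ps" unfolding fits_def by (rule ball_cong[OF refl one])
  finally show ?thesis .
qed

theorem certificate_code_iff:
  fixes F Ps :: "('a, 'c::finite) config set"
  assumes F: "pattern_set G F" and Ps: "pattern_set G Ps"
  shows "certificate_code M (range (to_nat :: 'c \<Rightarrow> nat)) (patterns_code G n h k F) (patterns_code G n h k Ps) N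
    \<longleftrightarrow> certificate F Ps (ball N)"
proof -
  let ?A = "range (to_nat :: 'c \<Rightarrow> nat)"
  have all: "(\<forall>P\<in>set_decode (patterns_code G n h k Qs). refutes_code M ?A N (patterns_code G n h k Fs) P) \<longleftrightarrow>
      (\<forall>P\<in>Qs. refutes (ball N) Fs P)" if Fs: "pattern_set G Fs" and Qs: "pattern_set G Qs" for Fs Qs :: "('a, 'c) config set"
  proof -
    have "(\<forall>P\<in>set_decode (patterns_code G n h k Qs). refutes_code M ?A N (patterns_code G n h k Fs) P) \<longleftrightarrow>
      (\<forall>P\<in>Qs. refutes_code M ?A N (patterns_code G n h k Fs) (pcode P))"
      unfolding set_decode_patterns_code[OF Qs] by simp
    also have "\<dots> \<longleftrightarrow> (\<forall>P\<in>Qs. refutes (ball N) Fs P)"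
      by (rule ball_cong[OF refl refutes_code_iff[OF Fs pattern_set_finite_config[OF Qs]]])
    finally show ?thesis .
  qed
  have one: "code \<one> < N \<longleftrightarrow> \<one> \<in> ball N" unfolding ball_def by simp
  show ?thesis
    unfolding certificate_code_def certificate_def one all[OF F Ps] all[OF Ps F]
      based_code_iff[OF Ps] fits_code_iff[OF Ps] extendable_code_iff[OF Ps] all_one_step_extendable_iff ..
qed

end

end

section \<open>The search for a certificate\<close>

context polycyclic
begin

lemma dec_valid_pattern:
  assumes A: "finite A" and f: "computable f"
  shows "decidable (\<lambda>z. valid_pattern A (f z))"
  unfolding valid_pattern_def
  by (intro dec_ball dec_conj dec_valid_code dec_finite[OF A] dec_imp dec_eq comp_pfst comp_psnd comp_id
      comp_compose[OF f] f)

lemma dec_occurs_code: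
  assumes M: "computable M" and f: "computable N" "computable Ps" "computable x"
  shows "decidable (\<lambda>z. occurs_code M (N z) (Ps z) (x z))"
  unfolding occurs_code_def
  by (intro dec_bex dec_ex_less dec_conj dec_valid_code dec_ball dec_mem comp_pair comp_compose[OF M]
      comp_pfst comp_psnd comp_id f comp_compose[OF f(1)] comp_compose[OF f(2)] comp_compose[OF f(3)])

lemma dec_domain_code:
  assumes S: "decidable (\<lambda>z. S (psnd z) (pfst z))" and f: "computable N" "computable x"
  shows "decidable (\<lambda>z. domain_code A (S z) (N z) (x z))"
  unfolding domain_code_def
  by (intro dec_conj dec_ball dec_all_less dec_iff dec_ex_less dec_valid_code dec_less dec_mem S comp_pair
      comp_pfst comp_psnd comp_id f comp_compose[OF f(1)] comp_compose[OF f(2)] comp_const)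

lemma comp_config_bound: "computable N \<Longrightarrow> computable (\<lambda>z. config_bound A (N z))"
  unfolding config_bound_def by (intro comp_power2 comp_pair comp_const)

lemma dec_refutes_code:
  assumes M: "computable M" and A: "finite A" and f: "computable N" "computable F" "computable P"
  shows "decidable (\<lambda>z. refutes_code M A (N z) (F z) (P z))"
  unfolding refutes_code_def
  by (intro dec_conj dec_ball dec_less dec_all_less dec_imp dec_valid_pattern[OF A] dec_domain_code dec_const
      dec_occurs_code[OF M] dec_mem comp_config_bound
      comp_pfst comp_psnd comp_id f comp_compose[OF f(1)] comp_compose[OF f(2)] comp_compose[OF f(3)])

lemma dec_extendable_code:
  assumes M: "computable M" and A: "finite A" and f: "computable N" "computable Ps" "computable u"
  shows "decidable (\<lambda>z. extendable_code M A (N z) (Ps z) (u z))"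
  unfolding extendable_code_def
  by (intro dec_conj dec_all_less dec_ex_less dec_imp dec_not dec_valid_pattern[OF A] dec_domain_code
      dec_in_coded_layers dec_occurs_code[OF M] dec_finite[OF A] comp_config_bound comp_add comp_power2 comp_pair
      comp_pfst comp_psnd comp_id comp_const f comp_compose[OF f(1)] comp_compose[OF f(2)] comp_compose[OF f(3)])

lemma dec_based_code: "computable Ps \<Longrightarrow> decidable (\<lambda>z. based_code A (Ps z))"
  unfolding based_code_def
  by (intro dec_ball dec_disj dec_eq dec_ex_less dec_mem comp_pair comp_pfst comp_psnd comp_id comp_const)

lemma dec_fits_code:
  assumes M: "computable M" and f: "computable N" "computable Ps"
  shows "decidable (\<lambda>z. fits_code M (N z) (Ps z))"
  unfolding fits_code_def
  by (intro dec_ball dec_ex_less dec_conj dec_valid_code dec_eq dec_less comp_pair comp_compose[OF M]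
      comp_pfst comp_psnd comp_id comp_const f comp_compose[OF f(1)] comp_compose[OF f(2)])

lemma dec_certificate_code:
  assumes M: "computable M" and A: "finite A" and f: "computable F" "computable Ps" "computable N"
  shows "decidable (\<lambda>z. certificate_code M A (F z) (Ps z) (N z))"
  unfolding certificate_code_def
  by (intro dec_conj dec_less dec_based_code dec_fits_code[OF M] dec_ball dec_refutes_code[OF M A]
      dec_all_less dec_extendable_code[OF M A] comp_tuple_bound comp_Suc
      comp_pfst comp_psnd comp_id comp_const f comp_compose[OF f(1)] comp_compose[OF f(2)] comp_compose[OF f(3)])

text \<open>
  The search has to output only codes of pattern sets, which is ensured by testing each member with \<open>valid_pattern\<close>.
\<close>

lemma patterns_code_surj:
  assumes "\<forall>P\<in>set_decode y. valid_pattern (range (to_nat :: 'c::finite \<Rightarrow> nat)) P"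
  shows "\<exists>Ps :: ('a, 'c) config set. pattern_set G Ps \<and> y = patterns_code G n h k Ps"
proof -
  define Ps where "Ps = {P :: ('a, 'c) config. finite_config P \<and> pcode P \<in> set_decode y}"
  have img: "pcode ` Ps = set_decode y"
  proof
    show "set_decode y \<subseteq> pcode ` Ps"
    proof
      fix x assume x: "x \<in> set_decode y"
      then obtain P :: "('a, 'c) config" where "finite_config P" "x = pcode P"
        using assms valid_pattern_iff by blast
      then show "x \<in> pcode ` Ps" unfolding Ps_def using x by blast
    qed
  qed (auto simp: Ps_def)
  have "inj_on pcode Ps" using pcode_inj unfolding Ps_def by (auto intro!: inj_onI)
  then have "finite Ps" using finite_imageD[of pcode Ps] img by simp
  then have "pattern_set G Ps" unfolding pattern_set_def Ps_def finite_config_def by auto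
  moreover have "y = patterns_code G n h k Ps" unfolding patterns_code_def img by simp
  ultimately show ?thesis by blast
qed

text \<open>
  The search runs over all pairs of a code of patterns and a window size. Completeness yields a certificate on every sufficiently
  large window, hence on some \<open>ball N\<close>.
\<close>

theorem search_program:
  "\<exists>p. \<forall>F :: ('a, 'c::finite) config set. pattern_set G F \<longrightarrow>
    (\<forall>y. recf_eval p [patterns_code G n h k F] y \<longrightarrow>
      (\<exists>Ps N. pattern_set G Ps \<and> y = patterns_code G n h k Ps \<and> certificate F Ps (ball N))) \<and>
    (II_avoshift G n H h k (SFT G F) \<longrightarrow> (\<exists>y. recf_eval p [patterns_code G n h k F] y))"
proof -
  let ?A = "range (to_nat :: 'c \<Rightarrow> nat)"
  obtain M where Mc: "computable M"
    and M: "\<forall>a\<in>carrier G. \<forall>b\<in>carrier G. M (prod_encode (code a, code b)) = code (a \<otimes> b)"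
    using multiplication_computable by blast
  define Q where "Q z x \<longleftrightarrow> (\<forall>P\<in>set_decode (pfst z). valid_pattern ?A P) \<and>
      certificate_code M ?A x (pfst z) (psnd z)" for z x
  have "decidable (\<lambda>w. Q (pfst w) (psnd w))" unfolding Q_def
    by (intro dec_conj dec_ball dec_valid_pattern dec_certificate_code Mc comp_pfst comp_psnd comp_id) simp_all
  from recf_search[OF this comp_pfst[OF comp_id]] obtain p where p:
    "\<forall>x. (\<forall>y. recf_eval p [x] y \<longrightarrow> (\<exists>z. Q z x \<and> y = pfst z)) \<and> ((\<exists>z. Q z x) \<longrightarrow> (\<exists>y. recf_eval p [x] y))" ..
  have p1: "\<exists>z. Q z x \<and> y = pfst z" if "recf_eval p [x] y" for x y using p that by blast
  have p2: "\<exists>y. recf_eval p [x] y" if "Q z x" for x z using p that by blast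
  have sound: "\<exists>Ps N. pattern_set G Ps \<and> y = patterns_code G n h k Ps \<and> certificate F Ps (ball N)"
    if F: "pattern_set G F" and y: "recf_eval p [patterns_code G n h k F] y" for F :: "('a, 'c) config set" and y
  proof -
    obtain z where z: "Q z (patterns_code G n h k F)" "y = pfst z" using p1[OF y] by blast
    then have "\<forall>P\<in>set_decode y. valid_pattern ?A P" unfolding Q_def by blast
    from patterns_code_surj[OF this] obtain Ps :: "('a, 'c) config set"
      where Ps: "pattern_set G Ps" "y = patterns_code G n h k Ps" by blast
    have "certificate_code M ?A (patterns_code G n h k F) (patterns_code G n h k Ps) (psnd z)"
      using z Ps(2) unfolding Q_def by simp
    then have "certificate F Ps (ball (psnd z))" unfolding certificate_code_iff[OF M F Ps(1)] .
    then show ?thesis using Ps by blast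
  qed
  have complete: "\<exists>y. recf_eval p [patterns_code G n h k F] y"
    if F: "pattern_set G F" and avo: "II_avoshift G n H h k (SFT G F)" for F :: "('a, 'c) config set"
  proof -
    from certificate_complete[OF F avo] obtain Ps B0 where Ps: "pattern_set G Ps" and B0: "finite B0" "B0 \<subseteq> carrier G"
      and cert: "\<forall>B. finite B \<longrightarrow> B0 \<subseteq> B \<longrightarrow> B \<subseteq> carrier G \<longrightarrow> certificate F Ps B" by blast
    define N where "N = Suc (Max (insert 0 (code ` B0)))"
    have "B0 \<subseteq> ball N"
    proof
      fix b assume b: "b \<in> B0"
      then have "code b \<le> Max (insert 0 (code ` B0))" using B0(1) by (intro Max_ge) auto
      then show "b \<in> ball N" unfolding ball_def N_def using b B0(2) by auto
    qed
    moreover have "ball N \<subseteq> carrier G" unfolding ball_def by blast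
    ultimately have "certificate F Ps (ball N)" using cert finite_ball by blast
    then have "certificate_code M ?A (patterns_code G n h k F) (patterns_code G n h k Ps) N"
      unfolding certificate_code_iff[OF M F Ps] .
    moreover have "\<forall>P\<in>set_decode (patterns_code G n h k Ps). valid_pattern ?A P"
      unfolding set_decode_patterns_code[OF Ps] using pattern_set_finite_config[OF Ps] valid_pattern_iff by blast
    ultimately have "Q (prod_encode (patterns_code G n h k Ps, N)) (patterns_code G n h k F)"
      unfolding Q_def by simp
    then show ?thesis by (rule p2)
  qed
  show ?thesis using sound complete by blast
qed

lemma in_H_iff_entries:
  assumes i: "i \<le> n" and g: "g \<in> carrier G"
  shows "g \<in> H i \<longleftrightarrow> (\<forall>l<n. i \<le> l \<longrightarrow> entry l (code g) = 0)"
proof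
  assume "g \<in> H i"
  then obtain t where t: "\<And>l. i \<le> l \<Longrightarrow> t (Suc l) = 0" "code g = vcode (\<lambda>l. int_encode (t (Suc l)))"
    using elt_of_H[OF i] by metis
  show "\<forall>l<n. i \<le> l \<longrightarrow> entry l (code g) = 0" unfolding t(2) using t(1) by (simp add: int_encode_0)
next
  assume z: "\<forall>l<n. i \<le> l \<longrightarrow> entry l (code g) = 0"
  obtain t where t: "g = elt t n" "code g = vcode (\<lambda>l. int_encode (t (Suc l)))"
    using elt_of_H[of n g] g H_n by auto
  have "t (Suc l) = 0" if "i \<le> l" "l < n" for l
  proof -
    have "entry l (code g) = 0" using z that by blast
    then show ?thesis unfolding t(2) using that(2) by (simp add: int_encode_eq_0)
  qed
  then have "elt t n = elt t i" using i by (intro elt_extend) auto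
  then show "g \<in> H i" unfolding t(1) using elt_in_H[OF i] by simp
qed

lemma comp_patterns_in_H:
  fixes i :: nat
  assumes i: "i \<le> n"
  shows "\<exists>f. computable f \<and> (\<forall>Ps :: ('a, 'c::finite) config set. pattern_set G Ps \<longrightarrow>
    f (patterns_code G n h k Ps) = patterns_code G n h k {P \<in> Ps. dom P \<subseteq> H i})"
proof -
  define Z where "Z P \<longleftrightarrow> (\<forall>q\<in>set_decode P. \<forall>l<n. i \<le> l \<longrightarrow> entry l (pfst q) = 0)" for P
  have "decidable Z" unfolding Z_def
    by (intro dec_ball dec_all_fixed dec_imp dec_const dec_eq comp_entry comp_pfst comp_id comp_const)
  from comp_filter[OF comp_id this] have "computable (\<lambda>y. set_encode {P \<in> set_decode y. Z P})" .
  moreover have "set_encode {P \<in> set_decode (patterns_code G n h k Ps). Z P} = patterns_code G n h k {P \<in> Ps. dom P \<subseteq> H i}"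
    if Ps: "pattern_set G Ps" for Ps :: "('a, 'c) config set"
  proof -
    have Z: "Z (pcode P) \<longleftrightarrow> dom P \<subseteq> H i" if P: "P \<in> Ps" for P
    proof -
      have "Z (pcode P) \<longleftrightarrow> (\<forall>g a. P g = Some a \<longrightarrow> (\<forall>l<n. i \<le> l \<longrightarrow> entry l (code g) = 0))"
        unfolding Z_def by (rule ball_pcode_iff[OF pattern_set_finite_config[OF Ps P]])
      also have "\<dots> \<longleftrightarrow> (\<forall>g\<in>dom P. \<forall>l<n. i \<le> l \<longrightarrow> entry l (code g) = 0)" by auto
      also have "\<dots> \<longleftrightarrow> (\<forall>g\<in>dom P. g \<in> H i)"
        by (rule ball_cong[OF refl in_H_iff_entries[OF i pattern_setD(1)[OF Ps P], symmetric]])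
      finally show ?thesis by blast
    qed
    have "{x \<in> pcode ` Ps. Z x} = pcode ` {P \<in> Ps. dom P \<subseteq> H i}" using Z by blast
    then show ?thesis
      by (simp only: set_decode_patterns_code[OF Ps] patterns_code_def[of G n h k "{P \<in> Ps. dom P \<subseteq> H i}"])
  qed
  ultimately show ?thesis by (intro exI[of _ "\<lambda>y. set_encode {P \<in> set_decode y. Z P}"] conjI allI impI)
qed

text \<open>
  If a based pattern \<open>P\<close> occurs at \<open>g\<close> in a configuration with domain \<open>H i\<close>, then \<open>g = g \<otimes> \<one>\<close> belongs to \<open>H i\<close> and so does \<open>dom P\<close>. Thus the
  occurrences in the sense of \<open>G\<close> and of \<open>H i\<close> coincide.
\<close>

lemma restr_H_is_SFT:
  fixes F Ps :: "('a, 'c::finite) config set"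
  assumes i: "i \<le> n" and based: "based Ps" and Ps: "pattern_set G Ps"
    and def: "defines_restr G Ps (SFT G F) (H i)"
  shows "restr (SFT G F) (H i) = SFT (G\<lparr>carrier := H i\<rparr>) {P \<in> Ps. dom P \<subseteq> H i}"
proof -
  let ?K = "G\<lparr>carrier := H i\<rparr>"
  interpret K: group ?K by (rule subgroup_imp_group[OF H_subgroup[OF i]])
  have occ: "K.occ_at g P x \<longleftrightarrow> occ_at g P x" for g x and P :: "('a, 'c) config"
    unfolding K.occ_at_def occ_at_def by simp
  have av: "avoids Ps x \<longleftrightarrow> K.avoids {P \<in> Ps. dom P \<subseteq> H i} x" if x: "dom x = H i" for x :: "('a, 'c) config"
  proof
    assume a: "avoids Ps x"
    show "K.avoids {P \<in> Ps. dom P \<subseteq> H i} x"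
      unfolding K.avoids_def
    proof (intro ballI)
      fix P g assume "P \<in> {P \<in> Ps. dom P \<subseteq> H i}" "g \<in> carrier ?K"
      then have "P \<in> Ps" "g \<in> carrier G" using H_carrier[OF i] by auto
      then show "\<not> K.occ_at g P x" unfolding occ using a unfolding avoids_def by blast
    qed
  next
    assume a: "K.avoids {P \<in> Ps. dom P \<subseteq> H i} x"
    show "avoids Ps x" unfolding avoids_def
    proof (intro ballI notI)
      fix P g assume P: "P \<in> Ps" "g \<in> carrier G" "occ_at g P x"
      have dom: "g \<otimes> d \<in> H i" if "d \<in> dom P" for d
      proof -
        have "x (g \<otimes> d) \<noteq> None" using P(3) that unfolding occ_at_def by (auto simp: domIff)
        then show ?thesis using x by blast
      qed
      show False
      proof (cases "dom P = {}")
        case True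
        then have "K.occ_at \<one> P x" unfolding K.occ_at_def by simp
        moreover have "\<one> \<in> carrier ?K" "P \<in> {P \<in> Ps. dom P \<subseteq> H i}" using H_one[OF i] P(1) True by auto
        ultimately show False using a unfolding K.avoids_def by blast
      next
        case False
        then have "\<one> \<in> dom P" using bspec[OF based[unfolded based_def] P(1)] False by blast
        from dom[OF this] have g: "g \<in> H i" using P(2) by simp
        have "dom P \<subseteq> H i"
        proof
          fix d assume d: "d \<in> dom P"
          have "inv g \<otimes> (g \<otimes> d) \<in> H i" by (rule H_mult[OF i H_inv[OF i g] dom[OF d]])
          then show "d \<in> H i" using P(2) pattern_setD(1)[OF Ps P(1) d] by (simp add: m_assoc[symmetric])
        qed
        then have "P \<in> {P \<in> Ps. dom P \<subseteq> H i}" using P(1) by blast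
        moreover have "K.occ_at g P x" unfolding occ by (rule P(3))
        ultimately show False using a g unfolding K.avoids_def by auto
      qed
    qed
  qed
  show ?thesis
  proof (rule Set.set_eqI)
    fix x
    have "dom x = H i" if "x \<in> restr (SFT G F) (H i)"
    proof -
      obtain y where "y \<in> SFT G F" "x = y |` H i" using \<open>x \<in> restr (SFT G F) (H i)\<close> restr_iff by blast
      then show ?thesis using SFT_iff[of y F] H_carrier[OF i] by auto
    qed
    moreover have "x \<in> restr (SFT G F) (H i) \<longleftrightarrow> avoids Ps x" if "dom x = H i"
      using def that unfolding defines_restr_iff by blast
    ultimately show "x \<in> restr (SFT G F) (H i) \<longleftrightarrow> x \<in> SFT ?K {P \<in> Ps. dom P \<subseteq> H i}"
      unfolding K.SFT_iff using av by auto
  qed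
qed

lemma polycyclic_H:
  assumes i: "i \<le> n"
  shows "polycyclic (G\<lparr>carrier := H i\<rparr>) i H h k"
proof (intro polycyclic.intro polycyclic_axioms.intro)
  let ?K = "G\<lparr>carrier := H i\<rparr>"
  show "group ?K" by (rule subgroup_imp_group[OF H_subgroup[OF i]])
  show "H 0 = {\<one>\<^bsub>?K\<^esub>}" using H_0 by simp
  show "H i = carrier ?K" by simp
  have pow: "h (Suc j) [^]\<^bsub>?K\<^esub> t = h (Suc j) [^] t" if "j < i" for j and t :: int
    using int_pow_consistent[OF H_subgroup[OF i] h_in_H[OF that i]] by simp
  fix j
  show "subgroup (H j) ?K" if "j \<le> i"
    using subgroup_incl[OF H_subgroup H_subgroup[OF i] H_mono[OF that i]] that i by simp
  assume j: "j < i"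
  then have jn: "j < n" using i by simp
  show "H j \<subseteq> H (Suc j)" by (rule H_mono_Suc[OF jn])
  show "h (Suc j) \<in> H (Suc j)" by (rule h_in[OF jn])
  show "x \<otimes>\<^bsub>?K\<^esub> u \<otimes>\<^bsub>?K\<^esub> inv\<^bsub>?K\<^esub> x \<in> H j" if "x \<in> H (Suc j)" "u \<in> H j" for x u
  proof -
    have "x \<in> H i" using that(1) H_mono[of "Suc j" i] j i by auto
    then have "inv\<^bsub>?K\<^esub> x = inv x" by (rule m_inv_consistent[OF H_subgroup[OF i]])
    then show ?thesis using H_conj[OF jn that] by simp
  qed
  show "\<exists>t::int. \<exists>u\<in>H j. g = h (Suc j) [^]\<^bsub>?K\<^esub> t \<otimes>\<^bsub>?K\<^esub> u" if "g \<in> H (Suc j)" for g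
    using h_generates[OF jn that] pow[OF j] by simp
  show "h (Suc j) [^]\<^bsub>?K\<^esub> t \<in> H j \<longleftrightarrow> int (k (Suc j)) dvd t" for t
    using h_pow_iff[OF jn] pow[OF j] by simp
qed

lemma inductive_interval_H:
  assumes i: "i \<le> n" and C: "inductive_interval (G\<lparr>carrier := H i\<rparr>) i H h k C"
  shows "inductive_interval G n H h k C" "C \<subseteq> H i"
proof -
  let ?K = "G\<lparr>carrier := H i\<rparr>"
  interpret K: polycyclic ?K i H h k by (rule polycyclic_H[OF i])
  obtain T where T: "\<forall>l<i. grazes (k (Suc l)) (T l)" "C = K.layers 0 T"
    using C unfolding K.inductive_interval_iff by blast
  have layer: "K.layer l S = layer l S" if "l < i" for l S
    unfolding K.layer_def layer_def
    using int_pow_consistent[OF H_subgroup[OF i] h_in_H[OF that i]] by simp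
  let ?T = "\<lambda>l. if l < i then T l else {}"
  have "C = layers 0 ?T"
  proof -
    have "layers 0 ?T = (\<Union>l\<in>{0..<n}. if l < i then layer l (T l) else {})"
      unfolding layers_def by (rule SUP_cong) auto
    also have "\<dots> = (\<Union>l\<in>{0..<i}. layer l (T l))"
    proof
      show "(\<Union>l\<in>{0..<i}. layer l (T l)) \<subseteq> (\<Union>l\<in>{0..<n}. if l < i then layer l (T l) else {})"
      proof (rule UN_least)
        fix l assume "l \<in> {0..<i}"
        then have l: "l \<in> {0..<n}" "l < i" using i by auto
        have "layer l (T l) \<subseteq> (if l < i then layer l (T l) else {})" using l(2) by simp
        also have "\<dots> \<subseteq> (\<Union>l\<in>{0..<n}. if l < i then layer l (T l) else {})" by (rule UN_upper[OF l(1)])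
        finally show "layer l (T l) \<subseteq> (\<Union>l\<in>{0..<n}. if l < i then layer l (T l) else {})" .
      qed
    qed (auto split: if_splits)
    also have "\<dots> = C" unfolding T(2) K.layers_def using layer by auto
    finally show ?thesis ..
  qed
  moreover have "\<forall>l<n. grazes (k (Suc l)) (?T l)" using T(1) by (simp add: grazes_def)
  ultimately show "inductive_interval G n H h k C" unfolding inductive_interval_iff
    by (intro exI[of _ ?T] conjI)
  show "C \<subseteq> H i" unfolding T(2) using K.layers_carrier by simp
qed

end

context group
begin

text \<open>
  The complement is a union of cylinders, one for each occurrence of a forbidden pattern.
\<close>

lemma subshift_SFT:
  fixes F :: "('a, 'c::finite) config set"
  assumes F: "pattern_set G F"
  shows "subshift G (SFT G F)"
proof -
  let ?T = "product_topology (\<lambda>_. discrete_topology (UNIV :: 'c set)) (carrier G)"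
  let ?t = "\<lambda>x :: ('a, 'c) config. \<lambda>g\<in>carrier G. the (x g)"
  let ?O = "\<lambda>P g. {z \<in> topspace ?T. \<forall>d\<in>dom P. Some (z (g \<otimes> d)) = P d}"
  have "openin ?T {z \<in> topspace ?T. \<forall>d\<in>D. Some (z (g \<otimes> d)) = P d}"
    if "finite D" "D \<subseteq> carrier G" "g \<in> carrier G" for D g and P :: "('a, 'c) config"
    using that
  proof (induction rule: finite_induct)
    case empty
    have "{z \<in> topspace ?T. \<forall>d\<in>{}. Some (z (g \<otimes> d)) = P d} = topspace ?T" by blast
    then show ?case using openin_topspace[of ?T] by (simp only:)
  next
    case (insert d D)
    have "g \<otimes> d \<in> carrier G" using insert.prems by simp
    then have "continuous_map ?T (discrete_topology UNIV) (\<lambda>z. z (g \<otimes> d))"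
      by (rule continuous_map_product_projection)
    then have "openin ?T {z \<in> topspace ?T. z (g \<otimes> d) \<in> {a. Some a = P d}}"
      by (rule openin_continuous_map_preimage) simp
    moreover have "openin ?T {z \<in> topspace ?T. \<forall>d\<in>D. Some (z (g \<otimes> d)) = P d}" using insert by simp
    ultimately have "openin ?T ({z \<in> topspace ?T. z (g \<otimes> d) \<in> {a. Some a = P d}} \<inter>
        {z \<in> topspace ?T. \<forall>d\<in>D. Some (z (g \<otimes> d)) = P d})" by (rule openin_Int)
    moreover have "{z \<in> topspace ?T. z (g \<otimes> d) \<in> {a. Some a = P d}} \<inter>
        {z \<in> topspace ?T. \<forall>d\<in>D. Some (z (g \<otimes> d)) = P d} =
        {z \<in> topspace ?T. \<forall>d\<in>insert d D. Some (z (g \<otimes> d)) = P d}" by blast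
    ultimately show ?case by simp
  qed
  then have open_occ: "openin ?T (?O P g)" if "P \<in> F" "g \<in> carrier G" for P g
    using that pattern_setD(2)[OF F that(1)] pattern_setD(1)[OF F that(1)] by blast
  have top: "topspace ?T = Pi\<^sub>E (carrier G) (\<lambda>_. UNIV)" by simp
  have occ_iff: "occ_at g P x \<longleftrightarrow> ?t x \<in> ?O P g"
    if x: "dom x = carrier G" and P: "P \<in> F" and g: "g \<in> carrier G" for x P g
  proof -
    have "x (g \<otimes> d) = P d \<longleftrightarrow> Some (?t x (g \<otimes> d)) = P d" if "d \<in> dom P" for d
    proof -
      have gd: "g \<otimes> d \<in> carrier G" using pattern_setD(1)[OF F P that] g by simp
      then obtain a where "x (g \<otimes> d) = Some a" using x by blast
      then show ?thesis using gd by simp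
    qed
    then have "occ_at g P x \<longleftrightarrow> (\<forall>d\<in>dom P. Some (?t x (g \<otimes> d)) = P d)"
      unfolding occ_at_def by (rule ball_cong[OF refl])
    then show ?thesis unfolding top by simp
  qed
  have "?t ` SFT G F = topspace ?T - (\<Union>P\<in>F. \<Union>g\<in>carrier G. ?O P g)"
  proof
    show "?t ` SFT G F \<subseteq> topspace ?T - (\<Union>P\<in>F. \<Union>g\<in>carrier G. ?O P g)"
    proof
      fix z assume "z \<in> ?t ` SFT G F"
      then obtain x where x: "x \<in> SFT G F" "z = ?t x" by blast
      have d: "dom x = carrier G" and a: "avoids F x" using x(1) SFT_iff by blast+
      have "z \<notin> ?O P g" if "P \<in> F" "g \<in> carrier G" for P g
        unfolding x(2) occ_iff[OF d that, symmetric] using a that unfolding avoids_def by blast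
      moreover have "z \<in> topspace ?T" unfolding top x(2) by simp
      ultimately show "z \<in> topspace ?T - (\<Union>P\<in>F. \<Union>g\<in>carrier G. ?O P g)" by blast
    qed
    show "topspace ?T - (\<Union>P\<in>F. \<Union>g\<in>carrier G. ?O P g) \<subseteq> ?t ` SFT G F"
    proof
      fix z assume z: "z \<in> topspace ?T - (\<Union>P\<in>F. \<Union>g\<in>carrier G. ?O P g)"
      define x where "x g = (if g \<in> carrier G then Some (z g) else None)" for g
      have d: "dom x = carrier G" unfolding x_def by (auto split: if_splits)
      have "z \<in> Pi\<^sub>E (carrier G) (\<lambda>_. UNIV)" using z unfolding top by blast
      then have zx: "z = ?t x" unfolding x_def by (auto simp: PiE_iff extensional_def fun_eq_iff)
      have "avoids F x" unfolding avoids_def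
      proof (intro ballI)
        fix P g assume P: "P \<in> F" "g \<in> carrier G"
        have "z \<notin> ?O P g" using z P by blast
        then show "\<not> occ_at g P x" unfolding occ_iff[OF d P] zx[symmetric] .
      qed
      then have "x \<in> SFT G F" unfolding SFT_iff using d by blast
      then show "z \<in> ?t ` SFT G F" unfolding zx by blast
    qed
  qed
  moreover have "openin ?T (\<Union>g\<in>carrier G. ?O P g)" if "P \<in> F" for P
    by (rule openin_Union) (use open_occ[OF that] in blast)
  then have "openin ?T (\<Union>P\<in>F. \<Union>g\<in>carrier G. ?O P g)" by (intro openin_Union) blast
  then have "closedin ?T (topspace ?T - (\<Union>P\<in>F. \<Union>g\<in>carrier G. ?O P g))" by (rule closedin_diff[OF closedin_topspace])
  ultimately have "closed_configs (carrier G) (SFT G F)" unfolding closed_configs_def by simp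
  moreover have "\<forall>x\<in>SFT G F. dom x = carrier G" using SFT_iff by blast
  moreover have "\<forall>g\<in>carrier G. \<forall>x\<in>SFT G F. shift G g x \<in> SFT G F" using shift_SFT[OF _ F] by blast
  ultimately show ?thesis unfolding subshift_def by blast
qed

end

context polycyclic
begin

text \<open>
  The inductive intervals of \<open>H i\<close> are inductive intervals of \<open>G\<close> with empty layers above, and the avo property
  involves only restrictions to subsets of \<open>H i\<close>.
\<close>

lemma II_avoshift_H:
  fixes F Ps :: "('a, 'c::finite) config set"
  assumes i: "i \<le> n" and avo: "II_avoshift G n H h k (SFT G F)"
    and Q: "pattern_set (G\<lparr>carrier := H i\<rparr>) Q" "restr (SFT G F) (H i) = SFT (G\<lparr>carrier := H i\<rparr>) Q"
  shows "II_avoshift (G\<lparr>carrier := H i\<rparr>) i H h k (restr (SFT G F) (H i))"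
  unfolding II_avoshift_def
proof (intro conjI allI impI)
  let ?K = "G\<lparr>carrier := H i\<rparr>"
  interpret K: group ?K by (rule subgroup_imp_group[OF H_subgroup[OF i]])
  show "subshift ?K (restr (SFT G F) (H i))" unfolding Q(2) by (rule K.subshift_SFT[OF Q(1)])
  fix C assume C: "inductive_interval ?K i H h k C"
  have sub: "C \<subseteq> H i" by (rule inductive_interval_H(2)[OF i C])
  have rr: "restr (restr (SFT G F) (H i)) D = restr (SFT G F) D" if "D \<subseteq> H i" for D
  proof -
    have "(y |` H i) |` D = y |` D" for y :: "('a, 'c) config" by (rule restrict_restrict_subset[OF that])
    then show ?thesis unfolding restr_def image_image by simp
  qed
  have "avo G (SFT G F) C" using avo inductive_interval_H(1)[OF i C] unfolding II_avoshift_def by blast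
  then obtain B where B: "finite B" "B \<subseteq> C" "\<forall>x\<in>restr (SFT G F) C. \<forall>a.
     (x |` B)(\<one> \<mapsto> a) \<in> restr (SFT G F) (B \<union> {\<one>}) \<longleftrightarrow> x(\<one> \<mapsto> a) \<in> restr (SFT G F) (C \<union> {\<one>})"
    unfolding avo_def by blast
  have "B \<union> {\<one>} \<subseteq> H i" "C \<union> {\<one>} \<subseteq> H i" using B(2) sub H_one[OF i] by auto
  note r = rr[OF sub] rr[OF this(1)] rr[OF this(2)]
  show "avo ?K (restr (SFT G F) (H i)) C"
    unfolding avo_def
  proof (intro exI[of _ B] conjI)
    have one: "\<one>\<^bsub>?K\<^esub> = \<one>" by simp
    show "\<forall>x\<in>restr (restr (SFT G F) (H i)) C. \<forall>a.
     (x |` B)(\<one>\<^bsub>?K\<^esub> \<mapsto> a) \<in> restr (restr (SFT G F) (H i)) (B \<union> {\<one>\<^bsub>?K\<^esub>}) \<longleftrightarrow>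
     x(\<one>\<^bsub>?K\<^esub> \<mapsto> a) \<in> restr (restr (SFT G F) (H i)) (C \<union> {\<one>\<^bsub>?K\<^esub>})"
      unfolding one r by (rule B(3))
  qed (rule B(1,2))+
qed

end


theorem theorem8p5:
  fixes G :: "('g, 'b) monoid_scheme"
    and n :: nat and H :: "nat \<Rightarrow> 'g set" and h :: "nat \<Rightarrow> 'g" and k :: "nat \<Rightarrow> nat"
  assumes "polycycle_structure G n H h k"
  shows
    "(\<exists>p. \<forall>F :: ('g, 'a::finite) config set. pattern_set G F \<longrightarrow>
        (\<forall>y. recf_eval p [patterns_code G n h k F] y \<longrightarrow>
           (\<exists>Ps :: ('g, 'a) config set. pattern_set G Ps \<and> y = patterns_code G n h k Ps \<and>
              (\<forall>C. inductive_interval G n H h k C \<longrightarrow> defines_restr G Ps (SFT G F) C))) \<and>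
        (II_avoshift G n H h k (SFT G F) \<longrightarrow>
           (\<exists>y. recf_eval p [patterns_code G n h k F] y)))
     \<and>
     (\<forall>i\<le>n.
        (\<forall>F :: ('g, 'a) config set.
           pattern_set G F \<and> II_avoshift G n H h k (SFT G F) \<longrightarrow>
             II_avoshift (G\<lparr>carrier := H i\<rparr>) i H h k (restr (SFT G F) (H i))) \<and>
        (\<exists>q. \<forall>F :: ('g, 'a) config set.
           pattern_set G F \<and> II_avoshift G n H h k (SFT G F) \<longrightarrow>
             (\<exists>Q :: ('g, 'a) config set. pattern_set (G\<lparr>carrier := H i\<rparr>) Q \<and>
                recf_eval q [patterns_code G n h k F] (patterns_code G n h k Q) \<and>
                restr (SFT G F) (H i) = SFT (G\<lparr>carrier := H i\<rparr>) Q)))"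
proof (intro conjI allI impI)
  interpret polycyclic G n H h k by (rule polycyclic_if_structure[OF assms])
  have ball: "ball N \<subseteq> carrier G" for N unfolding ball_def by blast
  obtain p where found: "\<And>F y. pattern_set G F \<Longrightarrow> recf_eval p [patterns_code G n h k F] y \<Longrightarrow>
      \<exists>(Ps :: ('g, 'a) config set) N. pattern_set G Ps \<and> y = patterns_code G n h k Ps \<and> certificate (F :: ('g, 'a) config set) Ps (ball N)"
    and halts: "\<And>F :: ('g, 'a) config set. pattern_set G F \<Longrightarrow> II_avoshift G n H h k (SFT G F) \<Longrightarrow>
      \<exists>y. recf_eval p [patterns_code G n h k F] y"
    using search_program[where 'c = 'a] by metis
  show "\<exists>p. \<forall>F :: ('g, 'a) config set. pattern_set G F \<longrightarrow>
        (\<forall>y. recf_eval p [patterns_code G n h k F] y \<longrightarrow>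
           (\<exists>Ps :: ('g, 'a) config set. pattern_set G Ps \<and> y = patterns_code G n h k Ps \<and>
              (\<forall>C. inductive_interval G n H h k C \<longrightarrow> defines_restr G Ps (SFT G F) C))) \<and>
        (II_avoshift G n H h k (SFT G F) \<longrightarrow>
           (\<exists>y. recf_eval p [patterns_code G n h k F] y))"
  proof (intro exI[of _ p] allI impI conjI)
    fix F :: "('g, 'a) config set" and y
    assume F: "pattern_set G F" and y: "recf_eval p [patterns_code G n h k F] y"
    obtain Ps :: "('g, 'a) config set" and N where Ps: "pattern_set G Ps" "y = patterns_code G n h k Ps"
        "certificate F Ps (ball N)" using found[OF F y] by (elim exE conjE)
    have "defines_restr G Ps (SFT G F) C" if C: "inductive_interval G n H h k C" for C
    proof -
      obtain T where T: "\<forall>l<n. grazes (k (Suc l)) (T l)" "C = layers 0 T"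
        using C unfolding inductive_interval_iff by (elim exE conjE)
      then show ?thesis
        using certificate_sound(2)[OF F Ps(1) ball Ps(3)] unfolding grazing_tuple_def T(2) by simp
    qed
    then show "\<exists>Ps :: ('g, 'a) config set. pattern_set G Ps \<and> y = patterns_code G n h k Ps \<and>
              (\<forall>C. inductive_interval G n H h k C \<longrightarrow> defines_restr G Ps (SFT G F) C)"
      by (intro exI[of _ Ps] conjI allI impI Ps(1,2))
  next
    fix F :: "('g, 'a) config set"
    assume "pattern_set G F" "II_avoshift G n H h k (SFT G F)"
    then show "\<exists>y. recf_eval p [patterns_code G n h k F] y" by (rule halts)
  qed
  fix i assume i: "i \<le> n"
  let ?K = "G\<lparr>carrier := H i\<rparr>"
  let ?Q = "\<lambda>Ps :: ('g, 'a) config set. {P\<in>Ps. dom P \<subseteq> H i}"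
  have Q: "\<exists>Ps :: ('g, 'a) config set. recf_eval p [patterns_code G n h k F] (patterns_code G n h k Ps) \<and>
      pattern_set G Ps \<and> pattern_set ?K (?Q Ps) \<and> restr (SFT G F) (H i) = SFT ?K (?Q Ps)"
    if F: "pattern_set G F" and avo: "II_avoshift G n H h k (SFT G F)" for F :: "('g, 'a) config set"
  proof -
    obtain y where y: "recf_eval p [patterns_code G n h k F] y" using halts[OF F avo] ..
    obtain Ps :: "('g, 'a) config set" and N where Ps: "pattern_set G Ps" "y = patterns_code G n h k Ps"
        "certificate F Ps (ball N)" using found[OF F y] by (elim exE conjE)
    have "based Ps" using Ps(3) unfolding certificate_def by simp
    note restr_H_is_SFT[OF i this Ps(1) certificate_sound(3)[OF F Ps(1) ball Ps(3) i]]
    moreover have "pattern_set ?K (?Q Ps)" using Ps(1) unfolding pattern_set_def by simp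
    ultimately show ?thesis using y Ps(1) unfolding Ps(2) by (intro exI[of _ Ps] conjI)
  qed
  show "II_avoshift ?K i H h k (restr (SFT G F) (H i))"
    if "pattern_set G F \<and> II_avoshift G n H h k (SFT G F)" for F :: "('g, 'a) config set"
  proof -
    have F: "pattern_set G F" "II_avoshift G n H h k (SFT G F)" using that by simp_all
    obtain Ps :: "('g, 'a) config set" where "pattern_set ?K (?Q Ps)" "restr (SFT G F) (H i) = SFT ?K (?Q Ps)"
      using Q[OF F] by (elim exE conjE)
    then show ?thesis by (rule II_avoshift_H[OF i F(2)])
  qed
  obtain f where f: "computable f" "\<And>Ps :: ('g, 'a) config set. pattern_set G Ps \<Longrightarrow> f (patterns_code G n h k Ps) = patterns_code G n h k (?Q Ps)"
    using comp_patterns_in_H[OF i, where 'c = 'a] by metis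
  obtain r where r: "\<And>x. recf_eval r [x] (f x)" using f(1) unfolding computable_def by metis
  show "\<exists>q. \<forall>F :: ('g, 'a) config set.
           pattern_set G F \<and> II_avoshift G n H h k (SFT G F) \<longrightarrow>
             (\<exists>Q :: ('g, 'a) config set. pattern_set ?K Q \<and>
                recf_eval q [patterns_code G n h k F] (patterns_code G n h k Q) \<and>
                restr (SFT G F) (H i) = SFT ?K Q)"
  \<comment> \<open>The search, followed by the selection of the patterns with domain inside \<open>H i\<close>.\<close>
  proof (intro exI[of _ "recf.Comp r [p]"] allI impI)
    fix F :: "('g, 'a) config set"
    assume "pattern_set G F \<and> II_avoshift G n H h k (SFT G F)"
    then have F: "pattern_set G F" "II_avoshift G n H h k (SFT G F)" by simp_all
    obtain Ps :: "('g, 'a) config set" where Ps: "recf_eval p [patterns_code G n h k F] (patterns_code G n h k Ps)"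
        "pattern_set G Ps" "pattern_set ?K (?Q Ps)" "restr (SFT G F) (H i) = SFT ?K (?Q Ps)"
      using Q[OF F] by (elim exE conjE)
    have "recf_eval (recf.Comp r [p]) [patterns_code G n h k F] (f (patterns_code G n h k Ps))"
      by (rule recf_eval.Comp[of "[patterns_code G n h k Ps]"]) (use Ps(1) r in simp_all)
    then show "\<exists>Q :: ('g, 'a) config set. pattern_set ?K Q \<and>
                recf_eval (recf.Comp r [p]) [patterns_code G n h k F] (patterns_code G n h k Q) \<and>
                restr (SFT G F) (H i) = SFT ?K Q"
      unfolding f(2)[OF Ps(2)] by (intro exI[of _ "?Q Ps"] conjI Ps(3,4))
  qed
qed

end
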